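(* Let $F\in\mathcal{DM}^{\mathrm{ext}}(\Omega)$, and let $U\Subset\Omega$ be open. Then there is an $\mathcal L^1$-null set $\mathcal N\subset(0,\infty)$ such that, for any $\varepsilon\in(0,\infty)\setminus\mathcal N$, there exists a measure $(F\cdot\nu)_{\partial U^{\varepsilon}}$ supported on $\partial U^{\varepsilon}$ such that $$\langle F\cdot\nu,\phi\rangle_{\partial U^{\varepsilon}}=\int_{\partial U^{\varepsilon}}\phi\,\mathrm d(F\cdot\nu)_{\partial U^{\varepsilon}}\qquad\text{for any }\phi\in W^{1,\infty}(\Omega).$$ Moreover, for every sequence $\varepsilon_k\to0$ with $\varepsilon_k\notin\mathcal N$ (and $\varepsilon_k>0$), the normal trace of $F$ on $\partial U$ is the limit of these trace measures: $$\langle F\cdot\nu,\phi\rangle_{\partial U}=\lim_{k\to\infty}\int_{\partial U^{\varepsilon_k}}\phi\,\mathrm d(F\cdot\nu)_{\partial U^{\varepsilon_k}}\qquad\text{for any }\phi\in W^{1,\infty}(\Omega).$$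
   Context: Let $n\ge2$ and let $\Omega\subset\mathbb R^n$ be open. $A\Subset\Omega$ means that $\overline A$ is compact and $\overline A\subset\Omega$. $\mathcal{DM}^{\mathrm{ext}}(\Omega)$ is the space of finite $\mathbb R^n$-valued Radon measures $F$ on $\Omega$ whose distributional divergence, $\langle\operatorname{div}F,\varphi\rangle=-\int_\Omega\nabla\varphi\cdot \mathrm dF$ for $\varphi\in C_c^\infty(\Omega)$, is a finite signed Radon measure $\operatorname{div}F$ on $\Omega$. Pairing: for $\phi\in W^{1,\infty}(\Omega)$ (continuous representative), $\overline{\nabla\phi\cdot F}$ is the finite signed Radon measure on $\Omega$ characterized by $\int_\Omega\psi\,\mathrm d\overline{\nabla\phi\cdot F}=\lim_{\delta\to0}\int_\Omega\psi\,\nabla\phi_\delta\cdot \mathrm dF$ for all $\psi\in C_c(\Omega)$, where $\phi_\delta=\phi*\rho_\delta$ and $\rho_\delta$ is a standard mollifier. It is known that this limit exists, that $\phi F\in\mathcal{DM}^{\mathrm{ext}}(\Omega)$, that $\operatorname{div}(\phi F)=\phi\operatorname{div}F+\overline{\nabla\phi\cdot F}$, and $|\overline{\nabla\phi\cdot F}|\le\|\nabla\phi\|_{L^\infty(\Omega)}|F|$. Normal trace: for a Borel set $E\Subset\Omega$ and $\phi\in W^{1,\infty}(\Omega)$, $\langle F\cdot\nu,\phi\rangle_{\partial E}:=-\int_E\phi\,\mathrm d(\operatorname{div}F)-\int_E\mathrm d\overline{\nabla\phi\cdot F}$. For $\varepsilon>0$ and $U$ open, $U^\varepsilon=\{x\in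 U:\operatorname{dist}(x,\partial U)>\varepsilon\}$. $\mathcal L^1$ is Lebesgue measure. *)

theory Defs
  imports "HOL-Analysis.Analysis"
begin

section \<open>Finite signed and vector-valued Radon measures\<close>

text \<open>
  A finite (signed or vector-valued) Radon measure on an open subset \<open>\<Omega>\<close> of a Euclidean space is a
  countably additive set function on the Borel subsets of \<open>\<Omega>\<close>: finiteness of the total variation
  and inner/outer regularity are then automatic. As for \<^const>\<open>emeasure\<close>, the
  value on sets that are not Borel subsets of \<open>\<Omega>\<close> is fixed to be 0, so that equality of
  measures is equality of functions.
\<close>

abbreviation borel_subsets :: "'a::topological_space set \<Rightarrow> 'a set set" where
  "borel_subsets \<Omega> \<equiv> sets (restrict_space borel \<Omega>)"

definition radon_measure_on ::
  "'a::topological_space set \<Rightarrow> ('a set \<Rightarrow> 'b::real_normed_vector) \<Rightarrow> bool" where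
  "radon_measure_on \<Omega> \<mu> \<longleftrightarrow>
     (\<forall>A. range A \<subseteq> borel_subsets \<Omega> \<longrightarrow> disjoint_family A \<longrightarrow>
        (\<lambda>i::nat. \<mu> (A i)) sums \<mu> (\<Union>i. A i)) \<and>
     (\<forall>A. A \<notin> borel_subsets \<Omega> \<longrightarrow> \<mu> A = 0)"

text \<open>Positive part of the Jordan decomposition; \<^const>\<open>ennreal\<close> sends negative reals to 0, and
  \<open>B = {}\<close> always competes in the supremum.\<close>

definition pos_part :: "'a::topological_space set \<Rightarrow> ('a set \<Rightarrow> real) \<Rightarrow> 'a measure" where
  "pos_part \<Omega> \<mu> = measure_of \<Omega> (borel_subsets \<Omega>)
     (\<lambda>A. SUP B\<in>{B \<in> borel_subsets \<Omega>. B \<subseteq> A}. ennreal (\<mu> B))"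

definition neg_part :: "'a::topological_space set \<Rightarrow> ('a set \<Rightarrow> real) \<Rightarrow> 'a measure" where
  "neg_part \<Omega> \<mu> = pos_part \<Omega> (\<lambda>A. - \<mu> A)"

definition signed_integral ::
  "'a::topological_space set \<Rightarrow> ('a set \<Rightarrow> real) \<Rightarrow> ('a \<Rightarrow> real) \<Rightarrow> real" where
  "signed_integral \<Omega> \<mu> f = (\<integral>x. f x \<partial>pos_part \<Omega> \<mu>) - (\<integral>x. f x \<partial>neg_part \<Omega> \<mu>)"

definition signed_set_integral ::
  "'a::topological_space set \<Rightarrow> 'a set \<Rightarrow> ('a set \<Rightarrow> real) \<Rightarrow> ('a \<Rightarrow> real) \<Rightarrow> real" where
  "signed_set_integral \<Omega> E \<mu> f = signed_integral \<Omega> \<mu> (\<lambda>x. indicator E x * f x)"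

text \<open>The integral of \<open>G \<bullet> dF\<close> for a vector field \<open>G\<close> and a vector-valued measure \<open>F\<close>.\<close>

definition vector_integral ::
  "'a::euclidean_space set \<Rightarrow> ('a set \<Rightarrow> 'a) \<Rightarrow> ('a \<Rightarrow> 'a) \<Rightarrow> real" where
  "vector_integral \<Omega> F G = (\<Sum>b\<in>Basis. signed_integral \<Omega> (\<lambda>A. F A \<bullet> b) (\<lambda>x. G x \<bullet> b))"

text \<open>For \<open>K\<close> relatively closed in \<open>\<Omega>\<close> this says that the support of \<open>\<mu>\<close> is contained
  in \<open>K\<close>: the total variation of \<open>\<mu>\<close> vanishes on \<open>\<Omega> - K\<close>.\<close>

definition supported_on ::
  "'a::topological_space set \<Rightarrow> ('a set \<Rightarrow> real) \<Rightarrow> 'a set \<Rightarrow> bool" where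
  "supported_on \<Omega> \<mu> K \<longleftrightarrow> (\<forall>A\<in>borel_subsets \<Omega>. A \<inter> K = {} \<longrightarrow> \<mu> A = 0)"


section \<open>Test functions, Sobolev functions and mollification\<close>

definition grad :: "('a::euclidean_space \<Rightarrow> real) \<Rightarrow> 'a \<Rightarrow> 'a" where
  "grad f x = (THE D. GDERIV f x :> D)"

primrec Ck :: "nat \<Rightarrow> ('a::euclidean_space \<Rightarrow> real) \<Rightarrow> bool" where
  "Ck 0 f \<longleftrightarrow> continuous_on UNIV f"
| "Ck (Suc k) f \<longleftrightarrow> f differentiable_on UNIV \<and> (\<forall>b\<in>Basis. Ck k (\<lambda>x. grad f x \<bullet> b))"

text \<open>Functions compactly supported in \<open>\<Omega>\<close> are functions on the whole space
  (extended by zero).\<close>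

definition Cc :: "'a::euclidean_space set \<Rightarrow> ('a \<Rightarrow> real) set" where
  "Cc \<Omega> = {f. continuous_on UNIV f \<and> compact (closure {x. f x \<noteq> 0}) \<and> closure {x. f x \<noteq> 0} \<subseteq> \<Omega>}"

definition Cc_inf :: "'a::euclidean_space set \<Rightarrow> ('a \<Rightarrow> real) set" where
  "Cc_inf \<Omega> = {f \<in> Cc \<Omega>. \<forall>k. Ck k f}"

definition L_inf :: "'a::euclidean_space set \<Rightarrow> ('a \<Rightarrow> 'b::euclidean_space) set" where
  "L_inf \<Omega> = {f \<in> borel_measurable (lebesgue_on \<Omega>). \<exists>C. AE x in lebesgue_on \<Omega>. norm (f x) \<le> C}"

text \<open>Continuous representatives of the elements of \<open>W\<^sup>1\<^sup>,\<^sup>\<infinity>(\<Omega>)\<close>; \<open>g\<close> is the weak gradient.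
  Values outside \<open>\<Omega>\<close> are irrelevant.\<close>

definition W1_inf :: "'a::euclidean_space set \<Rightarrow> ('a \<Rightarrow> real) set" where
  "W1_inf \<Omega> = {\<phi> \<in> L_inf \<Omega>. continuous_on \<Omega> \<phi> \<and>
     (\<exists>g \<in> L_inf \<Omega>. \<forall>\<psi>\<in>Cc_inf \<Omega>.
        (\<integral>x. \<phi> x *\<^sub>R grad \<psi> x \<partial>lebesgue_on \<Omega>) = - (\<integral>x. \<psi> x *\<^sub>R g x \<partial>lebesgue_on \<Omega>))}"

text \<open>Rotation invariance is not demanded, so every usual choice of standard mollifier is covered;
  the pairing below does not depend on it.\<close>

definition standard_mollifier :: "('a::euclidean_space \<Rightarrow> real) \<Rightarrow> bool" where
  "standard_mollifier \<rho> \<longleftrightarrow> \<rho> \<in> Cc_inf (UNIV :: 'a set) \<and> (\<forall>x. 0 \<le> \<rho> x) \<and>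
     (\<forall>x. 1 < norm x \<longrightarrow> \<rho> x = 0) \<and> (\<integral>x. \<rho> x \<partial>lebesgue) = 1"

text \<open>\<open>\<phi> * \<rho>\<^sub>\<delta>\<close> with \<open>\<phi>\<close> extended by zero outside \<open>\<Omega>\<close>, where
  \<open>\<rho>\<^sub>\<delta>(z) = \<delta>\<^sup>-\<^sup>n \<rho>(z/\<delta>)\<close>. On a compact subset of \<open>\<Omega>\<close> the extension plays no role
  once \<open>\<delta>\<close> is small.\<close>

definition mollify ::
  "('a::euclidean_space \<Rightarrow> real) \<Rightarrow> 'a set \<Rightarrow> real \<Rightarrow> ('a \<Rightarrow> real) \<Rightarrow> 'a \<Rightarrow> real" where
  "mollify \<rho> \<Omega> \<delta> \<phi> x =
     (\<integral>y. \<phi> y * (\<rho> ((x - y) /\<^sub>R \<delta>) / \<delta> ^ DIM('a)) \<partial>lebesgue_on \<Omega>)"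


section \<open>Divergence-measure fields, pairing and normal trace\<close>

definition is_divergence ::
  "'a::euclidean_space set \<Rightarrow> ('a set \<Rightarrow> 'a) \<Rightarrow> ('a set \<Rightarrow> real) \<Rightarrow> bool" where
  "is_divergence \<Omega> F \<mu> \<longleftrightarrow> radon_measure_on \<Omega> \<mu> \<and>
     (\<forall>\<phi>\<in>Cc_inf \<Omega>. signed_integral \<Omega> \<mu> \<phi> = - vector_integral \<Omega> F (grad \<phi>))"

definition DM_ext :: "'a::euclidean_space set \<Rightarrow> ('a set \<Rightarrow> 'a) set" where
  "DM_ext \<Omega> = {F. radon_measure_on \<Omega> F \<and> (\<exists>\<mu>. is_divergence \<Omega> F \<mu>)}"

definition divergence ::
  "'a::euclidean_space set \<Rightarrow> ('a set \<Rightarrow> 'a) \<Rightarrow> ('a set \<Rightarrow> real)" where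
  "divergence \<Omega> F = (THE \<mu>. is_divergence \<Omega> F \<mu>)"

definition pairing :: "('a::euclidean_space \<Rightarrow> real) \<Rightarrow> 'a set \<Rightarrow> ('a \<Rightarrow> real) \<Rightarrow>
    ('a set \<Rightarrow> 'a) \<Rightarrow> ('a set \<Rightarrow> real)" where
  "pairing \<rho> \<Omega> \<phi> F = (THE \<mu>. radon_measure_on \<Omega> \<mu> \<and>
     (\<forall>\<psi>\<in>Cc \<Omega>. ((\<lambda>\<delta>. vector_integral \<Omega> F (\<lambda>x. \<psi> x *\<^sub>R grad (mollify \<rho> \<Omega> \<delta> \<phi>) x))
        \<longlongrightarrow> signed_integral \<Omega> \<mu> \<psi>) (at_right 0)))"

definition normal_trace :: "('a::euclidean_space \<Rightarrow> real) \<Rightarrow> 'a set \<Rightarrow> ('a set \<Rightarrow> 'a) \<Rightarrow>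
    'a set \<Rightarrow> ('a \<Rightarrow> real) \<Rightarrow> real" where
  "normal_trace \<rho> \<Omega> F E \<phi> =
     - signed_set_integral \<Omega> E (divergence \<Omega> F) \<phi>
     - signed_set_integral \<Omega> E (pairing \<rho> \<Omega> \<phi> F) (\<lambda>_. 1)"

definition compactly_inside :: "'a::topological_space set \<Rightarrow> 'a set \<Rightarrow> bool"
    (infix \<open>\<Subset>\<close> 50) where
  "A \<Subset> \<Omega> \<longleftrightarrow> compact (closure A) \<and> closure A \<subseteq> \<Omega>"

text \<open>A bounded open set has empty frontier only if it is itself empty, so the convention
  \<open>infdist x {} = 0\<close> is harmless for the sets considered.\<close>

definition inner_set :: "'a::euclidean_space set \<Rightarrow> real \<Rightarrow> 'a set" where
  "inner_set U \<epsilon> = {x \<in> U. infdist x (frontier U) > \<epsilon>}"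

end

theory Submission
  imports Defs
begin

text \<open>
  Take smooth cutoffs \<open>\<eta>\<^sub>k\<close> that rise from 0 to 1 across the shell where the distance to \<open>\<partial>U\<close> inside \<open>U\<close>
  lies between \<open>\<epsilon>\<close> and \<open>\<epsilon> + 1/k\<close>, with gradient of order \<open>k\<close>. The product rule for the pairing gives
  \<open>\<integral>\<phi> \<nabla>\<eta>\<^sub>k \<cdot> dF = - \<integral>\<eta>\<^sub>k \<phi> d(div F) - \<integral>\<eta>\<^sub>k d(\<nabla>\<phi> \<cdot> F)\<close>, whose limit is the normal trace on
  \<open>\<partial>U\<^sup>\<epsilon>\<close>. The left-hand side is bounded by \<open>\<integral>|\<phi>| d\<sigma>\<^sub>k\<close>, where \<open>\<sigma>\<^sub>k\<close> is \<open>k|F|\<close> restricted to the shell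
  up to a constant. By Tonelli and Fatou the lower limit of the masses of \<open>\<sigma>\<^sub>k\<close> is finite for almost
  every \<open>\<epsilon>\<close>, so a subsequence converges weakly to a finite measure \<open>\<sigma>\<close> on \<open>\<partial>U\<^sup>\<epsilon>\<close>. Hence the normal
  trace is a functional bounded by the \<open>L\<^sup>1(\<sigma>)\<close> norm and is represented by a signed measure. The limit
  \<open>\<epsilon>\<^sub>k \<rightarrow> 0\<close> is dominated convergence, since the indicator functions of \<open>U\<^sup>\<epsilon>\<^sup>k\<close> tend to that of \<open>U\<close>.
\<close>

section \<open>Jordan decomposition of finite signed measures\<close>

text \<open>Divergence and pairing are defined by \<open>THE\<close>, so existence and uniqueness of
  the pairing and its product rule are proved here rather than assumed. The obstacle is that
  \<open>F\<close> may charge Lebesgue null sets, while the weak gradient of \<phi> is defined only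
  almost everywhere; the pairing is therefore never an integral of that gradient. Functionals are
  studied on smooth test functions, where derivatives can be moved off \<phi>, and are carried over
  by density in L^1 of a finite positive measure that controls them. One representation lemma serves
  twice: with a multiple of a majorant of \<open>F\<close> it yields the pairing, with the weak
  limit of the shell measures it yields the trace measure. The trace functional on smooth functions
  converges along every cutoff sequence; compactness only produces the measure that controls it. The
  exceptional set of \<epsilon> comes from shell masses alone and is thus independent of \<phi>.
  Total variations are replaced by finite majorants; the resulting factors enter only estimates that
  tend to 0 or assert finiteness.\<close>

lemma space_restrict_borel [simp]: "space (restrict_space borel \<Omega>) = \<Omega>"
  by (simp add: space_restrict_space)

lemma borel_subsets_subset: "A \<in> borel_subsets \<Omega> \<Longrightarrow> A \<subseteq> \<Omega>"
  using sets.sets_into_space[of A "restrict_space borel \<Omega>"] by simp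

lemma borel_subsets_space [simp, intro]: "\<Omega> \<in> borel_subsets \<Omega>"
  using sets.top[of "restrict_space borel \<Omega>"] by simp

lemma radon_measure_on_sums:
  assumes "radon_measure_on \<Omega> \<mu>" "range A \<subseteq> borel_subsets \<Omega>" "disjoint_family A"
  shows "(\<lambda>i::nat. \<mu> (A i)) sums \<mu> (\<Union>i. A i)"
  using assms unfolding radon_measure_on_def by blast

lemma radon_measure_on_empty:
  assumes "radon_measure_on \<Omega> \<mu>" shows "\<mu> {} = 0"
proof -
  have "(\<lambda>i::nat. \<mu> {}) sums \<mu> {}"
    using radon_measure_on_sums[OF assms, of "\<lambda>_. {}"] by (auto simp: disjoint_family_on_def)
  then have "(\<lambda>i::nat. \<mu> {}) \<longlonglongrightarrow> 0"
    using summable_LIMSEQ_zero sums_summable by blast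
  then show ?thesis by (simp add: LIMSEQ_const_iff)
qed

lemma radon_measure_on_Un:
  assumes \<mu>: "radon_measure_on \<Omega> \<mu>"
    and A: "A \<in> borel_subsets \<Omega>" and B: "B \<in> borel_subsets \<Omega>" and AB: "A \<inter> B = {}"
  shows "\<mu> (A \<union> B) = \<mu> A + \<mu> B"
proof -
  have "(\<lambda>i. \<mu> (binaryset A B i)) sums \<mu> (\<Union>i. binaryset A B i)"
    using A B AB by (intro radon_measure_on_sums[OF \<mu>])
      (auto simp: binaryset_def disjoint_family_on_def)
  moreover have "(\<lambda>i. \<mu> (binaryset A B i)) sums (\<mu> A + \<mu> B)"
    by (rule binaryset_sums) (rule radon_measure_on_empty[OF \<mu>])
  ultimately show ?thesis
    by (simp add: UN_binaryset_eq sums_unique2)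
qed

lemma radon_measure_on_Diff:
  assumes \<mu>: "radon_measure_on \<Omega> \<mu>"
    and A: "A \<in> borel_subsets \<Omega>" and B: "B \<in> borel_subsets \<Omega>" and AB: "B \<subseteq> A"
  shows "\<mu> (A - B) = \<mu> A - \<mu> B"
  using radon_measure_on_Un[OF \<mu>, of "A - B" B] A B AB by (auto simp: Un_absorb2 Diff_disjoint Int_commute)

lemma radon_measure_on_uminus:
  assumes "radon_measure_on \<Omega> \<mu>" shows "radon_measure_on \<Omega> (\<lambda>A. - \<mu> A)"
  using assms unfolding radon_measure_on_def by (auto intro: sums_minus)

text \<open>Signed and vector values rule out monotonicity arguments, so the limit comes from a
  telescoping series over the differences of consecutive sets. All values are finite, so the
  subtraction is legitimate whatever the starting set.\<close>

lemma radon_measure_on_decseq: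
  assumes \<mu>: "radon_measure_on \<Omega> \<mu>"
    and A: "range A \<subseteq> borel_subsets \<Omega>" and dec: "decseq A"
  shows "(\<lambda>i::nat. \<mu> (A i)) \<longlonglongrightarrow> \<mu> (\<Inter>i. A i)"
proof -
  define D where "D i = A i - A (Suc i)" for i
  have D: "range D \<subseteq> borel_subsets \<Omega>" using A by (auto simp: D_def)
  have dis: "disjoint_family D"
    unfolding disjoint_family_on_def
  proof (intro ballI impI)
    fix m n :: nat assume "m \<noteq> n"
    have *: "D i \<inter> D j = {}" if "i < j" for i j
      using decseqD[OF dec, of "Suc i" j] that by (auto simp: D_def)
    show "D m \<inter> D n = {}"
      using \<open>m \<noteq> n\<close> *[of m n] *[of n m] by (cases m n rule: linorder_cases) auto
  qed
  have I: "(\<Inter>i. A i) \<in> borel_subsets \<Omega>" using A by auto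
  have UD: "(\<Union>i. D i) = A 0 - (\<Inter>i. A i)"
  proof (intro equalityI subsetI)
    fix x assume "x \<in> (\<Union>i. D i)"
    then show "x \<in> A 0 - (\<Inter>i. A i)"
      using decseqD[OF dec, of 0] by (auto simp: D_def)
  next
    fix x assume x: "x \<in> A 0 - (\<Inter>i. A i)"
    then obtain n where n: "x \<notin> A n" by auto
    \<comment> \<open>The first set that misses \<open>x\<close> is not \<open>A 0\<close>, so
      \<open>x\<close> lies in the difference just before it.\<close>
    define k where "k = (LEAST k. x \<notin> A k)"
    have "x \<notin> A k" unfolding k_def using n by (rule LeastI)
    moreover from this x have "k \<noteq> 0" by (cases k) auto
    moreover from this have "x \<in> A (k - 1)"
      using not_less_Least[of "k - 1" "\<lambda>k. x \<notin> A k"] by (auto simp: k_def)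
    ultimately have "x \<in> D (k - 1)" by (auto simp: D_def)
    then show "x \<in> (\<Union>i. D i)" by blast
  qed
  have sums: "(\<lambda>i. \<mu> (D i)) sums \<mu> (\<Union>i. D i)"
    by (rule radon_measure_on_sums[OF \<mu> D dis])
  have "\<mu> (D i) = \<mu> (A i) - \<mu> (A (Suc i))" for i
    unfolding D_def using A decseqD[OF dec, of i "Suc i"]
    by (intro radon_measure_on_Diff[OF \<mu>]) auto
  then have "(\<Sum>i<n. \<mu> (D i)) = \<mu> (A 0) - \<mu> (A n)" for n
    by (induction n) auto
  moreover have "\<mu> (\<Union>i. D i) = \<mu> (A 0) - \<mu> (\<Inter>i. A i)"
    unfolding UD using A I by (intro radon_measure_on_Diff[OF \<mu>]) auto
  ultimately have "(\<lambda>n. \<mu> (A 0) - \<mu> (A n)) \<longlonglongrightarrow> \<mu> (A 0) - \<mu> (\<Inter>i. A i)"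
    using sums by (simp add: sums_def)
  from tendsto_diff[OF tendsto_const[of "\<mu> (A 0)"] this] show ?thesis by simp
qed

section \<open>Positive and negative parts as finite measures\<close>

lemma space_pos_part [simp]: "space (pos_part \<Omega> \<mu>) = \<Omega>"
  unfolding pos_part_def by (rule space_measure_of) (auto dest: borel_subsets_subset)

lemma sets_pos_part [simp, measurable_cong]: "sets (pos_part \<Omega> \<mu>) = sets (restrict_space borel \<Omega>)"
  unfolding pos_part_def
  using sets.sigma_sets_eq[of "restrict_space borel \<Omega>"]
  by (subst sets_measure_of) (auto dest: borel_subsets_subset)

lemma space_neg_part [simp]: "space (neg_part \<Omega> \<mu>) = \<Omega>"
  and sets_neg_part [simp, measurable_cong]: "sets (neg_part \<Omega> \<mu>) = sets (restrict_space borel \<Omega>)"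
  unfolding neg_part_def by simp_all

text \<open>This is the set function handed to \<open>measure_of\<close> in \<open>pos_part\<close>.
  Since \<open>measure_of\<close> yields the zero measure for a function that is not countably
  additive, additivity has to be proved before \<open>emeasure\<close> can be evaluated.\<close>

definition upper_variation :: "'a::topological_space set \<Rightarrow> ('a set \<Rightarrow> real) \<Rightarrow> 'a set \<Rightarrow> ennreal" where
  "upper_variation \<Omega> \<mu> A = (SUP B\<in>{B \<in> borel_subsets \<Omega>. B \<subseteq> A}. ennreal (\<mu> B))"

lemma upper_variation_upper:
  "B \<in> borel_subsets \<Omega> \<Longrightarrow> B \<subseteq> A \<Longrightarrow> ennreal (\<mu> B) \<le> upper_variation \<Omega> \<mu> A"
  unfolding upper_variation_def by (auto intro: SUP_upper)

lemma upper_variation_mono: "A \<subseteq> A' \<Longrightarrow> upper_variation \<Omega> \<mu> A \<le> upper_variation \<Omega> \<mu> A'"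
  unfolding upper_variation_def by (rule SUP_subset_mono) auto

text \<open>Competitors inside disjoint sets can be united, and their values add. When one value is
  negative, \<open>ennreal\<close> truncates it to 0 and the other competitor is used alone.\<close>

lemma upper_variation_super:
  assumes \<mu>: "radon_measure_on \<Omega> \<mu>"
    and A: "A \<in> borel_subsets \<Omega>" and A': "A' \<in> borel_subsets \<Omega>" and dis: "A \<inter> A' = {}"
  shows "upper_variation \<Omega> \<mu> A + upper_variation \<Omega> \<mu> A' \<le> upper_variation \<Omega> \<mu> (A \<union> A')"
proof -
  have ne: "{B \<in> borel_subsets \<Omega>. B \<subseteq> X} \<noteq> {}" for X by auto
  have *: "ennreal (\<mu> B) + ennreal (\<mu> B') \<le> upper_variation \<Omega> \<mu> (A \<union> A')"
    if B: "B \<in> borel_subsets \<Omega>" "B \<subseteq> A" and B': "B' \<in> borel_subsets \<Omega>" "B' \<subseteq> A'" for B B'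
  proof (cases "\<mu> B \<ge> 0 \<and> \<mu> B' \<ge> 0")
    case True
    have "\<mu> (B \<union> B') = \<mu> B + \<mu> B'"
      using B B' dis by (intro radon_measure_on_Un[OF \<mu>]) auto
    moreover have "ennreal (\<mu> (B \<union> B')) \<le> upper_variation \<Omega> \<mu> (A \<union> A')"
      using B B' by (intro upper_variation_upper) auto
    ultimately show ?thesis using True by simp
  next
    case False
    then show ?thesis
      using upper_variation_upper[OF B(1), of "A \<union> A'" \<mu>] upper_variation_upper[OF B'(1), of "A \<union> A'" \<mu>] B B'
      by (cases "\<mu> B \<ge> 0") (auto simp: ennreal_neg)
  qed
  have "upper_variation \<Omega> \<mu> A + upper_variation \<Omega> \<mu> A' =
     (SUP B\<in>{B \<in> borel_subsets \<Omega>. B \<subseteq> A}. ennreal (\<mu> B) + upper_variation \<Omega> \<mu> A')"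
    unfolding upper_variation_def by (subst ennreal_SUP_add_left[OF ne]) auto
  also have "\<dots> = (SUP B\<in>{B \<in> borel_subsets \<Omega>. B \<subseteq> A}. SUP B'\<in>{B \<in> borel_subsets \<Omega>. B \<subseteq> A'}. ennreal (\<mu> B) + ennreal (\<mu> B'))"
    unfolding upper_variation_def[of _ _ A'] by (subst ennreal_SUP_add_right[OF ne]) auto
  also have "\<dots> \<le> upper_variation \<Omega> \<mu> (A \<union> A')"
    by (intro SUP_least) (auto intro: *)
  finally show ?thesis .
qed

text \<open>Finite superadditivity and monotonicity give one inequality. For the other, a competitor
  in the union is cut along the \<open>A i\<close>; countable additivity of \<mu> turns its value
  into a limit of partial sums, each bounded termwise.\<close>

lemma countably_additive_upper_variation:
  assumes \<mu>: "radon_measure_on \<Omega> \<mu>"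
  shows "countably_additive (borel_subsets \<Omega>) (upper_variation \<Omega> \<mu>)"
proof (rule countably_additiveI)
  fix A :: "nat \<Rightarrow> 'a set"
  assume A: "range A \<subseteq> borel_subsets \<Omega>" and dis: "disjoint_family A"
    and UA: "(\<Union>i. A i) \<in> borel_subsets \<Omega>"
  show "(\<Sum>i. upper_variation \<Omega> \<mu> (A i)) = upper_variation \<Omega> \<mu> (\<Union>i. A i)"
  proof (rule antisym)
    have fin: "(\<Sum>i<n. upper_variation \<Omega> \<mu> (A i)) \<le> upper_variation \<Omega> \<mu> (\<Union>i<n. A i)" for n
    proof (induction n)
      case (Suc n)
      have "(\<Union>i<n. A i) \<inter> A n = {}"
        using dis by (auto simp: disjoint_family_on_def) (metis disjoint_iff less_irrefl)
      then have "upper_variation \<Omega> \<mu> (\<Union>i<n. A i) + upper_variation \<Omega> \<mu> (A n)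
          \<le> upper_variation \<Omega> \<mu> ((\<Union>i<n. A i) \<union> A n)"
        using A by (intro upper_variation_super[OF \<mu>]) auto
      then show ?case
        using Suc by (auto simp: lessThan_Suc Un_commute add.commute intro: order_trans add_mono)
    qed auto
    show "(\<Sum>i. upper_variation \<Omega> \<mu> (A i)) \<le> upper_variation \<Omega> \<mu> (\<Union>i. A i)"
      by (rule suminf_le_const) (auto intro!: order_trans[OF fin] upper_variation_mono)
    have "ennreal (\<mu> B) \<le> (\<Sum>i. upper_variation \<Omega> \<mu> (A i))"
      if B: "B \<in> borel_subsets \<Omega>" "B \<subseteq> (\<Union>i. A i)" for B
    proof -
      have "(\<lambda>i. \<mu> (B \<inter> A i)) sums \<mu> (\<Union>i. B \<inter> A i)"
        using A B dis by (intro radon_measure_on_sums[OF \<mu>]) (auto simp: disjoint_family_on_def, blast)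
      moreover have "(\<Union>i. B \<inter> A i) = B" using B by auto
      ultimately have "(\<lambda>n. \<Sum>i<n. \<mu> (B \<inter> A i)) \<longlonglongrightarrow> \<mu> B" by (simp add: sums_def)
      then have "(\<lambda>n. ennreal (\<Sum>i<n. \<mu> (B \<inter> A i))) \<longlonglongrightarrow> ennreal (\<mu> B)" by (rule tendsto_ennrealI)
      moreover have "ennreal (\<Sum>i<n. \<mu> (B \<inter> A i)) \<le> (\<Sum>i. upper_variation \<Omega> \<mu> (A i))" for n
      proof -
        \<comment> \<open>Negative slices are first replaced by 0, since \<open>sum_ennreal\<close>
          asks for nonnegative terms and \<open>ennreal\<close> sends negative ones to 0
          anyway.\<close>
        have "ennreal (\<Sum>i<n. \<mu> (B \<inter> A i)) \<le> ennreal (\<Sum>i<n. max 0 (\<mu> (B \<inter> A i)))"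
          by (intro ennreal_leI sum_mono) auto
        also have "\<dots> = (\<Sum>i<n. ennreal (max 0 (\<mu> (B \<inter> A i))))" by (subst sum_ennreal) auto
        also have "\<dots> = (\<Sum>i<n. ennreal (\<mu> (B \<inter> A i)))"
          by (intro sum.cong) (auto simp: max_def ennreal_neg)
        also have "\<dots> \<le> (\<Sum>i<n. upper_variation \<Omega> \<mu> (A i))"
          using A B by (intro sum_mono upper_variation_upper) auto
        also have "\<dots> \<le> (\<Sum>i. upper_variation \<Omega> \<mu> (A i))" by (rule sum_le_suminf) auto
        finally show ?thesis .
      qed
      ultimately show ?thesis by (intro LIMSEQ_le_const2) auto
    qed
    then show "upper_variation \<Omega> \<mu> (\<Union>i. A i) \<le> (\<Sum>i. upper_variation \<Omega> \<mu> (A i))"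
      unfolding upper_variation_def[of _ _ "\<Union>i. A i"] by (intro SUP_least) auto
  qed
qed

lemma upper_variation_empty: "radon_measure_on \<Omega> \<mu> \<Longrightarrow> upper_variation \<Omega> \<mu> {} = 0"
proof -
  assume "radon_measure_on \<Omega> \<mu>"
  moreover have "{B \<in> borel_subsets \<Omega>. B \<subseteq> {}} = {{}}" by auto
  ultimately show ?thesis by (simp add: upper_variation_def radon_measure_on_empty)
qed

lemma emeasure_pos_part:
  assumes \<mu>: "radon_measure_on \<Omega> \<mu>" and A: "A \<in> borel_subsets \<Omega>"
  shows "emeasure (pos_part \<Omega> \<mu>) A = upper_variation \<Omega> \<mu> A"
proof (rule emeasure_measure_of[where \<Omega>=\<Omega> and A = "borel_subsets \<Omega>"])
  show "pos_part \<Omega> \<mu> = measure_of \<Omega> (borel_subsets \<Omega>) (upper_variation \<Omega> \<mu>)"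
    unfolding pos_part_def upper_variation_def[abs_def] ..
  show "borel_subsets \<Omega> \<subseteq> Pow \<Omega>" by (auto dest: borel_subsets_subset)
  show "positive (sets (pos_part \<Omega> \<mu>)) (upper_variation \<Omega> \<mu>)"
    using upper_variation_empty[OF \<mu>] by (simp add: positive_def)
  show "countably_additive (sets (pos_part \<Omega> \<mu>)) (upper_variation \<Omega> \<mu>)"
    using countably_additive_upper_variation[OF \<mu>] by simp
qed (use A in simp)

text \<open>A set of infinite upper variation contains another one on which \<open>\<mu>\<close> is as large as we like;
  iterating contradicts continuity from above.\<close>

lemma upper_variation_finite:
  assumes \<mu>: "radon_measure_on \<Omega> \<mu>"
  shows "upper_variation \<Omega> \<mu> \<Omega> < \<infinity>"
proof (rule ccontr)
  assume "\<not> ?thesis"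
  then have inf: "upper_variation \<Omega> \<mu> \<Omega> = \<infinity>" by (metis infinity_ennreal_def top.not_eq_extremum)
  define Q where "Q A \<longleftrightarrow> A \<in> borel_subsets \<Omega> \<and> upper_variation \<Omega> \<mu> A = \<infinity>" for A
  have step: "\<exists>B. Q B \<and> B \<subseteq> A \<and> \<bar>\<mu> B\<bar> \<ge> real n" if Q: "Q A" for A n
  proof -
    have A: "A \<in> borel_subsets \<Omega>" "upper_variation \<Omega> \<mu> A = \<infinity>" using Q by (auto simp: Q_def)
    \<comment> \<open>The surplus \<open>\<bar>\<mu> A\<bar>\<close> makes \<mu> at least
      \<open>n\<close> in absolute value on \<open>C\<close> and on \<open>A - C\<close> alike, so
      it does not matter which of the two inherits the infinite upper variation.\<close>
    have "ennreal (real n + \<bar>\<mu> A\<bar>) < upper_variation \<Omega> \<mu> A" using A by simp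
    then obtain C where C: "C \<in> borel_subsets \<Omega>" "C \<subseteq> A" "ennreal (real n + \<bar>\<mu> A\<bar>) < ennreal (\<mu> C)"
      unfolding upper_variation_def less_SUP_iff by auto
    then have C': "real n + \<bar>\<mu> A\<bar> < \<mu> C"
      by (metis ennreal_less_iff abs_ge_zero add_nonneg_nonneg of_nat_0_le_iff)
    have D: "\<mu> (A - C) = \<mu> A - \<mu> C" by (rule radon_measure_on_Diff[OF \<mu> A(1) C(1,2)])
    have "emeasure (pos_part \<Omega> \<mu>) C + emeasure (pos_part \<Omega> \<mu>) (A - C) = emeasure (pos_part \<Omega> \<mu>) A"
      using A C by (subst plus_emeasure) (auto simp: Un_absorb1)
    then have "upper_variation \<Omega> \<mu> C + upper_variation \<Omega> \<mu> (A - C) = \<infinity>"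
      using A C by (simp add: emeasure_pos_part[OF \<mu>])
    then consider "upper_variation \<Omega> \<mu> C = \<infinity>" | "upper_variation \<Omega> \<mu> (A - C) = \<infinity>"
      by (auto simp: ennreal_add_eq_top)
    then show ?thesis
    proof cases
      case 1 then show ?thesis using C C' by (intro exI[of _ C]) (auto simp: Q_def)
    next
      case 2 then show ?thesis using A C C' D by (intro exI[of _ "A - C"]) (auto simp: Q_def)
    qed
  qed
  have "Q \<Omega>" using inf by (auto simp: Q_def)
  from dependent_nat_choice[where P = "\<lambda>n B. Q B \<and> \<bar>\<mu> B\<bar> \<ge> real n" and Q = "\<lambda>n A B. B \<subseteq> A"]
  obtain A where A: "\<And>n. Q (A n)" "\<And>n. \<bar>\<mu> (A n)\<bar> \<ge> real n" "\<And>n. A (Suc n) \<subseteq> A n"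
    using step[of _ ] \<open>Q \<Omega>\<close> by (metis (no_types, lifting))
  have "(\<lambda>i. \<mu> (A i)) \<longlonglongrightarrow> \<mu> (\<Inter>i. A i)"
    using A by (intro radon_measure_on_decseq[OF \<mu>]) (auto simp: Q_def decseq_Suc_iff)
  then have "Bseq (\<lambda>i. \<mu> (A i))" by (meson Bseq_def convergentI convergent_imp_Bseq)
  then obtain K where "\<And>n. \<bar>\<mu> (A n)\<bar> \<le> K" by (auto simp: Bseq_def)
  then have "real n \<le> K" for n using A(2)[of n] order_trans by blast
  then show False using reals_Archimedean2[of K] by (meson not_less)
qed

lemma finite_measure_pos_part: "radon_measure_on \<Omega> \<mu> \<Longrightarrow> finite_measure (pos_part \<Omega> \<mu>)"
  using upper_variation_finite[of \<Omega> \<mu>]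
  by (intro finite_measureI) (auto simp: emeasure_pos_part)

lemma finite_measure_neg_part: "radon_measure_on \<Omega> \<mu> \<Longrightarrow> finite_measure (neg_part \<Omega> \<mu>)"
  unfolding neg_part_def by (intro finite_measure_pos_part radon_measure_on_uminus)

text \<open>Passing from a competitor \<open>B\<close> to \<open>A - B\<close> changes its value to
  \<open>\<mu> A - \<mu> B\<close>. Hence the suprema of \<mu> and of its negative over subsets of
  \<open>A\<close> differ by exactly \<open>\<mu> A\<close>; this takes the place of a Hahn
  decomposition.\<close>

lemma measure_pos_part_diff_neg_part:
  assumes \<mu>: "radon_measure_on \<Omega> \<mu>" and A: "A \<in> borel_subsets \<Omega>"
  shows "measure (pos_part \<Omega> \<mu>) A - measure (neg_part \<Omega> \<mu>) A = \<mu> A"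
proof -
  interpret P: finite_measure "pos_part \<Omega> \<mu>" by (rule finite_measure_pos_part[OF \<mu>])
  interpret N: finite_measure "neg_part \<Omega> \<mu>" by (rule finite_measure_neg_part[OF \<mu>])
  have uP: "\<mu> B \<le> measure (pos_part \<Omega> \<mu>) A"
    if "B \<in> borel_subsets \<Omega>" "B \<subseteq> A" for B
    using upper_variation_upper[OF that, of \<mu>] A \<mu>
    by (simp add: emeasure_pos_part[symmetric] P.emeasure_eq_measure)
  have uN: "- \<mu> B \<le> measure (neg_part \<Omega> \<mu>) A"
    if "B \<in> borel_subsets \<Omega>" "B \<subseteq> A" for B
    using upper_variation_upper[OF that, of "\<lambda>A. - \<mu> A"] A radon_measure_on_uminus[OF \<mu>]
    using N.emeasure_eq_measure[of A]
    by (simp add: emeasure_pos_part[symmetric] neg_part_def)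
  \<comment> \<open>Together with \<open>uP\<close> this makes the measure the least upper bound of
    the competitors; the empty competitor gives \<open>0 \<le> c\<close>.\<close>
  have lP: "measure (pos_part \<Omega> \<mu>) A \<le> c"
    if "\<And>B. B \<in> borel_subsets \<Omega> \<Longrightarrow> B \<subseteq> A \<Longrightarrow> \<mu> B \<le> c" for c
  proof -
    have "0 \<le> c" using that[of "{}"] radon_measure_on_empty[OF \<mu>] by simp
    have "upper_variation \<Omega> \<mu> A \<le> ennreal c"
      unfolding upper_variation_def by (intro SUP_least ennreal_leI) (auto intro: that)
    then show ?thesis using \<open>0 \<le> c\<close> A \<mu> by (simp add: emeasure_pos_part[symmetric] P.emeasure_eq_measure)
  qed
  have lN: "measure (neg_part \<Omega> \<mu>) A \<le> c"
    if "\<And>B. B \<in> borel_subsets \<Omega> \<Longrightarrow> B \<subseteq> A \<Longrightarrow> - \<mu> B \<le> c" for c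
  proof -
    have "0 \<le> c" using that[of "{}"] radon_measure_on_empty[OF \<mu>] by simp
    have "upper_variation \<Omega> (\<lambda>A. - \<mu> A) A \<le> ennreal c"
      unfolding upper_variation_def by (intro SUP_least ennreal_leI) (auto intro: that)
    then show ?thesis using \<open>0 \<le> c\<close> A radon_measure_on_uminus[OF \<mu>] N.emeasure_eq_measure[of A]
      by (simp add: emeasure_pos_part[symmetric] neg_part_def)
  qed
  have D: "\<mu> (A - B) = \<mu> A - \<mu> B" "A - B \<in> borel_subsets \<Omega>"
    if "B \<in> borel_subsets \<Omega>" "B \<subseteq> A" for B
    using radon_measure_on_Diff[OF \<mu> A that] A that by auto
  have "measure (pos_part \<Omega> \<mu>) A \<le> \<mu> A + measure (neg_part \<Omega> \<mu>) A"
  proof (rule lP)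
    fix B assume B: "B \<in> borel_subsets \<Omega>" "B \<subseteq> A"
    show "\<mu> B \<le> \<mu> A + measure (neg_part \<Omega> \<mu>) A" using uN[of "A - B"] D[OF B] by auto
  qed
  moreover have "measure (neg_part \<Omega> \<mu>) A \<le> measure (pos_part \<Omega> \<mu>) A - \<mu> A"
  proof (rule lN)
    fix B assume B: "B \<in> borel_subsets \<Omega>" "B \<subseteq> A"
    show "- \<mu> B \<le> measure (pos_part \<Omega> \<mu>) A - \<mu> A" using uP[of "A - B"] D[OF B] by auto
  qed
  ultimately show ?thesis by simp
qed

text \<open>A majorant stands in for the total variation: a finite positive measure bounding the set
  function set by set also bounds both Jordan parts, and one majorant can be shared by several set
  functions.\<close>

definition dominates ::
  "'a::topological_space measure \<Rightarrow> 'a set \<Rightarrow> ('a set \<Rightarrow> 'b::real_normed_vector) \<Rightarrow> bool" where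
  "dominates m \<Omega> \<mu> \<longleftrightarrow> finite_measure m \<and> sets m = borel_subsets \<Omega> \<and>
     (\<forall>A\<in>borel_subsets \<Omega>. norm (\<mu> A) \<le> measure m A)"

lemma dominatesD:
  assumes "dominates m \<Omega> \<mu>"
  shows "finite_measure m" "sets m = borel_subsets \<Omega>" "space m = \<Omega>"
    "\<And>A. A \<in> borel_subsets \<Omega> \<Longrightarrow> norm (\<mu> A) \<le> measure m A"
  using assms sets_eq_imp_space_eq[of m "restrict_space borel \<Omega>"] unfolding dominates_def by auto

lemma pos_part_le:
  assumes \<mu>: "radon_measure_on \<Omega> \<mu>" and m: "dominates m \<Omega> \<mu>"
  shows "pos_part \<Omega> \<mu> \<le> m"
proof -
  note mD = dominatesD[OF m]
  interpret finite_measure m by (rule mD)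
  have "emeasure (pos_part \<Omega> \<mu>) A \<le> emeasure m A" if A: "A \<in> borel_subsets \<Omega>" for A
    unfolding emeasure_pos_part[OF \<mu> A] upper_variation_def
  proof (intro SUP_least)
    fix B assume B: "B \<in> {B \<in> borel_subsets \<Omega>. B \<subseteq> A}"
    then have "\<mu> B \<le> measure m B" using mD(4)[of B] by auto
    also have "\<dots> \<le> measure m A" using A B mD(2) by (intro finite_measure_mono) auto
    finally show "ennreal (\<mu> B) \<le> emeasure m A" by (simp add: emeasure_eq_measure ennreal_leI)
  qed
  then show ?thesis using mD(2) by (subst le_measure) auto
qed

lemma dominates_uminus: "dominates m \<Omega> (\<lambda>A. - \<mu> A) \<longleftrightarrow> dominates m \<Omega> \<mu>"
  by (simp add: dominates_def)

lemma neg_part_le: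
  assumes \<mu>: "radon_measure_on \<Omega> \<mu>" and m: "dominates m \<Omega> \<mu>"
  shows "neg_part \<Omega> \<mu> \<le> m"
  unfolding neg_part_def using assms
  by (intro pos_part_le radon_measure_on_uminus) (simp_all add: dominates_uminus)

lemma integrable_measure_mono:
  fixes f :: "'a \<Rightarrow> real"
  assumes "integrable m f" "p \<le> m" "sets p = sets m"
  shows "integrable p f" "(\<integral>x. \<bar>f x\<bar> \<partial>p) \<le> (\<integral>x. \<bar>f x\<bar> \<partial>m)"
proof -
  have meas: "f \<in> borel_measurable m" "f \<in> borel_measurable p"
    using assms measurable_cong_sets[OF assms(3) refl, of borel] by auto
  have le: "(\<integral>\<^sup>+x. norm (f x) \<partial>p) \<le> (\<integral>\<^sup>+x. norm (f x) \<partial>m)"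
    by (rule nn_integral_mono_measure[OF assms(3,2)])
  show i: "integrable p f"
    using le assms(1) meas unfolding integrable_iff_bounded by auto
  have "ennreal (\<integral>x. \<bar>f x\<bar> \<partial>p) \<le> ennreal (\<integral>x. \<bar>f x\<bar> \<partial>m)"
    using le i assms(1) by (simp add: nn_integral_eq_integral integrable_abs)
  then show "(\<integral>x. \<bar>f x\<bar> \<partial>p) \<le> (\<integral>x. \<bar>f x\<bar> \<partial>m)"
    by (simp add: integral_nonneg_AE)
qed

lemma integrable_parts:
  fixes f :: "'a::topological_space \<Rightarrow> real"
  assumes \<mu>: "radon_measure_on \<Omega> \<mu>" and m: "dominates m \<Omega> \<mu>" and f: "integrable m f"
  shows "integrable (pos_part \<Omega> \<mu>) f" "integrable (neg_part \<Omega> \<mu>) f"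
  using integrable_measure_mono(1)[OF f pos_part_le[OF \<mu> m]] dominatesD(2)[OF m]
    integrable_measure_mono(1)[OF f neg_part_le[OF \<mu> m]] by auto

text \<open>Each Jordan part is below \<open>m\<close>, and the two are estimated separately, whence
  the factor 2.\<close>

lemma signed_integral_bound:
  assumes \<mu>: "radon_measure_on \<Omega> \<mu>" and m: "dominates m \<Omega> \<mu>" and f: "integrable m f"
  shows "\<bar>signed_integral \<Omega> \<mu> f\<bar> \<le> 2 * (\<integral>x. \<bar>f x\<bar> \<partial>m)"
proof -
  have "\<bar>\<integral>x. f x \<partial>pos_part \<Omega> \<mu>\<bar> \<le> (\<integral>x. \<bar>f x\<bar> \<partial>pos_part \<Omega> \<mu>)"
    "\<bar>\<integral>x. f x \<partial>neg_part \<Omega> \<mu>\<bar> \<le> (\<integral>x. \<bar>f x\<bar> \<partial>neg_part \<Omega> \<mu>)"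
    using integral_norm_bound[of "pos_part \<Omega> \<mu>" f] integral_norm_bound[of "neg_part \<Omega> \<mu>" f] by auto
  moreover have "(\<integral>x. \<bar>f x\<bar> \<partial>pos_part \<Omega> \<mu>) \<le> (\<integral>x. \<bar>f x\<bar> \<partial>m)"
    "(\<integral>x. \<bar>f x\<bar> \<partial>neg_part \<Omega> \<mu>) \<le> (\<integral>x. \<bar>f x\<bar> \<partial>m)"
    using integrable_measure_mono(2)[OF f pos_part_le[OF \<mu> m]] dominatesD(2)[OF m]
      integrable_measure_mono(2)[OF f neg_part_le[OF \<mu> m]] by auto
  ultimately show ?thesis unfolding signed_integral_def by linarith
qed

lemma signed_integral_cong:
  assumes "\<And>x. x \<in> \<Omega> \<Longrightarrow> f x = g x"
  shows "signed_integral \<Omega> \<mu> f = signed_integral \<Omega> \<mu> g"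
  unfolding signed_integral_def using assms
  by (intro arg_cong2[where f = "(-)"] Bochner_Integration.integral_cong) auto

lemma signed_integral_add:
  assumes \<mu>: "radon_measure_on \<Omega> \<mu>" and m: "dominates m \<Omega> \<mu>" and fg: "integrable m f" "integrable m g"
  shows "signed_integral \<Omega> \<mu> (\<lambda>x. f x + g x) = signed_integral \<Omega> \<mu> f + signed_integral \<Omega> \<mu> g"
  using integrable_parts[OF \<mu> m] fg unfolding signed_integral_def by simp

lemma signed_integral_cmult:
  "signed_integral \<Omega> \<mu> (\<lambda>x. c * f x) = c * signed_integral \<Omega> \<mu> f"
  unfolding signed_integral_def by (simp add: right_diff_distrib)

lemma signed_integral_diff:
  assumes \<mu>: "radon_measure_on \<Omega> \<mu>" and m: "dominates m \<Omega> \<mu>" and fg: "integrable m f" "integrable m g"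
  shows "signed_integral \<Omega> \<mu> (\<lambda>x. f x - g x) = signed_integral \<Omega> \<mu> f - signed_integral \<Omega> \<mu> g"
  using integrable_parts[OF \<mu> m] fg unfolding signed_integral_def by simp

lemma signed_integral_indicator:
  assumes \<mu>: "radon_measure_on \<Omega> \<mu>" and A: "A \<in> borel_subsets \<Omega>"
  shows "signed_integral \<Omega> \<mu> (indicator A) = \<mu> A"
  using measure_pos_part_diff_neg_part[OF \<mu> A] borel_subsets_subset[OF A]
  unfolding signed_integral_def by (simp add: Int_absorb2)

lemma signed_integral_tendsto:
  assumes \<mu>: "radon_measure_on \<Omega> \<mu>" and m: "dominates m \<Omega> \<mu>"
    and s: "\<And>i::nat. integrable m (s i)" and f: "integrable m f"
    and lim: "(\<lambda>i. \<integral>x. \<bar>s i x - f x\<bar> \<partial>m) \<longlonglongrightarrow> 0"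
  shows "(\<lambda>i. signed_integral \<Omega> \<mu> (s i)) \<longlonglongrightarrow> signed_integral \<Omega> \<mu> f"
proof -
  have "(\<lambda>i. signed_integral \<Omega> \<mu> (s i) - signed_integral \<Omega> \<mu> f) \<longlonglongrightarrow> 0"
  proof (rule Lim_null_comparison)
    show "\<forall>\<^sub>F i in sequentially. norm (signed_integral \<Omega> \<mu> (s i) - signed_integral \<Omega> \<mu> f)
        \<le> 2 * (\<integral>x. \<bar>s i x - f x\<bar> \<partial>m)"
      using signed_integral_bound[OF \<mu> m] s f
      by (auto simp: signed_integral_diff[OF \<mu> m, symmetric])
    show "(\<lambda>i. 2 * (\<integral>x. \<bar>s i x - f x\<bar> \<partial>m)) \<longlonglongrightarrow> 0" using tendsto_mult_left[OF lim, of 2] by simp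
  qed
  then show ?thesis by (simp add: LIM_zero_iff)
qed

text \<open>Convergence in L^1 of a majorant is the form needed below: it passes at once to signed
  integrals and, through norms, to vector integrals.\<close>

lemma L1_dominated_convergence:
  fixes f :: "'a \<Rightarrow> real"
  assumes "integrable m w" "f \<in> borel_measurable m" "\<And>i::nat. s i \<in> borel_measurable m"
    and lim: "\<And>x. x \<in> space m \<Longrightarrow> (\<lambda>i. s i x) \<longlonglongrightarrow> f x"
    and bd: "\<And>i x. x \<in> space m \<Longrightarrow> \<bar>s i x\<bar> \<le> w x"
  shows "(\<lambda>i. \<integral>x. \<bar>s i x - f x\<bar> \<partial>m) \<longlonglongrightarrow> 0" "integrable m f" "\<And>i. integrable m (s i)"
proof -
  have bdf: "\<bar>f x\<bar> \<le> w x" if "x \<in> space m" for x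
    using tendsto_rabs[OF lim[OF that]] bd[OF that] by (intro LIMSEQ_le_const2) auto
  \<comment> \<open>The limit inherits the bound \<open>w\<close>, so the difference is dominated by
    twice that bound.\<close>
  have "(\<lambda>i. \<integral>x. \<bar>s i x - f x\<bar> \<partial>m) \<longlonglongrightarrow> (\<integral>x. 0 \<partial>m)"
  proof (rule integral_dominated_convergence[where w = "\<lambda>x. 2 * w x"])
    show "AE x in m. (\<lambda>i. \<bar>s i x - f x\<bar>) \<longlonglongrightarrow> 0"
      using lim by (auto intro!: AE_I2 tendsto_rabs_zero simp: LIM_zero_iff)
    show "AE x in m. norm \<bar>s i x - f x\<bar> \<le> 2 * w x" for i
    proof (rule AE_I2)
      fix x assume "x \<in> space m"
      from bd[OF this, of i] bdf[OF this] show "norm \<bar>s i x - f x\<bar> \<le> 2 * w x" by simp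
    qed
  qed (use assms in auto)
  then show "(\<lambda>i. \<integral>x. \<bar>s i x - f x\<bar> \<partial>m) \<longlonglongrightarrow> 0" by simp
  show "integrable m f"
    using assms bdf by (intro Bochner_Integration.integrable_bound[OF assms(1)]) (auto intro!: AE_I2 intro: order_trans[OF _ abs_ge_self])
  show "integrable m (s i)" for i
    using assms by (intro Bochner_Integration.integrable_bound[OF assms(1)]) (auto intro!: AE_I2 intro: order_trans[OF bd abs_ge_self])
qed

lemma finite_measure_integrable_bounded:
  fixes f :: "'a \<Rightarrow> 'b::{banach, second_countable_topology}"
  assumes "finite_measure m" "f \<in> borel_measurable m" "\<And>x. x \<in> space m \<Longrightarrow> norm (f x) \<le> C"
  shows "integrable m f"
  using assms by (intro finite_measure.integrable_const_bound[where B = C]) auto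

text \<open>Indexed by \<open>bool\<close> it adds two measures; indexed by \<open>Basis\<close> it
  collects the majorants of the components of a vector measure.\<close>

lemma exists_sum_measure:
  fixes M :: "'i \<Rightarrow> 'a measure"
  assumes "finite I" "\<And>i. i \<in> I \<Longrightarrow> finite_measure (M i)" "\<And>i. i \<in> I \<Longrightarrow> sets (M i) = sets S"
  obtains m where "finite_measure m" "sets m = sets S"
    "\<And>A. A \<in> sets S \<Longrightarrow> measure m A = (\<Sum>i\<in>I. measure (M i) A)"
proof -
  define m where "m = measure_of (space S) (sets S) (\<lambda>A. \<Sum>i\<in>I. emeasure (M i) A)"
  have sp: "space m = space S" and st: "sets m = sets S"
    unfolding m_def using sets.space_closed by auto
  have em: "emeasure m A = (\<Sum>i\<in>I. emeasure (M i) A)" if A: "A \<in> sets S" for A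
    unfolding m_def
  proof (rule emeasure_measure_of_sigma)
    show "countably_additive (sets S) (\<lambda>A. \<Sum>i\<in>I. emeasure (M i) A)"
    proof (rule countably_additiveI)
      fix A :: "nat \<Rightarrow> 'a set" assume *: "range A \<subseteq> sets S" "disjoint_family A"
      have "(\<Sum>j. \<Sum>i\<in>I. emeasure (M i) (A j)) = (\<Sum>i\<in>I. \<Sum>j. emeasure (M i) (A j))"
        by (rule suminf_sum) simp
      also have "\<dots> = (\<Sum>i\<in>I. emeasure (M i) (\<Union>j. A j))"
        using * assms(3) by (intro sum.cong suminf_emeasure) auto
      finally show "(\<Sum>j. \<Sum>i\<in>I. emeasure (M i) (A j)) = (\<Sum>i\<in>I. emeasure (M i) (\<Union>j. A j))" .
    qed
  qed (auto simp: positive_def A sets.sigma_algebra_axioms)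
  have em2: "emeasure m A = ennreal (\<Sum>i\<in>I. measure (M i) A)" if A: "A \<in> sets S" for A
    unfolding em[OF A] using assms(2)
    by (subst sum_ennreal[symmetric]) (auto intro!: sum.cong simp: finite_measure.emeasure_eq_measure)
  show ?thesis
  proof
    show "finite_measure m" using em2[of "space S"] sp by (intro finite_measureI) auto
    show "sets m = sets S" by (rule st)
    show "measure m A = (\<Sum>i\<in>I. measure (M i) A)" if "A \<in> sets S" for A
      using em2[OF that] by (simp add: measure_def sum_nonneg)
  qed
qed

lemma exists_dominates_real:
  fixes \<mu> :: "'a::topological_space set \<Rightarrow> real"
  assumes \<mu>: "radon_measure_on \<Omega> \<mu>"
  obtains m where "dominates m \<Omega> \<mu>"
proof -
  obtain m where m: "finite_measure m" "sets m = borel_subsets \<Omega>"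
    "\<And>A. A \<in> borel_subsets \<Omega> \<Longrightarrow> measure m A =
        (\<Sum>i\<in>UNIV. measure (if i then pos_part \<Omega> \<mu> else neg_part \<Omega> \<mu>) A)"
    by (rule exists_sum_measure[of "UNIV :: bool set" "\<lambda>i. if i then pos_part \<Omega> \<mu> else neg_part \<Omega> \<mu>" "restrict_space borel \<Omega>"])
      (use finite_measure_pos_part[OF \<mu>] finite_measure_neg_part[OF \<mu>] in auto)
  have "\<bar>\<mu> A\<bar> \<le> measure m A" if A: "A \<in> borel_subsets \<Omega>" for A
  proof -
    have "measure m A = measure (pos_part \<Omega> \<mu>) A + measure (neg_part \<Omega> \<mu>) A"
      using m(3)[OF A] by (simp add: UNIV_bool)
    then show ?thesis
      using measure_pos_part_diff_neg_part[OF \<mu> A]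
        measure_nonneg[of "pos_part \<Omega> \<mu>" A] measure_nonneg[of "neg_part \<Omega> \<mu>" A]
      by linarith
  qed
  with m show ?thesis by (intro that[of m]) (auto simp: dominates_def)
qed

lemma radon_measure_on_inner:
  assumes "radon_measure_on \<Omega> F" shows "radon_measure_on \<Omega> (\<lambda>A. F A \<bullet> b)"
  using assms unfolding radon_measure_on_def by (auto intro: bounded_linear.sums bounded_linear_inner_left)

lemma exists_dominates:
  fixes F :: "'a::topological_space set \<Rightarrow> 'b::euclidean_space"
  assumes F: "radon_measure_on \<Omega> F"
  obtains m where "dominates m \<Omega> F"
proof -
  have "\<exists>m. dominates m \<Omega> (\<lambda>A. F A \<bullet> b)" for b :: 'b
    using exists_dominates_real[OF radon_measure_on_inner[OF F]] by metis
  then obtain M where M: "\<And>b::'b. dominates (M b) \<Omega> (\<lambda>A. F A \<bullet> b)" by metis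
  obtain m where m: "finite_measure m" "sets m = borel_subsets \<Omega>"
    "\<And>A. A \<in> borel_subsets \<Omega> \<Longrightarrow> measure m A = (\<Sum>b\<in>Basis. measure (M b) A)"
    by (rule exists_sum_measure[of "Basis :: 'b set" M "restrict_space borel \<Omega>"])
      (use dominatesD(1,2)[OF M] in auto)
  have "norm (F A) \<le> measure m A" if A: "A \<in> borel_subsets \<Omega>" for A
  proof -
    have "norm (F A) \<le> (\<Sum>b\<in>Basis. \<bar>F A \<bullet> b\<bar>)" by (rule norm_le_l1)
    also have "\<dots> \<le> (\<Sum>b\<in>Basis. measure (M b) A)"
      using dominatesD(4)[OF M A] by (intro sum_mono) simp
    finally show ?thesis using m(3)[OF A] by simp
  qed
  with m show ?thesis by (intro that[of m]) (auto simp: dominates_def)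
qed

lemma dominates_common:
  assumes "dominates m \<Omega> \<mu>" "dominates m' \<Omega> \<nu>"
  obtains M where "dominates M \<Omega> \<mu>" "dominates M \<Omega> \<nu>"
proof -
  obtain M where M: "finite_measure M" "sets M = borel_subsets \<Omega>"
    "\<And>A. A \<in> borel_subsets \<Omega> \<Longrightarrow> measure M A = (\<Sum>i\<in>UNIV. measure (if i then m else m') A)"
    by (rule exists_sum_measure[of "UNIV :: bool set" "\<lambda>i. if i then m else m'" "restrict_space borel \<Omega>"])
      (use dominatesD(1,2)[OF assms(1)] dominatesD(1,2)[OF assms(2)] in auto)
  then show ?thesis
    using dominatesD(4)[OF assms(1)] dominatesD(4)[OF assms(2)]
    by (intro that[of M]) (auto simp: dominates_def UNIV_bool intro: add_increasing add_increasing2)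
qed

section \<open>Integrals against vector measures\<close>

lemma dominates_inner:
  assumes "dominates m \<Omega> F" "norm b \<le> 1" shows "dominates m \<Omega> (\<lambda>A. F A \<bullet> b)"
  unfolding dominates_def
proof (intro conjI ballI dominatesD[OF assms(1)])
  fix A assume A: "A \<in> borel_subsets \<Omega>"
  have "norm (F A \<bullet> b) \<le> norm (F A) * norm b" using Cauchy_Schwarz_ineq2 by simp
  also have "\<dots> \<le> norm (F A) * 1" using assms(2) by (intro mult_left_mono) auto
  finally show "norm (F A \<bullet> b) \<le> measure m A" using dominatesD(4)[OF assms(1) A] by simp
qed

text \<open>A coordinate of \<open>G\<close> is at most its norm, and each of the
  \<open>DIM('a)\<close> coordinates costs the factor 2 of the signed bound. This constant returns
  in the weight of the shell measures.\<close>

lemma vector_integral_bound: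
  fixes F :: "'a::euclidean_space set \<Rightarrow> 'a"
  assumes F: "radon_measure_on \<Omega> F" and m: "dominates m \<Omega> F" and G: "integrable m G"
  shows "\<bar>vector_integral \<Omega> F G\<bar> \<le> (2 * DIM('a)) * (\<integral>x. norm (G x) \<partial>m)"
proof -
  have "\<bar>vector_integral \<Omega> F G\<bar> \<le> (\<Sum>b\<in>Basis. \<bar>signed_integral \<Omega> (\<lambda>A. F A \<bullet> b) (\<lambda>x. G x \<bullet> b)\<bar>)"
    unfolding vector_integral_def by (rule sum_abs)
  also have "\<dots> \<le> (\<Sum>b\<in>(Basis :: 'a set). 2 * (\<integral>x. norm (G x) \<partial>m))"
  proof (rule sum_mono)
    fix b :: 'a assume b: "b \<in> Basis"
    have i: "integrable m (\<lambda>x. G x \<bullet> b)" using G by simp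
    have "\<bar>signed_integral \<Omega> (\<lambda>A. F A \<bullet> b) (\<lambda>x. G x \<bullet> b)\<bar> \<le> 2 * (\<integral>x. \<bar>G x \<bullet> b\<bar> \<partial>m)"
      using b by (intro signed_integral_bound[OF radon_measure_on_inner[OF F] dominates_inner[OF m] i]) auto
    also have "\<dots> \<le> 2 * (\<integral>x. norm (G x) \<partial>m)"
      using i G b by (intro mult_left_mono integral_mono) (auto simp: Basis_le_norm)
    finally show "\<bar>signed_integral \<Omega> (\<lambda>A. F A \<bullet> b) (\<lambda>x. G x \<bullet> b)\<bar> \<le> 2 * (\<integral>x. norm (G x) \<partial>m)" .
  qed
  finally show ?thesis by (simp add: mult_ac)
qed

lemma vector_integral_add:
  fixes F :: "'a::euclidean_space set \<Rightarrow> 'a"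
  assumes F: "radon_measure_on \<Omega> F" and m: "dominates m \<Omega> F" and G: "integrable m G" "integrable m H"
  shows "vector_integral \<Omega> F (\<lambda>x. G x + H x) = vector_integral \<Omega> F G + vector_integral \<Omega> F H"
  unfolding vector_integral_def sum.distrib[symmetric] inner_add_left
  using G by (intro sum.cong refl signed_integral_add[OF radon_measure_on_inner[OF F] dominates_inner[OF m]]) auto

lemma vector_integral_diff:
  fixes F :: "'a::euclidean_space set \<Rightarrow> 'a"
  assumes F: "radon_measure_on \<Omega> F" and m: "dominates m \<Omega> F" and G: "integrable m G" "integrable m H"
  shows "vector_integral \<Omega> F (\<lambda>x. G x - H x) = vector_integral \<Omega> F G - vector_integral \<Omega> F H"
  unfolding vector_integral_def sum_subtractf[symmetric] inner_diff_left
  using G by (intro sum.cong refl signed_integral_diff[OF radon_measure_on_inner[OF F] dominates_inner[OF m]]) auto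

lemma vector_integral_scaleR:
  "vector_integral \<Omega> F (\<lambda>x. c *\<^sub>R G x) = c * vector_integral \<Omega> F G"
  unfolding vector_integral_def by (simp add: signed_integral_cmult sum_distrib_left)

lemma vector_integral_cong:
  assumes "\<And>x. x \<in> \<Omega> \<Longrightarrow> G x = H x"
  shows "vector_integral \<Omega> F G = vector_integral \<Omega> F H"
  unfolding vector_integral_def using assms by (intro sum.cong refl signed_integral_cong) auto

lemma vector_integral_tendsto:
  fixes F :: "'a::euclidean_space set \<Rightarrow> 'a"
  assumes F: "radon_measure_on \<Omega> F" and m: "dominates m \<Omega> F"
    and s: "\<And>i::nat. integrable m (s i)" and G: "integrable m G"
    and lim: "(\<lambda>i. \<integral>x. norm (s i x - G x) \<partial>m) \<longlonglongrightarrow> 0"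
  shows "(\<lambda>i. vector_integral \<Omega> F (s i)) \<longlonglongrightarrow> vector_integral \<Omega> F G"
proof -
  have "(\<lambda>i. vector_integral \<Omega> F (s i) - vector_integral \<Omega> F G) \<longlonglongrightarrow> 0"
  proof (rule Lim_null_comparison)
    show "\<forall>\<^sub>F i in sequentially. norm (vector_integral \<Omega> F (s i) - vector_integral \<Omega> F G)
        \<le> (2 * DIM('a)) * (\<integral>x. norm (s i x - G x) \<partial>m)"
      using vector_integral_bound[OF F m] s G
      by (auto simp: vector_integral_diff[OF F m, symmetric])
    show "(\<lambda>i. (2 * DIM('a)) * (\<integral>x. norm (s i x - G x) \<partial>m)) \<longlonglongrightarrow> 0"
      using tendsto_mult_left[OF lim, of "2 * DIM('a)"] by simp
  qed
  then show ?thesis by (simp add: LIM_zero_iff)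
qed

section \<open>Smooth functions and convolution\<close>

text \<open>Two gradients at a point induce the same linear form; evaluating it at their difference
  shows that they agree. This resolves \<open>THE\<close> in \<open>grad\<close>.\<close>

lemma GDERIV_grad:
  assumes "GDERIV f x :> D" shows "grad f x = D"
  unfolding grad_def
proof (rule the_equality)
  fix E assume "GDERIV f x :> E"
  with assms have "(\<lambda>h. h \<bullet> D) = (\<lambda>h. h \<bullet> E)"
    unfolding gderiv_def by (rule has_derivative_unique)
  then have "(E - D) \<bullet> E = (E - D) \<bullet> D" by metis
  then have "(E - D) \<bullet> (E - D) = 0" by (simp add: inner_diff_right)
  then show "E = D" by simp
qed (fact assms)

lemma differentiable_GDERIV:
  fixes f :: "'a::euclidean_space \<Rightarrow> real"
  assumes "f differentiable (at x)" shows "GDERIV f x :> grad f x"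
proof -
  obtain f' where f': "(f has_derivative f') (at x)" using assms unfolding differentiable_def by auto
  interpret linear f' using f' by (rule has_derivative_linear)
  have "f' h = h \<bullet> (\<Sum>b\<in>Basis. f' b *\<^sub>R b)" for h
  proof -
    have "f' h = f' (\<Sum>b\<in>Basis. (h \<bullet> b) *\<^sub>R b)" by (simp add: euclidean_representation)
    also have "\<dots> = (\<Sum>b\<in>Basis. (h \<bullet> b) * f' b)" by (simp add: sum scale)
    finally show ?thesis by (simp add: inner_sum_right mult.commute)
  qed
  then have "f' = (\<lambda>h. h \<bullet> (\<Sum>b\<in>Basis. f' b *\<^sub>R b))" by (rule ext)
  then have "GDERIV f x :> (\<Sum>b\<in>Basis. f' b *\<^sub>R b)" using f' unfolding gderiv_def by metis
  then show ?thesis using GDERIV_grad by metis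
qed

lemma GDERIV_differentiable: "GDERIV f x :> D \<Longrightarrow> f differentiable (at x)"
  unfolding gderiv_def by (rule differentiableI)

section \<open>Calculus of k times continuously differentiable functions\<close>

lemma Ck_SucI:
  assumes "\<And>x. GDERIV f x :> g x" "\<And>b. b \<in> Basis \<Longrightarrow> Ck k (\<lambda>x. g x \<bullet> b)"
  shows "Ck (Suc k) f"
  using assms(2) GDERIV_grad[OF assms(1)] GDERIV_differentiable[OF assms(1)]
  by (simp add: differentiable_on_def)

lemma Ck_Suc_GDERIV: "Ck (Suc k) f \<Longrightarrow> GDERIV f x :> grad f x"
  by (simp add: differentiable_GDERIV differentiable_on_def)

lemma Ck_Suc_imp: "Ck (Suc k) f \<Longrightarrow> Ck k f"
proof (induction k arbitrary: f)
  case 0 then show ?case by (simp add: differentiable_imp_continuous_on)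
next
  case (Suc k)
  show ?case
  proof (rule Ck_SucI[of _ "grad f"])
    show "GDERIV f x :> grad f x" for x using Ck_Suc_GDERIV[OF Suc.prems] .
    show "Ck k (\<lambda>x. grad f x \<bullet> b)" if "b \<in> Basis" for b
      using Suc.IH[of "\<lambda>x. grad f x \<bullet> b"] Suc.prems that by simp
  qed
qed

lemma Ck_const [simp]: "Ck k (\<lambda>x::'a::euclidean_space. c)"
proof (induction k arbitrary: c)
  case (Suc k)
  then show ?case by (intro Ck_SucI[of _ "\<lambda>_. 0"]) (auto intro: GDERIV_const)
qed auto

lemma Ck_add: "Ck k f \<Longrightarrow> Ck k g \<Longrightarrow> Ck k (\<lambda>x. f x + g x)"
proof (induction k arbitrary: f g)
  case (Suc k)
  then show ?case
    by (intro Ck_SucI[of _ "\<lambda>x. grad f x + grad g x"])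
      (auto intro!: GDERIV_add Suc.IH simp: inner_add_left Ck_Suc_GDERIV simp del: Ck.simps(2), auto)
qed (auto intro: continuous_intros)

text \<open>The product rule multiplies one function by a derivative of the other, so the induction
  also needs both functions themselves one order lower.\<close>

lemma Ck_mult: "Ck k f \<Longrightarrow> Ck k g \<Longrightarrow> Ck k (\<lambda>x. f x * g x)"
proof (induction k arbitrary: f g)
  case (Suc k)
  have fg: "Ck k f" "Ck k g" using Suc.prems Ck_Suc_imp by blast+
  show ?case
  proof (rule Ck_SucI[of _ "\<lambda>x. f x *\<^sub>R grad g x + g x *\<^sub>R grad f x"])
    show "GDERIV (\<lambda>x. f x * g x) x :> f x *\<^sub>R grad g x + g x *\<^sub>R grad f x" for x
      using Suc.prems by (intro GDERIV_mult Ck_Suc_GDERIV)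
    show "Ck k (\<lambda>x. (f x *\<^sub>R grad g x + g x *\<^sub>R grad f x) \<bullet> b)" if "b \<in> Basis" for b
      using Suc.prems that fg by (auto simp: inner_add_left intro!: Ck_add Suc.IH)
  qed
qed (auto intro: continuous_intros)

lemma GDERIV_affine:
  assumes "GDERIV f (c *\<^sub>R x + a) :> D"
  shows "GDERIV (\<lambda>x. f (c *\<^sub>R x + a)) x :> c *\<^sub>R D"
proof -
  have "((\<lambda>x. c *\<^sub>R x + a) has_derivative (\<lambda>h. c *\<^sub>R h)) (at x)"
    by (auto intro!: derivative_eq_intros)
  from has_derivative_compose[OF this assms[unfolded gderiv_def]]
  show ?thesis unfolding gderiv_def by (simp add: o_def)
qed

lemma Ck_affine: "Ck k f \<Longrightarrow> Ck k (\<lambda>x. f (c *\<^sub>R x + a))"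
proof (induction k arbitrary: f)
  case 0
  then show ?case by (auto intro!: continuous_on_compose2[of UNIV f] continuous_intros)
next
  case (Suc k)
  show ?case
  proof (rule Ck_SucI[of _ "\<lambda>x. c *\<^sub>R grad f (c *\<^sub>R x + a)"])
    show "GDERIV (\<lambda>x. f (c *\<^sub>R x + a)) x :> c *\<^sub>R grad f (c *\<^sub>R x + a)" for x
      using Suc.prems by (intro GDERIV_affine Ck_Suc_GDERIV)
    show "Ck k (\<lambda>x. (c *\<^sub>R grad f (c *\<^sub>R x + a)) \<bullet> b)" if "b \<in> Basis" for b
      using Suc.prems that Suc.IH[of "\<lambda>x. grad f x \<bullet> b"] by (auto intro!: Ck_mult)
  qed
qed

section \<open>Compactly supported functions and their gradients\<close>

lemma CcI:
  assumes "continuous_on UNIV f" "compact K" "K \<subseteq> \<Omega>" "\<And>x. x \<notin> K \<Longrightarrow> f x = 0"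
  shows "f \<in> Cc \<Omega>"
proof -
  have "closure {x. f x \<noteq> 0} \<subseteq> K"
    using assms(2,4) by (intro closure_minimal) (auto simp: compact_imp_closed)
  moreover from this have "compact (closure {x. f x \<noteq> 0})"
    using compact_Int_closed[OF assms(2) closed_closure, of "{x. f x \<noteq> 0}"] by (simp add: Int_absorb1)
  ultimately show ?thesis using assms unfolding Cc_def by auto
qed

lemma CcE:
  assumes "f \<in> Cc \<Omega>"
  obtains K where "compact K" "K \<subseteq> \<Omega>" "\<And>x. x \<notin> K \<Longrightarrow> f x = 0"
  using assms closure_subset[of "{x. f x \<noteq> 0}"] unfolding Cc_def by blast

lemma Cc_continuous: "f \<in> Cc \<Omega> \<Longrightarrow> continuous_on UNIV f"
  unfolding Cc_def by simp

lemma Cc_bounded: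
  assumes "f \<in> Cc \<Omega>"
  obtains C where "C \<ge> 0" "\<And>x. \<bar>f x\<bar> \<le> C"
proof -
  obtain K where K: "compact K" "\<And>x. x \<notin> K \<Longrightarrow> f x = 0" using CcE[OF assms] by metis
  have "compact (f ` K)"
    using Cc_continuous[OF assms] K by (intro compact_continuous_image) (auto intro: continuous_on_subset)
  then obtain C where "\<And>x. x \<in> K \<Longrightarrow> \<bar>f x\<bar> \<le> C"
    by (metis bounded_iff compact_imp_bounded image_eqI real_norm_def)
  then have "\<bar>f x\<bar> \<le> max 0 C" for x using K(2)[of x] by (cases "x \<in> K") (auto simp: max.coboundedI2)
  then show ?thesis by (rule that[rotated]) simp
qed

lemma Cc_mono: "\<Omega> \<subseteq> \<Omega>' \<Longrightarrow> f \<in> Cc \<Omega> \<Longrightarrow> f \<in> Cc \<Omega>'"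
  unfolding Cc_def by auto

lemma Cc_inf_Cc: "f \<in> Cc_inf \<Omega> \<Longrightarrow> f \<in> Cc \<Omega>" unfolding Cc_inf_def by simp

lemma Cc_inf_Ck: "f \<in> Cc_inf \<Omega> \<Longrightarrow> Ck k f" unfolding Cc_inf_def by simp

lemma Cc_inf_mono: "\<Omega> \<subseteq> \<Omega>' \<Longrightarrow> f \<in> Cc_inf \<Omega> \<Longrightarrow> f \<in> Cc_inf \<Omega>'"
  unfolding Cc_inf_def using Cc_mono by blast

lemma Cc_inf_GDERIV: "f \<in> Cc_inf \<Omega> \<Longrightarrow> GDERIV f x :> grad f x"
  using Ck_Suc_GDERIV[OF Cc_inf_Ck[of f \<Omega> "Suc 0"]] .

lemma Cc_mult: assumes "f \<in> Cc \<Omega>" "continuous_on UNIV g" shows "(\<lambda>x. f x * g x) \<in> Cc \<Omega>"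
proof -
  obtain K where K: "compact K" "K \<subseteq> \<Omega>" "\<And>x. x \<notin> K \<Longrightarrow> f x = 0" using CcE[OF assms(1)] by metis
  then show ?thesis
    using Cc_continuous[OF assms(1)] assms(2) by (intro CcI[of _ K]) (auto intro: continuous_intros)
qed

lemma Cc_add: assumes "f \<in> Cc \<Omega>" "g \<in> Cc \<Omega>" shows "(\<lambda>x. f x + g x) \<in> Cc \<Omega>"
proof -
  obtain K where K: "compact K" "K \<subseteq> \<Omega>" "\<And>x. x \<notin> K \<Longrightarrow> f x = 0" using CcE[OF assms(1)] by metis
  obtain L where L: "compact L" "L \<subseteq> \<Omega>" "\<And>x. x \<notin> L \<Longrightarrow> g x = 0" using CcE[OF assms(2)] by metis
  show ?thesis
    using K L Cc_continuous[OF assms(1)] Cc_continuous[OF assms(2)]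
    by (intro CcI[of _ "K \<union> L"]) (auto intro: continuous_intros)
qed

lemma Cc_inf_mult: "f \<in> Cc_inf \<Omega> \<Longrightarrow> (\<And>k. Ck k g) \<Longrightarrow> (\<lambda>x. f x * g x) \<in> Cc_inf \<Omega>"
  unfolding Cc_inf_def using Cc_mult Ck_mult Ck.simps(1) by blast

lemma Cc_inf_add: "f \<in> Cc_inf \<Omega> \<Longrightarrow> g \<in> Cc_inf \<Omega> \<Longrightarrow> (\<lambda>x. f x + g x) \<in> Cc_inf \<Omega>"
  unfolding Cc_inf_def using Cc_add Ck_add by blast

lemma Cc_inf_cmult: "f \<in> Cc_inf \<Omega> \<Longrightarrow> (\<lambda>x. c * f x) \<in> Cc_inf \<Omega>"
  using Cc_inf_mult[of f \<Omega> "\<lambda>_. c"] by (simp add: mult.commute)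

lemma Cc_inf_diff: "f \<in> Cc_inf \<Omega> \<Longrightarrow> g \<in> Cc_inf \<Omega> \<Longrightarrow> (\<lambda>x. f x - g x) \<in> Cc_inf \<Omega>"
  using Cc_inf_add[of f \<Omega> "\<lambda>x. (-1) * g x"] Cc_inf_cmult[of g \<Omega> "-1"] by simp

lemma Cc_inf_zero: "(\<lambda>x. 0) \<in> Cc_inf \<Omega>"
  unfolding Cc_inf_def by (auto intro!: CcI[of _ "{}"])

lemma grad_mult:
  assumes "\<And>x. GDERIV f x :> grad f x" "\<And>x. GDERIV g x :> grad g x"
  shows "grad (\<lambda>x. f x * g x) x = f x *\<^sub>R grad g x + g x *\<^sub>R grad f x"
  by (intro GDERIV_grad GDERIV_mult assms)

lemma grad_eq_0:
  assumes "open S" "x \<in> S" "\<And>y. y \<in> S \<Longrightarrow> f y = c" shows "grad f x = 0"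
proof (rule GDERIV_grad)
  have "((\<lambda>x. c) has_derivative (\<lambda>h. 0)) (at x)" by simp
  then have "(f has_derivative (\<lambda>h. 0)) (at x)"
    by (rule has_derivative_transform_within_open[OF _ assms(1,2)]) (simp add: assms(3))
  then show "GDERIV f x :> 0" by (simp add: gderiv_def)
qed

lemma grad_outside:
  assumes "compact K" "\<And>x. x \<notin> K \<Longrightarrow> f x = 0" "x \<notin> K" shows "grad f x = 0"
  using grad_eq_0[of "- K" x f 0] assms by (auto simp: open_Compl compact_imp_closed)

lemma Cc_inf_grad:
  assumes "f \<in> Cc_inf \<Omega>" "b \<in> Basis" shows "(\<lambda>x. grad f x \<bullet> b) \<in> Cc_inf \<Omega>"
proof -
  have Ck: "Ck k (\<lambda>x. grad f x \<bullet> b)" for k using Cc_inf_Ck[OF assms(1), of "Suc k"] assms(2) by simp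
  obtain K where K: "compact K" "K \<subseteq> \<Omega>" "\<And>x. x \<notin> K \<Longrightarrow> f x = 0"
    using CcE[OF Cc_inf_Cc[OF assms(1)]] by metis
  have "(\<lambda>x. grad f x \<bullet> b) \<in> Cc \<Omega>"
    using K Ck[of 0] grad_outside[OF K(1,3)] by (intro CcI[of _ K]) auto
  then show ?thesis using Ck by (simp add: Cc_inf_def)
qed

lemma continuous_grad:
  assumes "f \<in> Cc_inf \<Omega>" shows "continuous_on UNIV (grad f)"
  using Cc_continuous[OF Cc_inf_Cc[OF Cc_inf_grad[OF assms]]]
  by (subst continuous_on_componentwise) auto

lemma Cc_inf_grad_bounded:
  assumes "f \<in> Cc_inf \<Omega>"
  obtains C where "C \<ge> 0" "\<And>x. norm (grad f x) \<le> C"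
proof -
  obtain K where K: "compact K" "\<And>x. x \<notin> K \<Longrightarrow> f x = 0"
    using CcE[OF Cc_inf_Cc[OF assms]] by metis
  have "compact (grad f ` K)"
    using continuous_grad[OF assms] K by (intro compact_continuous_image) (auto intro: continuous_on_subset)
  then obtain C where "\<And>x. x \<in> K \<Longrightarrow> norm (grad f x) \<le> C"
    by (metis bounded_iff compact_imp_bounded image_eqI)
  then have "norm (grad f x) \<le> max 0 C" for x
    using grad_outside[OF K] by (cases "x \<in> K") (auto simp: max.coboundedI2)
  then show ?thesis by (rule that[rotated]) simp
qed

text \<open>The unit collar around the ball of radius \<open>R\<close> handles pairs that are not
  both in the larger ball: at distance below 1, such a pair lies entirely where the function
  vanishes.\<close>

lemma uniformly_continuous_zero_outside:
  fixes f :: "'a::euclidean_space \<Rightarrow> 'b::real_normed_vector"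
  assumes f: "continuous_on UNIV f" and R: "\<And>x. norm x > R \<Longrightarrow> f x = 0"
  shows "uniformly_continuous_on UNIV f"
  unfolding uniformly_continuous_on_def
proof (intro allI impI)
  fix e :: real assume e: "e > 0"
  have "uniformly_continuous_on (cball 0 (R + 1)) f"
    using f by (intro compact_uniformly_continuous) (auto intro: continuous_on_subset)
  then obtain d where d: "d > 0"
    "\<And>x x'. x \<in> cball 0 (R+1) \<Longrightarrow> x' \<in> cball 0 (R+1) \<Longrightarrow> dist x' x < d \<Longrightarrow> dist (f x') (f x) < e"
    using e unfolding uniformly_continuous_on_def by metis
  have "dist (f x') (f x) < e" if "dist x' x < min d 1" for x x'
  proof (cases "norm x \<le> R + 1 \<and> norm x' \<le> R + 1")
    case True then show ?thesis using d(2)[of x x'] that by simp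
  next
    case False
    have "\<bar>norm x' - norm x\<bar> < 1"
      using that norm_triangle_ineq3[of x' x] by (simp add: dist_norm)
    then have "norm x > R" "norm x' > R" using False by linarith+
    then show ?thesis using R e by simp
  qed
  then show "\<exists>d>0. \<forall>x\<in>UNIV. \<forall>x'\<in>UNIV. dist x' x < d \<longrightarrow> dist (f x') (f x) < e"
    using d(1) by (intro exI[of _ "min d 1"]) auto
qed

text \<open>The gradient is uniformly continuous because its support is compact, and the mean value
  inequality converts its oscillation into a Taylor error uniform in the base point. That uniformity
  is what later allows differentiation under the integral sign.\<close>

lemma Cc_inf_uniform_linearization:
  fixes r :: "'a::euclidean_space \<Rightarrow> real"
  assumes r: "r \<in> Cc_inf UNIV" and e: "e > 0"
  obtains d where "d > 0" "\<And>z h. norm h < d \<Longrightarrow> \<bar>r (z + h) - r z - h \<bullet> grad r z\<bar> \<le> e * norm h"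
proof -
  obtain K where K: "compact K" "\<And>x. x \<notin> K \<Longrightarrow> r x = 0"
    using CcE[OF Cc_inf_Cc[OF r]] by metis
  then obtain R where "\<And>x. x \<in> K \<Longrightarrow> norm x \<le> R" using compact_imp_bounded bounded_iff by metis
  then have "norm x > R \<Longrightarrow> grad r x = 0" for x using grad_outside[OF K] by force
  then have "uniformly_continuous_on UNIV (grad r)"
    by (rule uniformly_continuous_zero_outside[OF continuous_grad[OF r]])
  then obtain d where d: "d > 0" "\<And>x x'. dist x' x < d \<Longrightarrow> dist (grad r x') (grad r x) < e"
    using e unfolding uniformly_continuous_on_def by (metis UNIV_I)
  show ?thesis
  proof (rule that[OF d(1)])
    fix z h :: 'a assume h: "norm h < d"
    have "norm (r (z + h) - r z - (z + h - z) \<bullet> grad r z) \<le> norm (z + h - z) * e"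
    proof (rule differentiable_bound_linearization[where f' = "\<lambda>x h. h \<bullet> grad r x" and S = "ball z d" and ?x0.0 = z])
      show "z + t *\<^sub>R (z + h - z) \<in> ball z d" if "t \<in> {0..1}" for t
      proof -
        have "\<bar>t\<bar> * norm h \<le> 1 * norm h" using that by (intro mult_right_mono) auto
        then show ?thesis using h by (simp add: dist_norm)
      qed
      show "(r has_derivative (\<lambda>h. h \<bullet> grad r x)) (at x within ball z d)" for x
        using Cc_inf_GDERIV[OF r, of x] unfolding gderiv_def by (rule has_derivative_at_withinI)
      show "onorm ((\<lambda>h. h \<bullet> grad r x) - (\<lambda>h. h \<bullet> grad r z)) \<le> e" if "x \<in> ball z d" for x
      proof (rule onorm_le)
        fix y
        have "\<bar>y \<bullet> (grad r x - grad r z)\<bar> \<le> norm y * norm (grad r x - grad r z)"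
          by (rule Cauchy_Schwarz_ineq2)
        also have "\<dots> \<le> norm y * e"
          using d(2)[of x z] that by (intro mult_left_mono) (auto simp: dist_norm norm_minus_commute)
        finally show "norm (((\<lambda>h. h \<bullet> grad r x) - (\<lambda>h. h \<bullet> grad r z)) y) \<le> e * norm y"
          by (simp add: inner_diff_right mult.commute)
      qed
      show "z \<in> ball z d" using d by simp
    qed
    then show "\<bar>r (z + h) - r z - h \<bullet> grad r z\<bar> \<le> e * norm h" by (simp add: mult.commute)
  qed
qed

section \<open>Convolution and differentiation under the integral\<close>

lemma integrable_bounded_support:
  fixes g :: "'a::euclidean_space \<Rightarrow> 'b::{banach, second_countable_topology}"
  assumes "g \<in> borel_measurable borel" "\<And>y. norm (g y) \<le> C" "\<And>y. y \<notin> cball a R \<Longrightarrow> g y = 0"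
  shows "integrable lborel g" "norm (\<integral>y. g y \<partial>lborel) \<le> C * measure lborel (cball a R)"
proof -
  have fin: "emeasure lborel (cball a R) < \<infinity>" by (rule emeasure_bounded_finite) simp
  have int: "integrable lborel (\<lambda>y. C * indicator (cball a R) y)"
    using fin by (intro integrable_mult_right integrable_real_indicator) auto
  have le: "norm (g y) \<le> C * indicator (cball a R) y" for y
    using assms(2)[of y] assms(3)[of y] by (auto simp: indicator_def)
  show "integrable lborel g"
    by (rule Bochner_Integration.integrable_bound[OF int])
      (use assms(1) le in \<open>auto intro!: AE_I2 intro: order_trans[OF _ abs_ge_self]\<close>)
  then have "norm (\<integral>y. g y \<partial>lborel) \<le> (\<integral>y. C * indicator (cball a R) y \<partial>lborel)"
    using le int by (intro order_trans[OF integral_norm_bound] integral_mono) auto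
  then show "norm (\<integral>y. g y \<partial>lborel) \<le> C * measure lborel (cball a R)" by simp
qed

text \<open>The kernel may be vector valued, so that \<open>convol f (grad r)\<close> expresses the
  gradient of \<open>convol f r\<close>.\<close>

definition convol :: "('a::euclidean_space \<Rightarrow> real) \<Rightarrow> ('a \<Rightarrow> 'b::euclidean_space) \<Rightarrow> 'a \<Rightarrow> 'b" where
  "convol f r x = (\<integral>y. f y *\<^sub>R r (x - y) \<partial>lborel)"

lemma convol_integrable:
  fixes r :: "'a::euclidean_space \<Rightarrow> 'b::euclidean_space"
  assumes f: "f \<in> borel_measurable borel" "\<And>y. \<bar>f y\<bar> \<le> C"
    and r: "continuous_on UNIV r" "compact K" "\<And>x. x \<notin> K \<Longrightarrow> r x = 0"
  shows "integrable lborel (\<lambda>y. f y *\<^sub>R r (x - y))"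
proof -
  obtain R where R: "\<And>x. x \<in> K \<Longrightarrow> norm x \<le> R" using r(2) compact_imp_bounded bounded_iff by metis
  have "compact (r ` K)" using r by (intro compact_continuous_image) (auto intro: continuous_on_subset)
  then obtain B where "\<And>x. x \<in> K \<Longrightarrow> norm (r x) \<le> B"
    by (metis bounded_iff compact_imp_bounded image_eqI)
  then have B: "norm (r x) \<le> max 0 B" for x using r(3)[of x] by (cases "x \<in> K") (auto simp: max.coboundedI2)
  have C: "C \<ge> 0" using f(2)[of 0] by linarith
  show ?thesis
  proof (rule integrable_bounded_support(1)[where C = "C * max 0 B" and a = x and R = R])
    have [measurable]: "r \<in> borel_measurable borel" using r(1) by (rule borel_measurable_continuous_onI)
    show "(\<lambda>y. f y *\<^sub>R r (x - y)) \<in> borel_measurable borel" using f(1) by measurable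
    show "norm (f y *\<^sub>R r (x - y)) \<le> C * max 0 B" for y
      using f(2)[of y] B[of "x - y"] C by (auto intro: mult_mono)
    show "f y *\<^sub>R r (x - y) = 0" if "y \<notin> cball x R" for y
      using that R[of "x - y"] r(3)[of "x - y"] by (auto simp: dist_norm)
  qed
qed

lemma convol_integrable_Cc:
  fixes r :: "'a::euclidean_space \<Rightarrow> real"
  assumes "f \<in> borel_measurable borel" "\<And>y. \<bar>f y\<bar> \<le> C" "r \<in> Cc UNIV"
  shows "integrable lborel (\<lambda>y. f y * r (x - y))"
  using CcE[OF assms(3)] convol_integrable[OF assms(1,2) Cc_continuous[OF assms(3)]]
  unfolding real_scaleR_def by metis

lemma convol_integrable_grad:
  fixes r :: "'a::euclidean_space \<Rightarrow> real"
  assumes "f \<in> borel_measurable borel" "\<And>y. \<bar>f y\<bar> \<le> C" "r \<in> Cc_inf UNIV"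
  shows "integrable lborel (\<lambda>y. f y *\<^sub>R grad r (x - y))"
proof -
  obtain K where K: "compact K" "\<And>x. x \<notin> K \<Longrightarrow> r x = 0"
    using CcE[OF Cc_inf_Cc[OF assms(3)]] by metis
  show ?thesis
    using convol_integrable[OF assms(1,2) continuous_grad[OF assms(3)] K(1) grad_outside[OF K]] by auto
qed

text \<open>The derivative falls on the kernel: its uniform linearization error is multiplied by the
  bounded \<open>f\<close> and integrated over a fixed ball.\<close>

lemma GDERIV_convol:
  fixes r :: "'a::euclidean_space \<Rightarrow> real"
  assumes f: "f \<in> borel_measurable borel" "\<And>y. \<bar>f y\<bar> \<le> C" and r: "r \<in> Cc_inf UNIV"
  shows "GDERIV (convol f r) x :> convol f (grad r) x"
  unfolding gderiv_def has_derivative_at_alt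
proof (intro conjI allI impI)
  show "bounded_linear (\<lambda>h. h \<bullet> convol f (grad r) x)" by (rule bounded_linear_inner_left)
  obtain K where K: "compact K" "\<And>x. x \<notin> K \<Longrightarrow> r x = 0"
    using CcE[OF Cc_inf_Cc[OF r]] by metis
  then obtain R where R: "\<And>x. x \<in> K \<Longrightarrow> norm x \<le> R" using compact_imp_bounded bounded_iff by metis
  have r0: "r z = 0" "grad r z = 0" if "norm z > R" for z
    using R[of z] that K(2)[of z] grad_outside[OF K(1), of r z, OF K(2)] by force+
  have C: "C \<ge> 0" using f(2)[of 0] by linarith
  have [measurable]: "r \<in> borel_measurable borel" "grad r \<in> borel_measurable borel" "f \<in> borel_measurable borel"
    using f Cc_continuous[OF Cc_inf_Cc[OF r]] continuous_grad[OF r] by (auto intro: borel_measurable_continuous_onI)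
  \<comment> \<open>Radius \<open>R + 1\<close>: outside this ball around \<open>x\<close> the
    kernel shifted to \<open>y\<close> vanishes as soon as \<open>norm (y - x) < 1\<close>, which
    the minimum with 1 below ensures.\<close>
  define V where "V = measure lborel (cball x (R + 1))"
  fix e :: real assume e: "e > 0"
  \<comment> \<open>The bound of \<open>f\<close> and the volume are divided out; adding 1 keeps the
    denominator positive when their product is 0.\<close>
  define e' where "e' = e / (C * V + 1)"
  have CV: "C * V + 1 > 0" using C by (simp add: V_def add_nonneg_pos)
  then have e': "e' > 0" using e by (simp add: e'_def)
  obtain d where d: "d > 0" "\<And>z h. norm h < d \<Longrightarrow> \<bar>r (z + h) - r z - h \<bullet> grad r z\<bar> \<le> e' * norm h"
    using Cc_inf_uniform_linearization[OF r e'] by metis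
  show "\<exists>d>0. \<forall>y. norm (y - x) < d \<longrightarrow>
     norm (convol f r y - convol f r x - (y - x) \<bullet> convol f (grad r) x) \<le> e * norm (y - x)"
  proof (intro exI[of _ "min d 1"] conjI allI impI)
    fix y assume y: "norm (y - x) < min d 1"
    define h where "h = y - x"
    define g where "g t = f t * (r (y - t) - r (x - t) - h \<bullet> grad r (x - t))" for t
    note i1 = convol_integrable_Cc[OF f Cc_inf_Cc[OF r]] and i2 = convol_integrable_grad[OF f r]
    have "convol f r y - convol f r x - h \<bullet> convol f (grad r) x
        = (\<integral>t. f t * r (y - t) - f t * r (x - t) - h \<bullet> (f t *\<^sub>R grad r (x - t)) \<partial>lborel)"
      unfolding convol_def using i1[of x] i1[of y] i2[of x] by (simp del: inner_scaleR_right)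
    also have "\<dots> = (\<integral>t. g t \<partial>lborel)"
      by (intro Bochner_Integration.integral_cong) (auto simp: g_def algebra_simps)
    finally have eq: "convol f r y - convol f r x - h \<bullet> convol f (grad r) x = (\<integral>t. g t \<partial>lborel)" .
    have "norm (\<integral>t. g t \<partial>lborel) \<le> (C * (e' * norm h)) * measure lborel (cball x (R + 1))"
    proof (rule integrable_bounded_support(2))
      show "g \<in> borel_measurable borel" unfolding g_def by measurable
      show "norm (g t) \<le> C * (e' * norm h)" for t
      proof -
        have "x - t + h = y - t" by (simp add: h_def)
        then have "\<bar>r (y - t) - r (x - t) - h \<bullet> grad r (x - t)\<bar> \<le> e' * norm h"
          using d(2)[of h "x - t"] y by (simp add: h_def)
        then show ?thesis
          using f(2)[of t] C unfolding g_def real_norm_def abs_mult by (intro mult_mono) auto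
      qed
      show "g t = 0" if "t \<notin> cball x (R + 1)" for t
      proof -
        have "norm (x - t) > R + 1" using that by (auto simp: dist_norm)
        moreover have "norm (x - t) \<le> norm (y - t) + norm h"
          using norm_triangle_ineq4[of "y - t" h] by (simp add: h_def)
        ultimately show ?thesis
          using y r0 by (simp add: g_def h_def)
      qed
    qed
    also have "\<dots> = e' * (C * V) * norm h" by (simp add: V_def)
    also have "\<dots> \<le> e * norm h"
      using CV e C by (intro mult_right_mono) (auto simp: e'_def divide_le_eq)
    finally show "norm (convol f r y - convol f r x - (y - x) \<bullet> convol f (grad r) x) \<le> e * norm (y - x)"
      using eq by (simp add: h_def)
  qed (use d in auto)
qed

text \<open>Induction on the order with \<open>f\<close> fixed: each component of the gradient is
  again a convolution of \<open>f\<close>, with a partial derivative of the kernel, which is again a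
  test function.\<close>

lemma Ck_convol:
  fixes r :: "'a::euclidean_space \<Rightarrow> real"
  assumes f: "f \<in> borel_measurable borel" "\<And>y. \<bar>f y\<bar> \<le> C" and r: "r \<in> Cc_inf UNIV"
  shows "Ck k (convol f r)"
  using r
proof (induction k arbitrary: r)
  case 0
  have "convol f r differentiable_on UNIV"
    using GDERIV_differentiable[OF GDERIV_convol[OF f 0]] by (simp add: differentiable_on_def)
  then show ?case by (simp add: differentiable_imp_continuous_on)
next
  case (Suc k)
  show ?case
  proof (rule Ck_SucI[OF GDERIV_convol[OF f Suc.prems]])
    fix b :: 'a assume b: "b \<in> Basis"
    have "(\<lambda>x. convol f (grad r) x \<bullet> b) = convol f (\<lambda>x. grad r x \<bullet> b)"
      unfolding convol_def using convol_integrable_grad[OF f Suc.prems] by (auto simp flip: integral_inner_left)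
    then show "Ck k (\<lambda>x. convol f (grad r) x \<bullet> b)"
      using Suc.IH[OF Cc_inf_grad[OF Suc.prems b]] by simp
  qed
qed

section \<open>Mollification and density of test functions\<close>

lemma lborel_integral_affine:
  fixes f :: "'a::euclidean_space \<Rightarrow> real"
  assumes [measurable]: "f \<in> borel_measurable borel" and c: "c \<noteq> 0"
  shows "(\<integral>y. f y \<partial>lborel) = \<bar>c\<bar> ^ DIM('a) * (\<integral>z. f (t + c *\<^sub>R z) \<partial>lborel)"
proof -
  have "(\<integral>y. f y \<partial>lborel) =
      (\<integral>y. f y \<partial>density (distr lborel borel (\<lambda>x. t + c *\<^sub>R x)) (\<lambda>_. ennreal (\<bar>c\<bar> ^ DIM('a))))"
    using lborel_affine[OF c, of t] by simp
  then show ?thesis by (simp add: integral_density integral_distr)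
qed

definition mollifier_kernel :: "('a::euclidean_space \<Rightarrow> real) \<Rightarrow> real \<Rightarrow> 'a \<Rightarrow> real" where
  "mollifier_kernel \<rho> \<delta> z = \<rho> (z /\<^sub>R \<delta>) / \<delta> ^ DIM('a)"

context
  fixes \<rho> :: "'a::euclidean_space \<Rightarrow> real" and \<delta> :: real
  assumes \<rho>: "standard_mollifier \<rho>" and \<delta>: "\<delta> > 0"
begin

lemma mollifier_kernel_nonneg: "mollifier_kernel \<rho> \<delta> z \<ge> 0"
  using \<rho> \<delta> by (simp add: mollifier_kernel_def standard_mollifier_def)

lemma mollifier_kernel_eq_0: "norm z > \<delta> \<Longrightarrow> mollifier_kernel \<rho> \<delta> z = 0"
  using \<rho> \<delta> by (simp add: mollifier_kernel_def standard_mollifier_def field_simps)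

lemma mollifier_kernel_Cc_inf: "mollifier_kernel \<rho> \<delta> \<in> Cc_inf UNIV"
proof -
  have "Ck k \<rho>" for k using \<rho> by (auto simp: standard_mollifier_def intro: Cc_inf_Ck)
  from Ck_affine[OF this, of _ "inverse \<delta>" 0] have "Ck k (\<lambda>z. \<rho> (z /\<^sub>R \<delta>))" for k by simp
  from Ck_mult[OF this, of _ "\<lambda>_. inverse (\<delta> ^ DIM('a))"]
  have Ck: "Ck k (mollifier_kernel \<rho> \<delta>)" for k
    by (simp add: mollifier_kernel_def[abs_def] divide_inverse)
  have "mollifier_kernel \<rho> \<delta> \<in> Cc UNIV"
    using Ck[of 0] mollifier_kernel_eq_0 by (intro CcI[of _ "cball 0 \<delta>"]) auto
  with Ck show ?thesis by (simp add: Cc_inf_def)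
qed

lemma mollifier_kernel_measurable [measurable]: "mollifier_kernel \<rho> \<delta> \<in> borel_measurable borel"
  using mollifier_kernel_Cc_inf Cc_inf_Cc Cc_continuous borel_measurable_continuous_onI by blast

lemma integral_mollifier_kernel: "(\<integral>y. mollifier_kernel \<rho> \<delta> (x - y) \<partial>lborel) = 1"
proof -
  have [measurable]: "\<rho> \<in> borel_measurable borel"
    using \<rho> unfolding standard_mollifier_def
    using Cc_inf_Cc Cc_continuous borel_measurable_continuous_onI by blast
  have "(\<integral>y. mollifier_kernel \<rho> \<delta> (x - y) \<partial>lborel) = (\<integral>z. mollifier_kernel \<rho> \<delta> z \<partial>lborel)"
    using lborel_integral_affine[of "\<lambda>y. mollifier_kernel \<rho> \<delta> (x - y)" "-1" x] by simp
  also have "\<dots> = \<delta> ^ DIM('a) * (\<integral>z. \<rho> z / \<delta> ^ DIM('a) \<partial>lborel)"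
    using lborel_integral_affine[of "mollifier_kernel \<rho> \<delta>" \<delta> 0] \<delta>
    by (simp add: mollifier_kernel_def)
  also have "\<dots> = (\<integral>z. \<rho> z \<partial>lborel)" using \<delta> by simp
  also have "\<dots> = (\<integral>z. \<rho> z \<partial>lebesgue)" by (simp add: integral_completion)
  also have "\<dots> = 1" using \<rho> by (simp add: standard_mollifier_def)
  finally show ?thesis .
qed

lemma mollifier_kernel_integrable: "integrable lborel (\<lambda>y. mollifier_kernel \<rho> \<delta> (x - y))"
  using convol_integrable_Cc[of "\<lambda>_. 1" 1 "mollifier_kernel \<rho> \<delta>" x] Cc_inf_Cc[OF mollifier_kernel_Cc_inf] by simp

text \<open>The convolution is a weighted mean of the values of \<open>f\<close> within distance
  \<delta>, with total weight 1. The choices of \<open>c\<close> and \<open>e\<close> cover all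
  later uses: \<open>c = 0\<close> bounds the size, \<open>c = e = 1/2\<close> puts values in the
  unit interval, \<open>e = 0\<close> shows that local constants are reproduced, and small
  \<open>e\<close> gives pointwise convergence.\<close>

lemma convol_mollifier_bound:
  assumes f: "f \<in> borel_measurable borel" "\<And>y. \<bar>f y\<bar> \<le> C"
    and c: "\<And>y. norm (x - y) \<le> \<delta> \<Longrightarrow> \<bar>f y - c\<bar> \<le> e"
  shows "\<bar>convol f (mollifier_kernel \<rho> \<delta>) x - c\<bar> \<le> e"
proof -
  let ?k = "\<lambda>y. mollifier_kernel \<rho> \<delta> (x - y)"
  have i: "integrable lborel (\<lambda>y. f y * ?k y)"
    by (rule convol_integrable_Cc[OF f Cc_inf_Cc[OF mollifier_kernel_Cc_inf]])
  have "convol f (mollifier_kernel \<rho> \<delta>) x - c = (\<integral>y. f y * ?k y \<partial>lborel) - (\<integral>y. c * ?k y \<partial>lborel)"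
    using integral_mollifier_kernel[of x] by (simp add: convol_def)
  also have "\<dots> = (\<integral>y. f y * ?k y - c * ?k y \<partial>lborel)"
    using i mollifier_kernel_integrable by (intro Bochner_Integration.integral_diff[symmetric]) auto
  also have "\<bar>\<dots>\<bar> \<le> (\<integral>y. e * ?k y \<partial>lborel)"
    unfolding real_norm_def[symmetric]
  proof (rule order_trans[OF integral_norm_bound integral_mono])
    show "norm (f y * ?k y - c * ?k y) \<le> e * ?k y" for y
    proof (cases "norm (x - y) \<le> \<delta>")
      case True
      have "norm (f y * ?k y - c * ?k y) = \<bar>f y - c\<bar> * ?k y"
        using mollifier_kernel_nonneg[of "x - y"] by (simp flip: left_diff_distrib add: abs_mult)
      then show ?thesis using c[OF True] mollifier_kernel_nonneg by (simp add: mult_right_mono)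
    qed (simp add: mollifier_kernel_eq_0)
  qed (use i mollifier_kernel_integrable in auto)
  finally show ?thesis using integral_mollifier_kernel[of x] by simp
qed

end

text \<open>The indicator of a neighbourhood of \<open>K\<close> is mollified at half the width of
  that neighbourhood: points of \<open>K\<close> see only ones, points far from \<open>K\<close>
  only zeros.\<close>

lemma smooth_cutoff:
  fixes K V :: "'a::euclidean_space set"
  assumes \<rho>: "standard_mollifier (\<rho> :: 'a \<Rightarrow> real)" and K: "compact K" and V: "open V" "K \<subseteq> V"
  obtains \<psi> where "\<psi> \<in> Cc_inf V" "\<And>x. 0 \<le> \<psi> x" "\<And>x. \<psi> x \<le> 1" "\<And>x. x \<in> K \<Longrightarrow> \<psi> x = 1"
proof (cases "K = {}")
  case True
  then show ?thesis using that[of "\<lambda>_. 0"] Cc_inf_zero by auto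
next
  case False
  obtain d where d: "d > 0" "\<And>x y. x \<in> K \<Longrightarrow> y \<in> -V \<Longrightarrow> d \<le> dist x y"
    using separate_compact_closed[OF K, of "-V"] V by (metis closed_Compl Diff_eq Diff_eq_empty_iff)
  \<comment> \<open>The neighbourhood has radius \<open>2 * \<delta>\<close> and mollification adds
    \<delta>; the resulting support, within \<open>3 * \<delta>\<close> of \<open>K\<close>, stays
    short of the complement of \<open>V\<close>, whose distance from \<open>K\<close> is at least
    \<open>4 * \<delta>\<close>.\<close>
  define \<delta> where "\<delta> = d / 4"
  have \<delta>: "\<delta> > 0" using d by (simp add: \<delta>_def)
  define S where "S = (\<Union>x\<in>K. ball x (2 * \<delta>))"
  have S: "S \<in> sets borel" unfolding S_def by (intro borel_open) auto
  define f :: "'a \<Rightarrow> real" where "f = indicator S"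
  have f: "f \<in> borel_measurable borel" "\<And>y. \<bar>f y\<bar> \<le> 1" using S by (auto simp: f_def indicator_def)
  define \<psi> where "\<psi> = convol f (mollifier_kernel \<rho> \<delta>)"
  have Ck: "Ck k \<psi>" for k unfolding \<psi>_def by (rule Ck_convol[OF f mollifier_kernel_Cc_inf[OF \<rho> \<delta>]])
  have half: "\<bar>\<psi> x - 1/2\<bar> \<le> 1/2" for x
    unfolding \<psi>_def by (rule convol_mollifier_bound[OF \<rho> \<delta> f]) (auto simp: f_def indicator_def)
  have one: "\<bar>\<psi> x - 1\<bar> \<le> 0" if "x \<in> K" for x
    unfolding \<psi>_def
  proof (rule convol_mollifier_bound[OF \<rho> \<delta> f])
    fix y assume "norm (x - y) \<le> \<delta>"
    then have "y \<in> S" using that \<delta> by (auto simp: S_def dist_norm intro!: bexI[of _ x])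
    then show "\<bar>f y - 1\<bar> \<le> 0" by (simp add: f_def)
  qed
  have zero: "\<bar>\<psi> x - 0\<bar> \<le> 0" if x: "x \<notin> {x. infdist x K \<le> 3 * \<delta>}" for x
    unfolding \<psi>_def
  proof (rule convol_mollifier_bound[OF \<rho> \<delta> f])
    fix y assume y: "norm (x - y) \<le> \<delta>"
    have "y \<notin> S"
    proof
      assume "y \<in> S"
      then obtain z where z: "z \<in> K" "dist z y < 2 * \<delta>" by (auto simp: S_def)
      have "infdist x K \<le> dist x z" using z by (intro infdist_le)
      also have "\<dots> \<le> dist x y + dist y z" by (rule dist_triangle)
      finally show False using x y z by (simp add: dist_norm norm_minus_commute)
    qed
    then show "\<bar>f y - 0\<bar> \<le> 0" by (simp add: f_def)
  qed
  have "{x. infdist x K \<le> 3 * \<delta>} \<subseteq> V"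
  proof
    fix x assume x: "x \<in> {x. infdist x K \<le> 3 * \<delta>}"
    obtain z where z: "z \<in> K" "infdist x K = dist x z"
      using infdist_attains_inf[of K x] False compact_imp_closed[OF K] by metis
    show "x \<in> V" using d(2)[OF z(1), of x] z(2) x \<delta> d(1) by (auto simp: \<delta>_def dist_commute)
  qed
  then have "\<psi> \<in> Cc V"
    using zero Ck[of 0] compact_infdist_le[OF False K, of "3 * \<delta>"] \<delta>
    by (intro CcI[of _ "{x. infdist x K \<le> 3 * \<delta>}"]) auto
  then have "\<psi> \<in> Cc_inf V" using Ck by (simp add: Cc_inf_def)
  moreover have "0 \<le> \<psi> x" "\<psi> x \<le> 1" for x using half[of x] by linarith+
  moreover have "\<psi> x = 1" if "x \<in> K" for x using one[OF that] by simp
  ultimately show ?thesis by (rule that)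
qed

section \<open>Density of test functions in L^1 and its consequences\<close>

lemma Cc_measurable:
  assumes "f \<in> Cc S" "sets m = borel_subsets \<Omega>"
  shows "f \<in> borel_measurable m"
  using borel_measurable_continuous_onI[OF Cc_continuous[OF assms(1)]] measurable_restrict_space1
    measurable_cong_sets[OF assms(2) refl, of borel] by blast

lemma Cc_integrable:
  assumes "f \<in> Cc S" "sets m = borel_subsets \<Omega>" "finite_measure m"
  shows "integrable m (f :: 'a::euclidean_space \<Rightarrow> real)"
proof -
  obtain C where "\<And>x. \<bar>f x\<bar> \<le> C" using Cc_bounded[OF assms(1)] by metis
  then show ?thesis
    by (intro finite_measure_integrable_bounded[OF assms(3) Cc_measurable[OF assms(1,2)], of C]) auto
qed

text \<open>Regularity encloses \<open>A\<close> between a compact \<open>K\<close> and an open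
  \<open>V\<close> with small difference; a cutoff for this pair can differ from the indicator only
  on \<open>V - K\<close>.\<close>

lemma Cc_inf_L1_dense_indicator:
  fixes \<Omega> :: "'a::euclidean_space set"
  assumes \<rho>: "standard_mollifier (\<rho> :: 'a \<Rightarrow> real)" and \<Omega>: "open \<Omega>"
    and m: "finite_measure m" "sets m = borel_subsets \<Omega>" and A: "A \<in> sets m" and e: "e > 0"
  obtains \<psi> where "\<psi> \<in> Cc_inf \<Omega>" "(\<integral>x. \<bar>indicator A x - \<psi> x\<bar> \<partial>m) < e"
proof -
  interpret finite_measure m by fact
  have sp: "space m = \<Omega>" using sets_eq_imp_space_eq[OF m(2)] by simp
  have id[measurable]: "(\<lambda>x. x) \<in> m \<rightarrow>\<^sub>M borel"
    by (simp add: measurable_cong_sets[OF m(2) refl] measurable_restrict_space1)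
  \<comment> \<open>Regularity concerns measures on the Borel sets of the whole space, so
    \<open>m\<close> is pushed forward along the inclusion of \<Omega>.\<close>
  define M where "M = distr m borel (\<lambda>x. x)"
  have M: "sets M = sets borel" by (simp add: M_def)
  have emM: "emeasure M B = emeasure m (B \<inter> \<Omega>)" if "B \<in> sets borel" for B
    using that by (simp add: M_def emeasure_distr sp vimage_def Int_def)
  have fin: "emeasure M (space M) \<noteq> \<infinity>" using emM[of UNIV] by (simp add: M_def)
  have A': "A \<in> sets borel" "A \<subseteq> \<Omega>"
    using A m(2) \<Omega> borel_subsets_subset[of A \<Omega>] by (auto simp: sets_restrict_space)
  have finA: "emeasure M A \<noteq> \<infinity>" using emM[OF A'(1)] by simp
  have e2: "e / 2 > 0" using e by simp
  have ne: "{K. K \<subseteq> A \<and> compact K} \<noteq> {}" using compact_empty by blast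
  obtain K where K: "K \<subseteq> A" "compact K" "emeasure M A < emeasure M K + ennreal (e / 2)"
    using SUP_approx_ennreal[OF e2 ne inner_regular[OF M fin A'(1)] finA] by blast
  obtain V where V: "A \<subseteq> V" "open V" "emeasure M V < emeasure M A + ennreal (e / 2)"
    using INF_approx_ennreal[OF e2 outer_regular[OF M fin A'(1)] finA] by blast
  have KV: "K \<subseteq> V \<inter> \<Omega>" using K V A' by auto
  have Ks: "K \<in> sets m" "V \<inter> \<Omega> \<in> sets m"
    using sets_restrict_space_iff[of \<Omega> "borel"] K(2) V(2) KV \<Omega> A'(2) K(1)
    by (auto simp: m(2) borel_compact)
  have VO: "open (V \<inter> \<Omega>)" using V(2) \<Omega> by (rule open_Int)
  obtain \<psi> where \<psi>: "\<psi> \<in> Cc_inf (V \<inter> \<Omega>)" "\<And>x. 0 \<le> \<psi> x" "\<And>x. \<psi> x \<le> 1" "\<And>x. x \<in> K \<Longrightarrow> \<psi> x = 1"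
    using smooth_cutoff[OF \<rho> K(2) VO KV] by blast
  obtain K' where K': "K' \<subseteq> V \<inter> \<Omega>" "\<And>x. x \<notin> K' \<Longrightarrow> \<psi> x = 0"
    using CcE[OF Cc_inf_Cc[OF \<psi>(1)]] by metis
  then have \<psi>0: "\<psi> x = 0" if "x \<notin> V \<inter> \<Omega>" for x using that by (meson subsetD)
  have \<psi>m: "\<psi> \<in> Cc_inf \<Omega>" using Cc_inf_mono[OF _ \<psi>(1)] by blast
  have iA: "integrable m (indicator A :: 'a \<Rightarrow> real)"
    by (rule integrable_real_indicator[OF A]) (simp add: top.not_eq_extremum[symmetric])
  have "(\<integral>x. \<bar>indicator A x - \<psi> x\<bar> \<partial>m) \<le> (\<integral>x. indicator (V \<inter> \<Omega> - K) x \<partial>m)"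
  proof (rule integral_mono)
    show "integrable m (\<lambda>x. \<bar>indicator A x - \<psi> x\<bar>)"
      using iA Cc_integrable[OF Cc_inf_Cc[OF \<psi>m] m(2,1)] by (intro integrable_abs Bochner_Integration.integrable_diff)
    show "integrable m (indicator (V \<inter> \<Omega> - K) :: 'a \<Rightarrow> real)"
      using Ks by (intro integrable_real_indicator) (auto simp: top.not_eq_extremum[symmetric])
    show "\<bar>indicator A x - \<psi> x\<bar> \<le> indicator (V \<inter> \<Omega> - K) x" for x
      using \<psi>(2,3)[of x] \<psi>(4)[of x] \<psi>0[of x] K(1) V(1) A'(2) by (auto simp: indicator_def)
  qed
  also have "\<dots> = measure m ((V \<inter> \<Omega> - K) \<inter> space m)" by simp
  also have "\<dots> = measure m (V \<inter> \<Omega> - K)" unfolding sp by (rule arg_cong[where f = "measure m"]) blast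
  also have "\<dots> = measure m (V \<inter> \<Omega>) - measure m K" by (rule finite_measure_Diff[OF Ks(2,1) KV])
  also have "\<dots> < e"
  proof -
    have "A \<inter> \<Omega> = A" "K \<inter> \<Omega> = K" using A'(2) KV by blast+
    have "ennreal (measure m A) < ennreal (measure m K + e / 2)" "ennreal (measure m (V \<inter> \<Omega>)) < ennreal (measure m A + e / 2)"
      using K(3) V(3) e unfolding emM[OF A'(1)] emM[OF borel_compact[OF K(2)]] emM[OF borel_open[OF V(2)]]
        \<open>A \<inter> \<Omega> = A\<close> \<open>K \<inter> \<Omega> = K\<close> emeasure_eq_measure by simp_all
    then have "measure m A < measure m K + e / 2" "measure m (V \<inter> \<Omega>) < measure m A + e / 2"
      by (simp_all add: ennreal_less_iff)
    then show ?thesis by linarith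
  qed
  finally show ?thesis by (rule that[OF \<psi>m])
qed

lemma Cc_inf_L1_dense:
  fixes \<Omega> :: "'a::euclidean_space set" and f :: "'a \<Rightarrow> real"
  assumes \<rho>: "standard_mollifier (\<rho> :: 'a \<Rightarrow> real)" and \<Omega>: "open \<Omega>"
    and m: "finite_measure m" "sets m = borel_subsets \<Omega>" and f: "integrable m f" and e: "e > 0"
  obtains \<psi> where "\<psi> \<in> Cc_inf \<Omega>" "(\<integral>x. \<bar>f x - \<psi> x\<bar> \<partial>m) < e"
proof -
  note int = Cc_integrable[OF Cc_inf_Cc m(2,1)]
  have "\<exists>\<psi>\<in>Cc_inf \<Omega>. (\<integral>x. \<bar>f x - \<psi> x\<bar> \<partial>m) < e"
    using f e
  proof (induction arbitrary: e rule: integrable_induct)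
    case (base A c)
    obtain \<psi> where \<psi>: "\<psi> \<in> Cc_inf \<Omega>" "(\<integral>x. \<bar>indicator A x - \<psi> x\<bar> \<partial>m) < e / (\<bar>c\<bar> + 1)"
      using Cc_inf_L1_dense_indicator[OF \<rho> \<Omega> m base(1)] base(3)
      by (metis abs_ge_zero add_nonneg_pos divide_pos_pos zero_less_one)
    have "\<bar>indicator A x *\<^sub>R c - c * \<psi> x\<bar> = \<bar>c\<bar> * \<bar>indicator A x - \<psi> x\<bar>" for x
      by (simp flip: abs_mult add: algebra_simps)
    then have "(\<integral>x. \<bar>indicator A x *\<^sub>R c - c * \<psi> x\<bar> \<partial>m) = \<bar>c\<bar> * (\<integral>x. \<bar>indicator A x - \<psi> x\<bar> \<partial>m)"
      by simp
    also have "\<dots> \<le> (\<bar>c\<bar> + 1) * (\<integral>x. \<bar>indicator A x - \<psi> x\<bar> \<partial>m)"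
      by (intro mult_right_mono integral_nonneg_AE) auto
    also have "\<dots> < e" using \<psi>(2) by (simp add: field_simps)
    finally show ?case using Cc_inf_cmult[OF \<psi>(1), of c] by (intro bexI[of _ "\<lambda>x. c * \<psi> x"])
  next
    case (add f g)
    obtain \<psi> where \<psi>: "\<psi> \<in> Cc_inf \<Omega>" "(\<integral>x. \<bar>f x - \<psi> x\<bar> \<partial>m) < e / 2" using add.IH(1)[of "e/2"] add.prems by auto
    obtain \<psi>' where \<psi>': "\<psi>' \<in> Cc_inf \<Omega>" "(\<integral>x. \<bar>g x - \<psi>' x\<bar> \<partial>m) < e / 2" using add.IH(2)[of "e/2"] add.prems by auto
    have "(\<integral>x. \<bar>f x + g x - (\<psi> x + \<psi>' x)\<bar> \<partial>m) \<le> (\<integral>x. \<bar>f x - \<psi> x\<bar> + \<bar>g x - \<psi>' x\<bar> \<partial>m)"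
      using add.hyps int[OF \<psi>(1)] int[OF \<psi>'(1)] by (intro integral_mono) auto
    also have "\<dots> = (\<integral>x. \<bar>f x - \<psi> x\<bar> \<partial>m) + (\<integral>x. \<bar>g x - \<psi>' x\<bar> \<partial>m)"
      using add.hyps int[OF \<psi>(1)] int[OF \<psi>'(1)] by (intro Bochner_Integration.integral_add) auto
    also have "\<dots> < e" using \<psi> \<psi>' by simp
    finally show ?case using Cc_inf_add[OF \<psi>(1) \<psi>'(1)] by (intro bexI[of _ "\<lambda>x. \<psi> x + \<psi>' x"])
  next
    case (lim f s)
    have "(\<lambda>i. \<integral>x. \<bar>s i x - f x\<bar> \<partial>m) \<longlonglongrightarrow> 0"
      using lim.hyps by (intro L1_dominated_convergence(1)[where w = "\<lambda>x. 2 * \<bar>f x\<bar>"]) auto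
    then have "\<forall>\<^sub>F i in sequentially. (\<integral>x. \<bar>s i x - f x\<bar> \<partial>m) < e / 2"
      using lim.prems by (intro order_tendstoD) auto
    then obtain i where i: "(\<integral>x. \<bar>s i x - f x\<bar> \<partial>m) < e / 2" using eventually_happens'[OF sequentially_bot] by blast
    obtain \<psi> where \<psi>: "\<psi> \<in> Cc_inf \<Omega>" "(\<integral>x. \<bar>s i x - \<psi> x\<bar> \<partial>m) < e / 2" using lim.IH[of "e/2" i] lim.prems by auto
    have "(\<integral>x. \<bar>f x - \<psi> x\<bar> \<partial>m) \<le> (\<integral>x. \<bar>s i x - f x\<bar> + \<bar>s i x - \<psi> x\<bar> \<partial>m)"
      using lim.hyps int[OF \<psi>(1)] by (intro integral_mono) auto
    also have "\<dots> = (\<integral>x. \<bar>s i x - f x\<bar> \<partial>m) + (\<integral>x. \<bar>s i x - \<psi> x\<bar> \<partial>m)"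
      using lim.hyps int[OF \<psi>(1)] by (intro Bochner_Integration.integral_add) auto
    also have "\<dots> < e" using \<psi> i by simp
    finally show ?case using \<psi>(1) by blast
  qed
  then show ?thesis using that by blast
qed

lemma Cc_inf_L1_dense_seq:
  fixes \<Omega> :: "'a::euclidean_space set" and f :: "'a \<Rightarrow> real"
  assumes \<rho>: "standard_mollifier (\<rho> :: 'a \<Rightarrow> real)" and \<Omega>: "open \<Omega>"
    and m: "finite_measure m" "sets m = borel_subsets \<Omega>" and f: "integrable m f"
  obtains \<psi> where "\<And>i::nat. \<psi> i \<in> Cc_inf \<Omega>" "(\<lambda>i. \<integral>x. \<bar>\<psi> i x - f x\<bar> \<partial>m) \<longlonglongrightarrow> 0"
proof -
  have "\<exists>\<psi>. \<psi> \<in> Cc_inf \<Omega> \<and> (\<integral>x. \<bar>f x - \<psi> x\<bar> \<partial>m) < inverse (real (Suc i))" for i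
    using Cc_inf_L1_dense[OF \<rho> \<Omega> m f, of "inverse (real (Suc i))"] by (metis inverse_positive_iff_positive of_nat_0_less_iff zero_less_Suc)
  then obtain \<psi> where \<psi>: "\<And>i. \<psi> i \<in> Cc_inf \<Omega>" "\<And>i. (\<integral>x. \<bar>f x - \<psi> i x\<bar> \<partial>m) < inverse (real (Suc i))" by metis
  have "(\<lambda>i. \<integral>x. \<bar>\<psi> i x - f x\<bar> \<partial>m) \<longlonglongrightarrow> 0"
    using \<psi>(2) by (intro real_tendsto_sandwich[OF _ _ tendsto_const LIMSEQ_inverse_real_of_nat])
      (auto intro!: always_eventually less_imp_le simp: abs_minus_commute)
  with \<psi>(1) show ?thesis by (rule that)
qed

text \<open>Test functions approximate the indicator of a Borel set in L^1 of a majorant common to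
  both measures. This uniqueness resolves \<open>THE\<close> in \<open>divergence\<close> and
  \<open>pairing\<close>.\<close>

lemma radon_measure_on_eqI:
  fixes \<Omega> :: "'a::euclidean_space set" and \<mu> \<nu> :: "'a set \<Rightarrow> real"
  assumes \<rho>: "standard_mollifier (\<rho> :: 'a \<Rightarrow> real)" and \<Omega>: "open \<Omega>"
    and \<mu>: "radon_measure_on \<Omega> \<mu>" and \<nu>: "radon_measure_on \<Omega> \<nu>"
    and eq: "\<And>\<psi>. \<psi> \<in> Cc_inf \<Omega> \<Longrightarrow> signed_integral \<Omega> \<mu> \<psi> = signed_integral \<Omega> \<nu> \<psi>"
  shows "\<mu> = \<nu>"
proof
  fix A
  show "\<mu> A = \<nu> A"
  proof (cases "A \<in> borel_subsets \<Omega>")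
    case False then show ?thesis using \<mu> \<nu> by (simp add: radon_measure_on_def)
  next
    case True
    obtain m1 where m1: "dominates m1 \<Omega> \<mu>" using exists_dominates[OF \<mu>] .
    obtain m2 where m2: "dominates m2 \<Omega> \<nu>" using exists_dominates[OF \<nu>] .
    obtain m where m: "dominates m \<Omega> \<mu>" "dominates m \<Omega> \<nu>" using dominates_common[OF m1 m2] .
    note mD = dominatesD[OF m(1)]
    have iA: "integrable m (indicator A :: 'a \<Rightarrow> real)"
      using True mD finite_measure.emeasure_eq_measure[OF mD(1)] by simp
    obtain \<psi> where \<psi>: "\<And>i. \<psi> i \<in> Cc_inf \<Omega>" "(\<lambda>i. \<integral>x. \<bar>\<psi> i x - indicator A x\<bar> \<partial>m) \<longlonglongrightarrow> 0"
      using Cc_inf_L1_dense_seq[OF \<rho> \<Omega> mD(1,2) iA] by blast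
    have i: "integrable m (\<psi> i)" for i using Cc_integrable[OF Cc_inf_Cc[OF \<psi>(1)] mD(2,1)] .
    have "(\<lambda>i. signed_integral \<Omega> \<mu> (\<psi> i)) \<longlonglongrightarrow> \<mu> A" "(\<lambda>i. signed_integral \<Omega> \<nu> (\<psi> i)) \<longlonglongrightarrow> \<nu> A"
      using signed_integral_tendsto[OF \<mu> m(1) i iA \<psi>(2)] signed_integral_tendsto[OF \<nu> m(2) i iA \<psi>(2)]
      by (simp_all add: signed_integral_indicator[OF \<mu> True] signed_integral_indicator[OF \<nu> True])
    then show ?thesis using eq[OF \<psi>(1)] LIMSEQ_unique by simp
  qed
qed

text \<open>A functional bounded by the \<open>L\<^sup>1\<close> norm of a finite measure extends by density to \<open>L\<^sup>1\<close>,
  and its values on indicator functions form the representing measure; no Riesz theorem is needed.\<close>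

lemma L1_bounded_functional_representation:
  fixes \<Omega> :: "'a::euclidean_space set" and L :: "('a \<Rightarrow> real) \<Rightarrow> real"
  assumes \<rho>: "standard_mollifier (\<rho> :: 'a \<Rightarrow> real)" and \<Omega>: "open \<Omega>"
    and m: "finite_measure m" "sets m = borel_subsets \<Omega>"
    and add: "\<And>f g. f \<in> Cc_inf \<Omega> \<Longrightarrow> g \<in> Cc_inf \<Omega> \<Longrightarrow> L (\<lambda>x. f x + g x) = L f + L g"
    and scale: "\<And>f c. f \<in> Cc_inf \<Omega> \<Longrightarrow> L (\<lambda>x. c * f x) = c * L f"
    and bd: "\<And>f. f \<in> Cc_inf \<Omega> \<Longrightarrow> \<bar>L f\<bar> \<le> (\<integral>x. \<bar>f x\<bar> \<partial>m)"
  obtains \<mu> where "radon_measure_on \<Omega> \<mu>" "dominates m \<Omega> \<mu>"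
    "\<And>f. f \<in> Cc_inf \<Omega> \<Longrightarrow> signed_integral \<Omega> \<mu> f = L f"
proof -
  interpret finite_measure m by fact
  have sp: "space m = \<Omega>" using sets_eq_imp_space_eq[OF m(2)] by simp
  note int = Cc_integrable[OF Cc_inf_Cc m(2,1)]
  define conv where "conv s f \<longleftrightarrow> (\<forall>i. s i \<in> Cc_inf \<Omega>) \<and> (\<lambda>i. \<integral>x. \<bar>s i x - f x\<bar> \<partial>m) \<longlonglongrightarrow> 0"
    for s :: "nat \<Rightarrow> 'a \<Rightarrow> real" and f :: "'a \<Rightarrow> real"
  have diff: "L (\<lambda>x. f x - g x) = L f - L g" if "f \<in> Cc_inf \<Omega>" "g \<in> Cc_inf \<Omega>" for f g
    using add[OF that(1) Cc_inf_cmult[OF that(2), of "-1"]] scale[OF that(2), of "-1"] by simp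
  have Ldiff: "\<bar>L f - L g\<bar> \<le> (\<integral>x. \<bar>f x - h x\<bar> \<partial>m) + (\<integral>x. \<bar>g x - h x\<bar> \<partial>m)"
    if "f \<in> Cc_inf \<Omega>" "g \<in> Cc_inf \<Omega>" "integrable m h" for f g h
  proof -
    have "\<bar>L f - L g\<bar> \<le> (\<integral>x. \<bar>f x - g x\<bar> \<partial>m)"
      using bd[OF Cc_inf_diff[OF that(1,2)]] diff[OF that(1,2)] by simp
    also have "\<dots> \<le> (\<integral>x. \<bar>f x - h x\<bar> + \<bar>g x - h x\<bar> \<partial>m)"
      using int[OF that(1)] int[OF that(2)] that(3) by (intro integral_mono) auto
    also have "\<dots> = (\<integral>x. \<bar>f x - h x\<bar> \<partial>m) + (\<integral>x. \<bar>g x - h x\<bar> \<partial>m)"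
      using int[OF that(1)] int[OF that(2)] that(3) by (intro Bochner_Integration.integral_add) auto
    finally show ?thesis .
  qed
  \<comment> \<open>The bound \<open>bd\<close> makes the images of an approximating sequence Cauchy
    and any two such sequences equivalent, so the extension to L^1 does not depend on the
    sequence.\<close>
  have "\<exists>l. \<forall>s. conv s f \<longrightarrow> (\<lambda>i. L (s i)) \<longlonglongrightarrow> l" if f: "integrable m f" for f
  proof -
    obtain s0 where s0: "conv s0 f"
      using Cc_inf_L1_dense_seq[OF \<rho> \<Omega> m f] unfolding conv_def by blast
    have lim0: "(\<lambda>i. L (s i) - L (t i)) \<longlonglongrightarrow> 0" if st: "conv s f" "conv t f" for s t
    proof (rule Lim_null_comparison)
      show "\<forall>\<^sub>F i in sequentially. norm (L (s i) - L (t i))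
          \<le> (\<integral>x. \<bar>s i x - f x\<bar> \<partial>m) + (\<integral>x. \<bar>t i x - f x\<bar> \<partial>m)"
        using st Ldiff[OF _ _ f] by (auto simp: conv_def)
      show "(\<lambda>i. (\<integral>x. \<bar>s i x - f x\<bar> \<partial>m) + (\<integral>x. \<bar>t i x - f x\<bar> \<partial>m)) \<longlonglongrightarrow> 0"
        using st tendsto_add[of _ 0 _ _ 0] by (auto simp: conv_def)
    qed
    have "Cauchy (\<lambda>i. L (s0 i))"
    proof (rule metric_CauchyI)
      fix e :: real assume "e > 0"
      then have "\<forall>\<^sub>F i in sequentially. (\<integral>x. \<bar>s0 i x - f x\<bar> \<partial>m) < e / 2"
        using s0 by (intro order_tendstoD) (auto simp: conv_def)
      then obtain N where N: "\<And>i. i \<ge> N \<Longrightarrow> (\<integral>x. \<bar>s0 i x - f x\<bar> \<partial>m) < e / 2"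
        by (auto simp: eventually_sequentially)
      show "\<exists>M. \<forall>i\<ge>M. \<forall>j\<ge>M. dist (L (s0 i)) (L (s0 j)) < e"
      proof (intro exI[of _ N] allI impI)
        fix i j assume "i \<ge> N" "j \<ge> N"
        then show "dist (L (s0 i)) (L (s0 j)) < e"
          using Ldiff[of "s0 i" "s0 j" f] N[of i] N[of j] s0 f by (auto simp: conv_def dist_real_def)
      qed
    qed
    then obtain l where l: "(\<lambda>i. L (s0 i)) \<longlonglongrightarrow> l" using Cauchy_convergent convergent_def by blast
    have "(\<lambda>i. L (s i)) \<longlonglongrightarrow> l" if "conv s f" for s
      using tendsto_add[OF lim0[OF that s0] l] by simp
    then show ?thesis by blast
  qed
  then obtain E where E: "\<And>f s. integrable m f \<Longrightarrow> conv s f \<Longrightarrow> (\<lambda>i. L (s i)) \<longlonglongrightarrow> E f" by metis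
  have ex: "\<exists>s. conv s f" if "integrable m f" for f
    using Cc_inf_L1_dense_seq[OF \<rho> \<Omega> m that] unfolding conv_def by blast
  have Eadd: "E (\<lambda>x. f x + g x) = E f + E g" if fg: "integrable m f" "integrable m g" for f g
  proof -
    obtain s t where s: "conv s f" and t: "conv t g" using ex fg by metis
    have i: "integrable m (s i)" "integrable m (t i)" for i using s t int by (auto simp: conv_def)
    have "conv (\<lambda>i x. s i x + t i x) (\<lambda>x. f x + g x)"
      unfolding conv_def
    proof (intro conjI allI Cc_inf_add)
      show "(\<lambda>i. \<integral>x. \<bar>s i x + t i x - (f x + g x)\<bar> \<partial>m) \<longlonglongrightarrow> 0"
      proof (rule Lim_null_comparison)
        have "(\<integral>x. \<bar>s i x + t i x - (f x + g x)\<bar> \<partial>m) \<le> (\<integral>x. \<bar>s i x - f x\<bar> + \<bar>t i x - g x\<bar> \<partial>m)" for i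
          using i fg by (intro integral_mono) auto
        also have "(\<integral>x. \<bar>s i x - f x\<bar> + \<bar>t i x - g x\<bar> \<partial>m) = (\<integral>x. \<bar>s i x - f x\<bar> \<partial>m) + (\<integral>x. \<bar>t i x - g x\<bar> \<partial>m)" for i
          using i fg by (intro Bochner_Integration.integral_add) auto
        finally show "\<forall>\<^sub>F i in sequentially. norm (\<integral>x. \<bar>s i x + t i x - (f x + g x)\<bar> \<partial>m)
            \<le> (\<integral>x. \<bar>s i x - f x\<bar> \<partial>m) + (\<integral>x. \<bar>t i x - g x\<bar> \<partial>m)"
          by (auto simp: integral_nonneg_AE)
        show "(\<lambda>i. (\<integral>x. \<bar>s i x - f x\<bar> \<partial>m) + (\<integral>x. \<bar>t i x - g x\<bar> \<partial>m)) \<longlonglongrightarrow> 0"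
          using s t tendsto_add[of _ 0 _ _ 0] by (auto simp: conv_def)
      qed
    qed (use s t in \<open>auto simp: conv_def\<close>)
    from E[OF _ this] fg have "(\<lambda>i. L (\<lambda>x. s i x + t i x)) \<longlonglongrightarrow> E (\<lambda>x. f x + g x)" by simp
    moreover have "(\<lambda>i. L (\<lambda>x. s i x + t i x)) = (\<lambda>i. L (s i) + L (t i))"
      using s t add by (auto simp: conv_def)
    moreover have "(\<lambda>i. L (s i) + L (t i)) \<longlonglongrightarrow> E f + E g"
      by (intro tendsto_add E fg s t)
    ultimately show ?thesis using LIMSEQ_unique by simp
  qed
  have Escale: "E (\<lambda>x. c * f x) = c * E f" if f: "integrable m f" for f c
  proof -
    obtain s where s: "conv s f" using ex f by metis
    have "(\<integral>x. \<bar>c * s i x - c * f x\<bar> \<partial>m) = \<bar>c\<bar> * (\<integral>x. \<bar>s i x - f x\<bar> \<partial>m)" for i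
      by (simp flip: right_diff_distrib add: abs_mult)
    then have "conv (\<lambda>i x. c * s i x) (\<lambda>x. c * f x)"
      using s tendsto_mult_right_zero[of _ _ "\<bar>c\<bar>"] by (auto simp: conv_def Cc_inf_cmult)
    from E[OF _ this] f have "(\<lambda>i. L (\<lambda>x. c * s i x)) \<longlonglongrightarrow> E (\<lambda>x. c * f x)" by simp
    moreover have "(\<lambda>i. L (\<lambda>x. c * s i x)) = (\<lambda>i. c * L (s i))" using s scale by (auto simp: conv_def)
    moreover have "(\<lambda>i. c * L (s i)) \<longlonglongrightarrow> c * E f"
      by (intro tendsto_mult_left E f s)
    ultimately show ?thesis using LIMSEQ_unique by simp
  qed
  have Ebd: "\<bar>E f\<bar> \<le> (\<integral>x. \<bar>f x\<bar> \<partial>m)" if f: "integrable m f" for f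
  proof -
    obtain s where s: "conv s f" using ex f by metis
    have i: "integrable m (s i)" for i using s int by (auto simp: conv_def)
    have "\<bar>L (s i)\<bar> \<le> (\<integral>x. \<bar>s i x - f x\<bar> \<partial>m) + (\<integral>x. \<bar>f x\<bar> \<partial>m)" for i
    proof -
      have "\<bar>L (s i)\<bar> \<le> (\<integral>x. \<bar>s i x\<bar> \<partial>m)" using bd s by (auto simp: conv_def)
      also have "\<dots> \<le> (\<integral>x. \<bar>s i x - f x\<bar> + \<bar>f x\<bar> \<partial>m)" using i f by (intro integral_mono) auto
      also have "\<dots> = (\<integral>x. \<bar>s i x - f x\<bar> \<partial>m) + (\<integral>x. \<bar>f x\<bar> \<partial>m)"
        using i f by (intro Bochner_Integration.integral_add) auto
      finally show ?thesis .
    qed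
    note le = this
    have l1: "(\<lambda>i. \<bar>L (s i)\<bar>) \<longlonglongrightarrow> \<bar>E f\<bar>" by (intro tendsto_rabs E f s)
    have l2: "(\<lambda>i. (\<integral>x. \<bar>s i x - f x\<bar> \<partial>m) + (\<integral>x. \<bar>f x\<bar> \<partial>m)) \<longlonglongrightarrow> 0 + (\<integral>x. \<bar>f x\<bar> \<partial>m)"
      using s by (intro tendsto_add) (auto simp: conv_def)
    have "\<bar>E f\<bar> \<le> 0 + (\<integral>x. \<bar>f x\<bar> \<partial>m)" by (rule LIMSEQ_le[OF l1 l2]) (auto intro: le)
    then show ?thesis by simp
  qed
  have Econg: "E f = E g" if fg: "integrable m f" "integrable m g" "\<And>x. x \<in> space m \<Longrightarrow> f x = g x" for f g
  proof -
    have "\<bar>E (\<lambda>x. f x + (-1) * g x)\<bar> \<le> (\<integral>x. \<bar>f x + (-1) * g x\<bar> \<partial>m)" using fg by (intro Ebd) auto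
    also have "\<dots> = (\<integral>x. 0 \<partial>m)" using fg(3) by (intro Bochner_Integration.integral_cong) auto
    finally have "E (\<lambda>x. f x + (-1) * g x) = 0" by simp
    moreover have "E (\<lambda>x. f x + (-1) * g x) = E f + (-1) * E g"
      using fg Eadd[of f "\<lambda>x. (-1) * g x"] Escale[of g "-1"] by auto
    ultimately show ?thesis by simp
  qed
  have Elim: "(\<lambda>i. E (s i)) \<longlonglongrightarrow> E f" if "\<And>i. integrable m (s i)" "integrable m f"
    "(\<lambda>i. \<integral>x. \<bar>s i x - f x\<bar> \<partial>m) \<longlonglongrightarrow> 0" for s :: "nat \<Rightarrow> 'a \<Rightarrow> real" and f
  proof -
    have "(\<lambda>i. E (s i) - E f) \<longlonglongrightarrow> 0"
    proof (rule Lim_null_comparison[OF _ that(3)])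
      have "E (s i) - E f = E (\<lambda>x. s i x + (-1) * f x)" for i
        using that Eadd[of "s i" "\<lambda>x. (-1) * f x"] Escale[of f "-1"] by auto
      then show "\<forall>\<^sub>F i in sequentially. norm (E (s i) - E f) \<le> (\<integral>x. \<bar>s i x - f x\<bar> \<partial>m)"
        using that Ebd[of "\<lambda>x. s _ x + (-1) * f x"] by auto
    qed
    then show ?thesis by (simp add: LIM_zero_iff)
  qed
  \<comment> \<open>The value 0 off the Borel subsets of \<Omega> is the convention built into
    \<open>radon_measure_on\<close>.\<close>
  define \<mu> where "\<mu> A = (if A \<in> borel_subsets \<Omega> then E (indicator A) else 0)" for A
  have iA: "integrable m (indicator A :: 'a \<Rightarrow> real)" if "A \<in> borel_subsets \<Omega>" for A
    using that m(2) by (simp add: emeasure_eq_measure)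
  have \<mu>: "radon_measure_on \<Omega> \<mu>"
    unfolding radon_measure_on_def
  proof (intro conjI allI impI)
    fix A :: "nat \<Rightarrow> 'a set" assume A: "range A \<subseteq> borel_subsets \<Omega>" and dis: "disjoint_family A"
    have An: "A i \<in> borel_subsets \<Omega>" for i using A by auto
    have Un: "(\<Union>i. A i) \<in> borel_subsets \<Omega>" "(\<Union>i<n. A i) \<in> borel_subsets \<Omega>" for n using A by auto
    have "(\<Sum>i<n. \<mu> (A i)) = E (indicator (\<Union>i<n. A i))" for n
    proof (induction n)
      case 0
      \<comment> \<open>The value at the zero function is obtained by scaling with 0.\<close>
      have "E (\<lambda>x. 0 * indicator {} x) = 0 * E (indicator {})" using iA[of "{}"] by (intro Escale) simp
      then show ?case by (simp add: fun_eq_iff indicator_def[abs_def])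
    next
      case (Suc n)
      have "E (indicator (\<Union>i<Suc n. A i)) = E (\<lambda>x. indicator (\<Union>i<n. A i) x + indicator (A n) x)"
      proof (rule Econg)
        have "(\<Union>i<n. A i) \<inter> A n = {}"
          using dis by (auto simp: disjoint_family_on_def) (metis disjoint_iff less_irrefl)
        then show "indicator (\<Union>i<Suc n. A i) x = (indicator (\<Union>i<n. A i) x + indicator (A n) x :: real)" for x
          by (auto simp: indicator_def lessThan_Suc)
      qed (use iA Un An in auto)
      also have "\<dots> = E (indicator (\<Union>i<n. A i)) + E (indicator (A n))"
        using iA Un An by (intro Eadd) auto
      finally show ?case using Suc An[of n] by (simp add: \<mu>_def)
    qed
    moreover have "(\<lambda>n. E (indicator (\<Union>i<n. A i))) \<longlonglongrightarrow> E (indicator (\<Union>i. A i))"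
    proof (rule Elim)
      show "(\<lambda>n. \<integral>x. \<bar>indicator (\<Union>i<n. A i) x - indicator (\<Union>i. A i) x :: real\<bar> \<partial>m) \<longlonglongrightarrow> 0"
      proof (rule L1_dominated_convergence(1)[where w = "\<lambda>_. 1"])
        show "(\<lambda>n. indicator (\<Union>i<n. A i) x :: real) \<longlonglongrightarrow> indicator (\<Union>i. A i) x" for x
          by (rule LIMSEQ_indicator_UN)
      qed (use Un m(2) in auto)
    qed (use iA Un in auto)
    ultimately show "(\<lambda>i. \<mu> (A i)) sums \<mu> (\<Union>i. A i)" using Un by (simp add: sums_def \<mu>_def)
  qed (simp add: \<mu>_def)
  have dom: "dominates m \<Omega> \<mu>"
    unfolding dominates_def
  proof (intro conjI ballI m)
    fix A assume A: "A \<in> borel_subsets \<Omega>"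
    have "\<bar>\<mu> A\<bar> \<le> (\<integral>x. \<bar>indicator A x\<bar> \<partial>m)" using Ebd[OF iA[OF A]] A by (simp add: \<mu>_def)
    also have "\<dots> = measure m A" using borel_subsets_subset[OF A] sp by (simp add: Int_absorb2)
    finally show "norm (\<mu> A) \<le> measure m A" by simp
  qed
  \<comment> \<open>Both sides are linear and continuous in L^1 of \<open>m\<close> and agree on
    indicators.\<close>
  have si: "signed_integral \<Omega> \<mu> f = E f" if "integrable m f" for f
    using that
  proof (induction rule: integrable_induct)
    case (base A c)
    have "signed_integral \<Omega> \<mu> (\<lambda>x. c * indicator A x) = c * \<mu> A"
      using base m(2) by (simp add: signed_integral_cmult signed_integral_indicator[OF \<mu>])
    also have "\<dots> = E (\<lambda>x. c * indicator A x)" using base m(2) Escale[OF iA] by (simp add: \<mu>_def)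
    finally show ?case by (simp add: mult.commute)
  next
    case (add f g)
    then show ?case using signed_integral_add[OF \<mu> dom] Eadd by simp
  next
    case (lim f s)
    have l: "(\<lambda>i. \<integral>x. \<bar>s i x - f x\<bar> \<partial>m) \<longlonglongrightarrow> 0"
      using lim.hyps by (intro L1_dominated_convergence(1)[where w = "\<lambda>x. 2 * \<bar>f x\<bar>"]) auto
    show ?case
      using signed_integral_tendsto[OF \<mu> dom lim.hyps(1,4) l] Elim[OF lim.hyps(1,4) l] lim.IH LIMSEQ_unique by simp
  qed
  show ?thesis
  proof (rule that[OF \<mu> dom])
    fix f assume f: "f \<in> Cc_inf \<Omega>"
    have "conv (\<lambda>_. f) f" using f by (simp add: conv_def)
    from E[OF int[OF f] this] have "E f = L f" by (simp add: LIMSEQ_const_iff)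
    then show "signed_integral \<Omega> \<mu> f = L f" using si[OF int[OF f]] by simp
  qed
qed

section \<open>Weak compactness of bounded measures\<close>

text \<open>Each coordinate is rounded down to a multiple of \<open>1 / 2 ^ N\<close>. The cells are
  half open, so at every level they partition the space and their masses add up without boundary
  corrections.\<close>

definition dyadic_floor :: "nat \<Rightarrow> 'a::euclidean_space \<Rightarrow> 'a" where
  "dyadic_floor N x = (\<Sum>b\<in>Basis. (of_int \<lfloor>2 ^ N * (x \<bullet> b)\<rfloor> / 2 ^ N) *\<^sub>R b)"

lemma dyadic_floor_inner: "b \<in> Basis \<Longrightarrow> dyadic_floor N x \<bullet> b = of_int \<lfloor>2 ^ N * (x \<bullet> b)\<rfloor> / 2 ^ N"
  unfolding dyadic_floor_def by (simp add: inner_sum_left inner_Basis if_distrib sum.delta cong: if_cong)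

lemma dyadic_floor_dist: "norm (x - dyadic_floor N x) \<le> DIM('a) / 2 ^ N" for x :: "'a::euclidean_space"
proof -
  have "norm (x - dyadic_floor N x) \<le> (\<Sum>b\<in>Basis. \<bar>(x - dyadic_floor N x) \<bullet> b\<bar>)" by (rule norm_le_l1)
  also have "\<dots> \<le> (\<Sum>b\<in>(Basis::'a set). 1 / 2 ^ N)"
  proof (rule sum_mono)
    fix b :: 'a assume b: "b \<in> Basis"
    have "(x - dyadic_floor N x) \<bullet> b = (2 ^ N * (x \<bullet> b) - of_int \<lfloor>2 ^ N * (x \<bullet> b)\<rfloor>) / 2 ^ N"
      using b by (simp add: inner_diff_left dyadic_floor_inner diff_divide_distrib)
    moreover have "\<bar>2 ^ N * (x \<bullet> b) - of_int \<lfloor>2 ^ N * (x \<bullet> b)\<rfloor>\<bar> \<le> 1"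
      using of_int_floor_le[of "2 ^ N * (x \<bullet> b)"] floor_correct[of "2 ^ N * (x \<bullet> b)"] by linarith
    ultimately show "\<bar>(x - dyadic_floor N x) \<bullet> b\<bar> \<le> 1 / 2 ^ N"
      by (simp add: abs_divide divide_right_mono)
  qed
  finally show ?thesis by simp
qed

text \<open>Taking an integer part before dividing by \<open>2 ^ (M - N)\<close> does not change the
  integer part of the quotient. Hence the cells are nested, and rounding at successive levels is
  coherent.\<close>

lemma dyadic_floor_compose:
  assumes "N \<le> M" shows "dyadic_floor N (dyadic_floor M x) = dyadic_floor N x"
proof (rule euclidean_eqI)
  fix b :: 'a assume b: "b \<in> Basis"
  define t where "t = 2 ^ M * (x \<bullet> b)"
  have M: "2 ^ M = (2 ^ N * 2 ^ (M - N) :: real)" using assms by (simp flip: power_add)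
  have "\<lfloor>2 ^ N * (of_int \<lfloor>t\<rfloor> / 2 ^ M) :: real\<rfloor> = \<lfloor>of_int \<lfloor>t\<rfloor> / (of_int (2 ^ (M - N)) :: real)\<rfloor>"
    unfolding M by simp
  also have "\<dots> = \<lfloor>t\<rfloor> div 2 ^ (M - N)" by (rule floor_divide_of_int_eq)
  also have "\<dots> = \<lfloor>t / of_int (2 ^ (M - N))\<rfloor>" by (rule floor_divide_real_eq_div[symmetric]) simp
  also have "t / of_int (2 ^ (M - N)) = 2 ^ N * (x \<bullet> b)" unfolding t_def M by simp
  finally show "dyadic_floor N (dyadic_floor M x) \<bullet> b = dyadic_floor N x \<bullet> b"
    using b by (simp add: dyadic_floor_inner t_def)
qed

lemma dyadic_floor_measurable [measurable]: "dyadic_floor N \<in> borel_measurable borel"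
  unfolding dyadic_floor_def[abs_def] by measurable

lemma finite_dyadic_floor:
  assumes "bounded B" shows "finite (dyadic_floor N ` (B :: 'a::euclidean_space set))"
proof -
  obtain R where R: "\<And>x. x \<in> B \<Longrightarrow> norm x \<le> R" using assms bounded_iff by metis
  define I where "I = {- \<lceil>2 ^ N * R\<rceil> - 1 .. \<lceil>2 ^ N * R\<rceil> + 1}"
  define G where "G h = (\<Sum>b\<in>Basis. (of_int (h b) / 2 ^ N) *\<^sub>R b)" for h :: "'a \<Rightarrow> int"
  have "dyadic_floor N ` B \<subseteq> G ` (PiE Basis (\<lambda>_. I))"
  proof
    fix y assume "y \<in> dyadic_floor N ` B"
    then obtain x where x: "x \<in> B" "y = dyadic_floor N x" by auto
    define h where "h = restrict (\<lambda>b. \<lfloor>2 ^ N * (x \<bullet> b)\<rfloor>) Basis"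
    have "y = G h" unfolding x dyadic_floor_def G_def h_def by (intro sum.cong) auto
    moreover have "h \<in> PiE Basis (\<lambda>_. I)"
    proof (intro PiE_I)
      fix b :: 'a assume b: "b \<in> Basis"
      have "\<bar>x \<bullet> b\<bar> \<le> R" using Basis_le_norm[OF b, of x] R[OF x(1)] by simp
      then have "\<bar>2 ^ N * (x \<bullet> b)\<bar> \<le> 2 ^ N * R" by (simp add: abs_mult)
      then show "h b \<in> I" unfolding h_def I_def using b by simp linarith
    qed (auto simp: h_def)
    ultimately show "y \<in> G ` (PiE Basis (\<lambda>_. I))" by blast
  qed
  moreover have "finite (G ` (PiE Basis (\<lambda>_. I)))" by (intro finite_imageI finite_PiE) (auto simp: I_def)
  ultimately show ?thesis by (rule finite_subset)
qed

section \<open>The inverse limit of the dyadic grids\<close>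

context
  fixes B :: "'a::euclidean_space set"
begin

text \<open>The inverse limit of the finite grids. It contains more than the roundings of points: on
  the unit interval the sequence \<open>1 - 1 / 2 ^ N\<close> is coherent, although its limit 1
  rounds to the constant sequence 1. Such extra elements make the space compact.\<close>

definition dyadic_seqs :: "(nat \<Rightarrow> 'a) set" where
  "dyadic_seqs = {\<omega>. \<forall>N. \<omega> N \<in> dyadic_floor N ` B \<and> \<omega> N = dyadic_floor N (\<omega> (Suc N))}"

text \<open>\<open>S\<close> may be any set, since only its trace on the finite grid of level
  \<open>N\<close> matters.\<close>

definition cylinder :: "nat \<Rightarrow> 'a set \<Rightarrow> (nat \<Rightarrow> 'a) set" where
  "cylinder N S = {\<omega> \<in> dyadic_seqs. \<omega> N \<in> S}"

definition cylinders :: "(nat \<Rightarrow> 'a) set set" where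
  "cylinders = {cylinder N S | N S. True}"

context
  assumes B: "bounded B"
begin

lemma dyadic_seqsD:
  assumes "\<omega> \<in> dyadic_seqs"
  shows "\<omega> N \<in> dyadic_floor N ` B" "\<omega> N = dyadic_floor N (\<omega> (Suc N))"
  using assms unfolding dyadic_seqs_def by blast+

lemma dyadic_seqs_project:
  assumes \<omega>: "\<omega> \<in> dyadic_seqs" and "N \<le> M" shows "\<omega> N = dyadic_floor N (\<omega> M)"
  using \<open>N \<le> M\<close>
proof (induction M rule: dec_induct)
  case base
  have "\<omega> N \<in> dyadic_floor N ` B" by (rule dyadic_seqsD(1)[OF \<omega>])
  then obtain x where "\<omega> N = dyadic_floor N x" by blast
  then show ?case by (simp add: dyadic_floor_compose)
next
  case (step M)
  have "\<omega> M = dyadic_floor M (\<omega> (Suc M))" by (rule dyadic_seqsD(2)[OF \<omega>])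
  then have "dyadic_floor N (\<omega> M) = dyadic_floor N (dyadic_floor M (\<omega> (Suc M)))" by (rule arg_cong)
  also have "\<dots> = dyadic_floor N (\<omega> (Suc M))" using step.hyps by (intro dyadic_floor_compose)
  finally show ?case using step.IH by (rule trans[rotated])
qed

text \<open>A condition on a coarse coordinate is a condition on any finer one; this brings two
  cylinders to a common level.\<close>

lemma cylinder_lift: "N \<le> M \<Longrightarrow> cylinder N S = cylinder M {y. dyadic_floor N y \<in> S}"
  unfolding cylinder_def using dyadic_seqs_project by auto

lemma dyadic_floor_in_dyadic_seqs: "x \<in> B \<Longrightarrow> (\<lambda>N. dyadic_floor N x) \<in> dyadic_seqs"
  by (auto simp: dyadic_seqs_def dyadic_floor_compose)

lemma ring_of_sets_cylinders: "ring_of_sets dyadic_seqs cylinders"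
proof (rule ring_of_setsI)
  show "cylinders \<subseteq> Pow dyadic_seqs" by (auto simp: cylinders_def cylinder_def)
  have "{} = cylinder 0 {}" by (simp add: cylinder_def)
  then show "{} \<in> cylinders" by (auto simp: cylinders_def)
  fix a b assume "a \<in> cylinders" "b \<in> cylinders"
  then obtain N S M T where a: "a = cylinder N S" and b: "b = cylinder M T" by (auto simp: cylinders_def)
  define K where "K = max N M"
  obtain S' T' where ab: "a = cylinder K S'" "b = cylinder K T'"
    using a b cylinder_lift[of N K S] cylinder_lift[of M K T] by (auto simp: K_def)
  have "a \<union> b = cylinder K (S' \<union> T')" "a - b = cylinder K (S' - T')"
    unfolding ab by (auto simp: cylinder_def)
  then show "a \<union> b \<in> cylinders" "a - b \<in> cylinders" by (auto simp: cylinders_def)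
qed

text \<open>Coherence links only consecutive coordinates and is the preimage of a finite set under a
  continuous map, so the space is a closed subset of a product of finite sets.\<close>

lemma compact_dyadic_seqs: "compact dyadic_seqs"
proof -
  have fin: "finite (dyadic_floor N ` B)" for N by (rule finite_dyadic_floor[OF B])
  have "compactin (product_topology (\<lambda>_. euclidean) UNIV) (PiE UNIV (\<lambda>N. dyadic_floor N ` B))"
    using fin by (subst compactin_PiE) (auto simp: finite_imp_compact)
  then have c: "compact (PiE UNIV (\<lambda>N. dyadic_floor N ` B))"
    by (simp add: euclidean_product_topology)
  have cl: "closed ((\<lambda>\<omega>. (\<omega> N, \<omega> (Suc N))) -` ((\<lambda>y. (dyadic_floor N y, y)) ` (dyadic_floor (Suc N) ` B)))" for N
  proof (rule closed_vimage)
    show "closed ((\<lambda>y. (dyadic_floor N y, y)) ` (dyadic_floor (Suc N) ` B))"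
      using fin by (intro finite_imp_closed) auto
    show "continuous_on UNIV (\<lambda>\<omega> :: nat \<Rightarrow> 'a. (\<omega> N, \<omega> (Suc N)))"
      by (intro continuous_on_Pair continuous_on_product_coordinates)
  qed
  have "dyadic_seqs = PiE UNIV (\<lambda>N. dyadic_floor N ` B) \<inter>
     (\<Inter>N. (\<lambda>\<omega>. (\<omega> N, \<omega> (Suc N))) -` ((\<lambda>y. (dyadic_floor N y, y)) ` (dyadic_floor (Suc N) ` B)))"
    (is "_ = ?P \<inter> (\<Inter>N. ?Q N)")
  proof (intro equalityI subsetI)
    fix \<omega> assume \<omega>: "\<omega> \<in> dyadic_seqs"
    have "(\<omega> N, \<omega> (Suc N)) \<in> (\<lambda>y. (dyadic_floor N y, y)) ` (dyadic_floor (Suc N) ` B)" for N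
      using dyadic_seqsD(1)[OF \<omega>, of "Suc N"] dyadic_seqsD(2)[OF \<omega>, of N] by (metis (no_types, lifting) image_eqI)
    moreover have "\<omega> \<in> ?P" using dyadic_seqsD(1)[OF \<omega>] by (simp add: PiE_iff)
    ultimately show "\<omega> \<in> ?P \<inter> (\<Inter>N. ?Q N)" unfolding vimage_def by simp
  next
    fix \<omega> assume \<omega>: "\<omega> \<in> ?P \<inter> (\<Inter>N. ?Q N)"
    have "\<omega> N \<in> dyadic_floor N ` B" for N using \<omega> by (simp add: PiE_iff)
    moreover have "\<omega> N = dyadic_floor N (\<omega> (Suc N))" for N
    proof -
      have "\<omega> \<in> ?Q N" using \<omega> by simp
      then show ?thesis by (elim vimageE imageE) simp
    qed
    ultimately show "\<omega> \<in> dyadic_seqs" unfolding dyadic_seqs_def by (intro CollectI allI conjI)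
  qed
  then show ?thesis using c cl by (auto intro!: compact_Int_closed closed_INT)
qed

lemma closed_cylinder: "closed (cylinder N S)"
proof -
  have "cylinder N S = dyadic_seqs \<inter> (\<lambda>\<omega>. \<omega> N) -` (S \<inter> dyadic_floor N ` B)"
    unfolding cylinder_def using dyadic_seqsD(1) by blast
  moreover have "closed ((\<lambda>\<omega> :: nat \<Rightarrow> 'a. \<omega> N) -` (S \<inter> dyadic_floor N ` B))"
    using finite_dyadic_floor[OF B]
    by (intro closed_vimage continuous_on_product_coordinates finite_imp_closed) auto
  ultimately show ?thesis using compact_imp_closed[OF compact_dyadic_seqs] by auto
qed

text \<open>The finite intersection property of compact sets. It supplies the continuity at the
  empty set required by the Caratheodory extension.\<close>

lemma cylinders_decseq_empty:
  assumes A: "range A \<subseteq> cylinders" and dec: "decseq A" and emp: "(\<Inter>i::nat. A i) = {}"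
  shows "\<exists>i. A i = {}"
proof (rule ccontr)
  assume ne: "\<not> ?thesis"
  have "dyadic_seqs \<inter> (\<Inter>i\<in>UNIV. A i) \<noteq> {}"
  proof (rule compact_imp_fip_image[OF compact_dyadic_seqs])
    show "closed (A i)" for i using A closed_cylinder by (auto simp: cylinders_def image_subset_iff) metis
    fix I' :: "nat set" assume I': "finite I'"
    \<comment> \<open>Inserting 0 covers the empty index set.\<close>
    obtain \<omega> where \<omega>: "\<omega> \<in> A (Max (insert 0 I'))" using ne by blast
    have "\<omega> \<in> A i" if "i \<in> I'" for i
      using decseqD[OF dec, of i "Max (insert 0 I')"] I' that \<omega> by auto
    moreover have "\<omega> \<in> dyadic_seqs"
      using \<omega> A by (force simp: cylinders_def cylinder_def image_subset_iff)
    ultimately show "dyadic_seqs \<inter> (\<Inter>i\<in>I'. A i) \<noteq> {}" by blast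
  qed
  with emp show False by simp
qed

lemma dyadic_seqs_dist:
  assumes "\<omega> \<in> dyadic_seqs" "N \<le> M" shows "norm (\<omega> M - \<omega> N) \<le> DIM('a) / 2 ^ N"
  using dyadic_floor_dist[of "\<omega> M" N] dyadic_seqs_project[OF assms] by simp

lemma dyadic_seqs_convergent:
  assumes \<omega>: "\<omega> \<in> dyadic_seqs" shows "\<omega> \<longlonglongrightarrow> lim \<omega>" "norm (lim \<omega> - \<omega> N) \<le> DIM('a) / 2 ^ N"
proof -
  have null: "(\<lambda>N. real DIM('a) / 2 ^ N) \<longlonglongrightarrow> 0"
    using LIMSEQ_divide_realpow_zero[of 2 "real DIM('a)"] by simp
  have "Cauchy \<omega>"
  proof (rule metric_CauchyI)
    fix e :: real assume "e > 0"
    then have "\<forall>\<^sub>F N in sequentially. real DIM('a) / 2 ^ N < e / 2" using null by (intro order_tendstoD) auto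
    then obtain N where N: "real DIM('a) / 2 ^ N < e / 2" by (auto simp: eventually_sequentially)
    have *: "dist (\<omega> M) (\<omega> N) < e / 2" if "M \<ge> N" for M
      using le_less_trans[OF dyadic_seqs_dist[OF \<omega> that] N] by (simp only: dist_norm)
    show "\<exists>N. \<forall>m\<ge>N. \<forall>n\<ge>N. dist (\<omega> m) (\<omega> n) < e"
      using * dist_triangle_half_l by (intro exI[of _ N]) blast
  qed
  then show l: "\<omega> \<longlonglongrightarrow> lim \<omega>" using Cauchy_convergent convergent_LIMSEQ_iff by blast
  have "(\<lambda>M. norm (\<omega> M - \<omega> N)) \<longlonglongrightarrow> norm (lim \<omega> - \<omega> N)" by (intro tendsto_intros l)
  then show "norm (lim \<omega> - \<omega> N) \<le> DIM('a) / 2 ^ N"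
    using dyadic_seqs_dist[OF \<omega>] by (intro LIMSEQ_le_const2) auto
qed

end

end

section \<open>From cell masses to a limit measure\<close>

lemma cylinder_preimage:
  "{x \<in> B. (\<lambda>N. dyadic_floor N x) \<in> cylinder B N S} = {x \<in> B. dyadic_floor N x \<in> S}"
  if "bounded B"
  using dyadic_floor_in_dyadic_seqs[OF that] by (auto simp: cylinder_def)

text \<open>The countably many cell masses of one measure form a point of a product of intervals
  \<open>{0..C}\<close>; sequential compactness of this product replaces a diagonal extraction.
  Convergence for arbitrary \<open>S\<close> follows by summing over finitely many cells.\<close>

lemma convergent_dyadic_masses:
  fixes \<sigma> :: "nat \<Rightarrow> 'a::euclidean_space measure"
  assumes fin: "\<And>k. finite_measure (\<sigma> k)" and sets: "\<And>k. sets (\<sigma> k) = sets borel"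
    and mass: "\<And>k. measure (\<sigma> k) UNIV \<le> C"
    and B: "bounded B" "B \<noteq> {}" "B \<in> sets borel"
  obtains r where "strict_mono r"
    "\<And>N S. convergent (\<lambda>k. measure (\<sigma> (r k)) {x \<in> B. dyadic_floor N x \<in> S})"
proof -
  have sp: "space (\<sigma> k) = UNIV" for k using sets_eq_imp_space_eq[OF sets] by simp
  have finD: "finite (dyadic_floor N ` B)" for N by (rule finite_dyadic_floor[OF B(1)])
  have fib: "{x \<in> B. dyadic_floor N x = y} \<in> sets borel" for N and y :: 'a
  proof -
    have "{x \<in> B. dyadic_floor N x = y} = B \<inter> (dyadic_floor N -` {y} \<inter> space borel)" by auto
    then show ?thesis using B(3) measurable_sets[OF dyadic_floor_measurable, of "{y}" N] by simp
  qed
  define Q where "Q = (SIGMA N:UNIV. dyadic_floor N ` B)"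
  have Q: "countable Q" "Q \<noteq> {}"
    unfolding Q_def using B(2) by (auto intro!: countable_SIGMA intro: countable_finite finD)
  define h where "h = from_nat_into Q"
  define u where "u k j = measure (\<sigma> k) {x \<in> B. dyadic_floor (fst (h j)) x = snd (h j)}" for k j
  have "u k \<in> PiE UNIV (\<lambda>_. {0..C})" for k
  proof -
    interpret finite_measure "\<sigma> k" by (rule fin)
    have "measure (\<sigma> k) A \<le> C" for A
      using mass[of k] bounded_measure[of A] sp[of k] by simp
    then show ?thesis by (simp add: u_def PiE_iff)
  qed
  moreover have "seq_compact (PiE UNIV (\<lambda>_::nat. {0..C}))"
  proof (rule compact_imp_seq_compact)
    have "compactin (product_topology (\<lambda>_. euclidean) UNIV) (PiE UNIV (\<lambda>_::nat. {0..C}))"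
      by (subst compactin_PiE) auto
    then show "compact (PiE UNIV (\<lambda>_::nat. {0..C}))" by (simp add: euclidean_product_topology)
  qed
  ultimately obtain l r where r: "strict_mono r" "(u \<circ> r) \<longlonglongrightarrow> l"
    unfolding seq_compact_def by meson
  have uj: "(\<lambda>k. u (r k) j) \<longlonglongrightarrow> l j" for j
    using continuous_on_tendsto_compose[OF continuous_on_product_coordinates r(2), of j] by (simp add: o_def)
  have pt: "convergent (\<lambda>k. measure (\<sigma> (r k)) {x \<in> B. dyadic_floor N x = y})" if y: "y \<in> dyadic_floor N ` B" for N y
  proof -
    have "(N, y) \<in> range h" unfolding h_def using Q y by (subst range_from_nat_into) (auto simp: Q_def)
    then obtain j where "h j = (N, y)" by auto
    then show ?thesis using uj[of j] by (auto simp: u_def convergent_def)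
  qed
  have "convergent (\<lambda>k. measure (\<sigma> (r k)) {x \<in> B. dyadic_floor N x \<in> S})" for N S
  proof -
    have "measure (\<sigma> k) {x \<in> B. dyadic_floor N x \<in> S}
        = (\<Sum>y\<in>S \<inter> dyadic_floor N ` B. measure (\<sigma> k) {x \<in> B. dyadic_floor N x = y})" for k
    proof -
      interpret finite_measure "\<sigma> k" by (rule fin)
      have "{x \<in> B. dyadic_floor N x \<in> S} = (\<Union>y\<in>S \<inter> dyadic_floor N ` B. {x \<in> B. dyadic_floor N x = y})"
        by auto
      then show ?thesis
        using finD fib sets by (auto intro!: finite_measure_finite_Union simp: disjoint_family_on_def)
    qed
    then show ?thesis using pt by (auto intro!: convergent_sum)
  qed
  with r(1) show ?thesis by (rule that)
qed

text \<open>Limits of masses are at first only finitely additive on cylinders; the Caratheodory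
  extension applies because decreasing cylinders with empty intersection are eventually
  empty.\<close>

lemma dyadic_limit_measure:
  fixes \<sigma> :: "nat \<Rightarrow> 'a::euclidean_space measure"
  assumes fin: "\<And>k. finite_measure (\<sigma> k)" and sets: "\<And>k. sets (\<sigma> k) = sets borel"
    and B: "bounded B" "B \<in> sets borel"
    and conv: "\<And>N S. convergent (\<lambda>k. measure (\<sigma> k) {x \<in> B. dyadic_floor N x \<in> S})"
  obtains M where "finite_measure M" "space M = dyadic_seqs B"
    "\<And>N S. cylinder B N S \<in> sets M"
    "\<And>N S. (\<lambda>k. measure (\<sigma> k) {x \<in> B. dyadic_floor N x \<in> S}) \<longlonglongrightarrow> measure M (cylinder B N S)"
proof -
  have sp: "space (\<sigma> k) = UNIV" for k using sets_eq_imp_space_eq[OF sets] by simp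
  \<comment> \<open>A cylinder is read through the map from points to coherent sequences; its
    preimage is a finite union of cells, so the limit exists by \<open>conv\<close>.\<close>
  define t where "t A = lim (\<lambda>k. measure (\<sigma> k) {x \<in> B. (\<lambda>N. dyadic_floor N x) \<in> A})" for A
  have conv': "(\<lambda>k. measure (\<sigma> k) {x \<in> B. (\<lambda>N. dyadic_floor N x) \<in> A}) \<longlonglongrightarrow> t A" if "A \<in> cylinders B" for A
    using that conv by (auto simp: cylinders_def t_def cylinder_preimage[OF B(1)] convergent_LIMSEQ_iff)
  have pos: "t A \<ge> 0" if "A \<in> cylinders B" for A
    using conv'[OF that] by (rule LIMSEQ_le_const) simp
  have meas: "{x \<in> B. (\<lambda>N. dyadic_floor N x) \<in> A} \<in> sets borel" if "A \<in> cylinders B" for A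
  proof -
    from that obtain N S where A: "A = cylinder B N S" by (auto simp: cylinders_def)
    have "{x \<in> B. dyadic_floor N x \<in> S} = B \<inter> (dyadic_floor N -` (S \<inter> dyadic_floor N ` B) \<inter> space borel)" by auto
    moreover have "S \<inter> dyadic_floor N ` B \<in> sets borel"
      using finite_dyadic_floor[OF B(1)] by (intro borel_closed finite_imp_closed) auto
    ultimately show ?thesis
      unfolding A cylinder_preimage[OF B(1)] using B(2) measurable_sets[OF dyadic_floor_measurable] sets.Int by metis
  qed
  have empty: "t {} = 0" by (simp add: t_def)
  interpret R: ring_of_sets "dyadic_seqs B" "cylinders B" by (rule ring_of_sets_cylinders[OF B(1)])
  have "\<exists>\<mu>. (\<forall>s\<in>cylinders B. \<mu> s = ennreal (t s)) \<and>
      measure_space (dyadic_seqs B) (sigma_sets (dyadic_seqs B) (cylinders B)) \<mu>"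
  proof (rule R.caratheodory_empty_continuous)
    show "positive (cylinders B) (\<lambda>s. ennreal (t s))" by (simp add: positive_def empty)
    show "additive (cylinders B) (\<lambda>s. ennreal (t s))"
      unfolding additive_def
    proof (intro ballI impI)
      fix x y assume x: "x \<in> cylinders B" and y: "y \<in> cylinders B" and xy: "x \<inter> y = {}"
      have "measure (\<sigma> k) {z \<in> B. (\<lambda>N. dyadic_floor N z) \<in> x \<union> y} =
         measure (\<sigma> k) {z \<in> B. (\<lambda>N. dyadic_floor N z) \<in> x} + measure (\<sigma> k) {z \<in> B. (\<lambda>N. dyadic_floor N z) \<in> y}" for k
      proof -
        interpret finite_measure "\<sigma> k" by (rule fin)
        have "{z \<in> B. (\<lambda>N. dyadic_floor N z) \<in> x \<union> y} =
          {z \<in> B. (\<lambda>N. dyadic_floor N z) \<in> x} \<union> {z \<in> B. (\<lambda>N. dyadic_floor N z) \<in> y}" by auto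
        then show ?thesis
          using meas[OF x] meas[OF y] sets xy by (auto intro!: finite_measure_Union)
      qed
      then have "(\<lambda>k. measure (\<sigma> k) {z \<in> B. (\<lambda>N. dyadic_floor N z) \<in> x \<union> y}) \<longlonglongrightarrow> t x + t y"
        using tendsto_add[OF conv'[OF x] conv'[OF y]] by simp
      then have "t (x \<union> y) = t x + t y" using conv'[of "x \<union> y"] x y LIMSEQ_unique by blast
      then show "ennreal (t (x \<union> y)) = ennreal (t x) + ennreal (t y)" using pos[OF x] pos[OF y] by simp
    qed
    show "ennreal (t A) \<noteq> \<infinity>" for A by simp
    show "(\<lambda>i. ennreal (t (A i))) \<longlonglongrightarrow> 0"
      if A: "range A \<subseteq> cylinders B" "decseq A" "(\<Inter>i. A i) = {}" for A :: "nat \<Rightarrow> _"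
    proof -
      obtain i where i: "A i = {}" using cylinders_decseq_empty[OF B(1) A] by blast
      have Aj: "A j = {}" if "j \<ge> i" for j using decseqD[OF A(2) that] i by auto
      have "\<forall>\<^sub>F j in sequentially. ennreal (t (A j)) = 0"
        by (rule eventually_sequentiallyI[of i]) (simp add: Aj empty)
      then show ?thesis by (rule tendsto_eventually)
    qed
  qed
  then obtain \<mu> where \<mu>: "\<And>s. s \<in> cylinders B \<Longrightarrow> \<mu> s = ennreal (t s)"
    "measure_space (dyadic_seqs B) (sigma_sets (dyadic_seqs B) (cylinders B)) \<mu>" by blast
  define M where "M = measure_of (dyadic_seqs B) (cylinders B) \<mu>"
  have cl: "cylinders B \<subseteq> Pow (dyadic_seqs B)" by (rule R.space_closed)
  have spM: "space M = dyadic_seqs B" and setsM: "sets M = sigma_sets (dyadic_seqs B) (cylinders B)"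
    using cl by (simp_all add: M_def)
  have cyl: "cylinder B N S \<in> cylinders B" for N S by (auto simp: cylinders_def)
  have cylM: "cylinder B N S \<in> sets M" for N S using cyl setsM by auto
  have em: "emeasure M (cylinder B N S) = ennreal (t (cylinder B N S))" for N S
  proof -
    have "emeasure M (cylinder B N S) = \<mu> (cylinder B N S)"
    proof (rule emeasure_measure_of[OF M_def cl])
      show "positive (sets M) \<mu>" "countably_additive (sets M) \<mu>"
        using \<mu>(2) unfolding measure_space_def setsM by auto
    qed (rule cylM)
    then show ?thesis using \<mu>(1)[OF cyl] by simp
  qed
  show ?thesis
  proof
    have "space M = cylinder B 0 UNIV" by (simp add: spM cylinder_def)
    then show "finite_measure M" using em by (intro finite_measureI) simp
    show "(\<lambda>k. measure (\<sigma> k) {x \<in> B. dyadic_floor N x \<in> S}) \<longlonglongrightarrow> measure M (cylinder B N S)" for N S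
      using conv'[OF cyl[of N S]] em[of N S] pos[OF cyl[of N S]]
      by (simp add: cylinder_preimage[OF B(1)] measure_def)
  qed (fact spM cylM)+
qed

text \<open>The limit is constructed on the compact space of coherent sequences of dyadic approximations,
  where clopen sets form an algebra on which finite additivity implies countable additivity, and
  is then pushed forward to the limits of these sequences.\<close>

theorem bounded_measures_weak_compactness:
  fixes \<sigma> :: "nat \<Rightarrow> 'a::euclidean_space measure"
  assumes fin: "\<And>k. finite_measure (\<sigma> k)" and sets: "\<And>k. sets (\<sigma> k) = sets borel"
    and mass: "\<And>k. measure (\<sigma> k) UNIV \<le> C"
    and B: "bounded B" "B \<in> sets borel" "\<And>k. AE x in \<sigma> k. x \<in> B"
  obtains r \<tau> where "strict_mono (r :: nat \<Rightarrow> nat)" "finite_measure \<tau>" "sets \<tau> = sets borel"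
    "\<And>f :: 'a \<Rightarrow> real. continuous_on UNIV f \<Longrightarrow> (\<lambda>k. \<integral>x. f x \<partial>\<sigma> (r k)) \<longlonglongrightarrow> (\<integral>x. f x \<partial>\<tau>)"
proof -
  obtain R0 where R0: "\<And>x. x \<in> B \<Longrightarrow> norm x \<le> R0" using B(1) bounded_iff by metis
  \<comment> \<open>The maximum with 0 keeps the ball \<open>D\<close> nonempty even when
    \<open>B\<close> is empty.\<close>
  define R where "R = max R0 0"
  have R: "R \<ge> 0" by (simp add: R_def)
  define D where "D = cball (0 :: 'a) R"
  have D: "bounded D" "D \<in> sets borel" "D \<noteq> {}" using R by (auto simp: D_def)
  have BD: "B \<subseteq> D" using R0 by (force simp: D_def R_def)
  have aeD: "AE x in \<sigma> k. x \<in> D" for k using B(3)[of k] BD by auto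
  have sp: "space (\<sigma> k) = UNIV" for k using sets_eq_imp_space_eq[OF sets] by simp
  obtain r where r: "strict_mono r"
    "\<And>N S. convergent (\<lambda>k. measure (\<sigma> (r k)) {x \<in> D. dyadic_floor N x \<in> S})"
    by (rule convergent_dyadic_masses[of \<sigma>, OF fin sets mass D(1,3,2)]) (rule that)
  obtain M where M: "finite_measure M" "space M = dyadic_seqs D"
    "\<And>N S. cylinder D N S \<in> sets M"
    "\<And>N S. (\<lambda>k. measure (\<sigma> (r k)) {x \<in> D. dyadic_floor N x \<in> S}) \<longlonglongrightarrow> measure M (cylinder D N S)"
    by (rule dyadic_limit_measure[of "\<lambda>k. \<sigma> (r k)" D, OF fin sets D(1,2) r(2)]) (rule that)
  interpret M: finite_measure M by (rule M(1))
  have coord: "(\<lambda>\<omega>. \<omega> N) \<in> M \<rightarrow>\<^sub>M borel" for N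
  proof (rule measurableI)
    fix S :: "'a set"
    have "(\<lambda>\<omega>. \<omega> N) -` S \<inter> space M = cylinder D N S"
      by (auto simp: M(2) cylinder_def)
    then show "(\<lambda>\<omega>. \<omega> N) -` S \<inter> space M \<in> sets M" using M(3) by simp
  qed simp
  have limM[measurable]: "lim \<in> borel_measurable M"
    by (rule borel_measurable_LIMSEQ_metric[OF coord]) (use M(2) dyadic_seqs_convergent(1)[OF D(1)] in auto)
  define \<tau> where "\<tau> = distr M borel lim"
  define w where "w N = real DIM('a) / 2 ^ N" for N
  have w: "w \<longlonglongrightarrow> 0" unfolding w_def using LIMSEQ_divide_realpow_zero[of 2 "real DIM('a)"] by simp
  have w1: "w N \<le> DIM('a)" for N by (simp add: w_def divide_le_eq)
  \<comment> \<open>Rounding moves a point of \<open>D\<close> by at most \<open>DIM('a)\<close>,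
    and so does passing from a coordinate of a coherent sequence to its limit; all points at which
    \<open>f\<close> is compared lie in \<open>E\<close>.\<close>
  define E where "E = cball (0 :: 'a) (R + 2 * DIM('a))"
  have flE: "dyadic_floor N x \<in> cball 0 (R + DIM('a))" if "x \<in> D" for x N
    using dyadic_floor_dist[of x N] w1[of N] that norm_triangle_ineq4[of x "x - dyadic_floor N x"]
    by (auto simp: D_def w_def)
  have lim_near: "norm (lim \<omega> - \<omega> N) \<le> w N" if "\<omega> \<in> dyadic_seqs D" for \<omega> N
    using dyadic_seqs_convergent(2)[OF D(1) that] by (simp add: w_def)
  have seqE: "\<omega> N \<in> cball 0 (R + DIM('a))" if "\<omega> \<in> dyadic_seqs D" for \<omega> N
    using dyadic_seqsD(1)[OF D(1) that, of N] flE by auto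
  have limE: "lim \<omega> \<in> E" if "\<omega> \<in> dyadic_seqs D" for \<omega>
    using lim_near[OF that, of 0] seqE[OF that, of 0] w1[of 0] norm_triangle_ineq[of "lim \<omega> - \<omega> 0" "\<omega> 0"]
    by (simp add: E_def)
  have M_le: "measure M (space M) \<le> C"
  proof -
    have "measure (\<sigma> (r k)) {x \<in> D. dyadic_floor 0 x \<in> UNIV} \<le> C" for k
      using mass[of "r k"] finite_measure.bounded_measure[OF fin[of "r k"], of "{x \<in> D. dyadic_floor 0 x \<in> UNIV}"]
      by (simp only: sp)
    then have "measure M (cylinder D 0 UNIV) \<le> C" by (intro LIMSEQ_le_const2[OF M(4)]) auto
    moreover have "space M = cylinder D 0 UNIV" by (simp add: M(2) cylinder_def)
    ultimately show ?thesis by simp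
  qed
  have C: "C \<ge> 0" using M_le measure_nonneg order_trans by blast
  have "(\<lambda>k. \<integral>x. f x \<partial>\<sigma> (r k)) \<longlonglongrightarrow> (\<integral>x. f x \<partial>\<tau>)" if f: "continuous_on UNIV f" for f :: "'a \<Rightarrow> real"
  proof (rule LIMSEQ_I)
    fix e :: real assume e: "e > 0"
    have [measurable]: "f \<in> borel_measurable borel" using f by (rule borel_measurable_continuous_onI)
    have fk: "f \<in> borel_measurable (\<sigma> k)" for k using sets by (simp cong: measurable_cong_sets)
    have flk: "(\<lambda>x. f (dyadic_floor N x)) \<in> borel_measurable (\<sigma> k)" for k N
      using sets by (simp cong: measurable_cong_sets)
    have cont: "continuous_on E f" using f continuous_on_subset by blast
    have "compact (f ` E)" using cont by (intro compact_continuous_image) (auto simp: E_def)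
    then obtain b where b: "\<And>x. x \<in> E \<Longrightarrow> \<bar>f x\<bar> \<le> b"
      by (metis bounded_iff compact_imp_bounded image_eqI real_norm_def)
    \<comment> \<open>Replacing \<open>f\<close> by its values at grid points costs
      \<open>e' * C\<close> for the measures and again for the limit, and the finite sums differ by
      less than \<open>e'\<close>. The choice makes \<open>2 * (e' * C) + e'\<close> smaller than
      \<open>e\<close>.\<close>
    define e' where "e' = e / 3 / (C + 1)"
    have e': "e' > 0" using e C by (simp add: e'_def)
    have "uniformly_continuous_on E f" using cont by (intro compact_uniformly_continuous) (auto simp: E_def)
    then obtain d where d: "d > 0" "\<And>x y. x \<in> E \<Longrightarrow> y \<in> E \<Longrightarrow> dist y x < d \<Longrightarrow> dist (f y) (f x) < e'"
      using e' unfolding uniformly_continuous_on_def by metis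
    have "\<forall>\<^sub>F N in sequentially. w N < d" using w d(1) by (rule order_tendstoD)
    then obtain N where N: "w N < d" by (auto simp: eventually_sequentially)
    define P where "P = dyadic_floor N ` D"
    have P: "finite P" unfolding P_def by (rule finite_dyadic_floor[OF D(1)])
    have sub: "D \<subseteq> E" "cball 0 (R + DIM('a)) \<subseteq> E" by (auto simp: D_def E_def)
    \<comment> \<open>A Riemann sum over the cells of level \<open>N\<close>; by the choice of
      \<open>N\<close>, rounding moves a point by less than \<open>d\<close>.\<close>
    have est1: "\<bar>(\<integral>x. f x \<partial>\<sigma> k) - (\<Sum>y\<in>P. f y * measure (\<sigma> k) {x \<in> D. dyadic_floor N x \<in> {y}})\<bar> \<le> e' * C" for k
    proof -
      interpret finite_measure "\<sigma> k" by (rule fin)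
      have fl: "{x \<in> D. dyadic_floor N x \<in> {y}} \<in> sets (\<sigma> k)" for y
      proof -
        have "{x \<in> D. dyadic_floor N x \<in> {y}} = D \<inter> (dyadic_floor N -` {y} \<inter> space borel)" by auto
        then show ?thesis using D(2) measurable_sets[OF dyadic_floor_measurable, of "{y}" N] sets by simp
      qed
      have i1: "integrable (\<sigma> k) f"
        using aeD[of k] b sub fk by (intro integrable_const_bound[where B = b]) auto
      have i2: "integrable (\<sigma> k) (\<lambda>x. f (dyadic_floor N x))"
      proof (rule integrable_const_bound[where B = b])
        have "\<bar>f (dyadic_floor N x)\<bar> \<le> b" if "x \<in> D" for x
          using flE[OF that, of N] b sub by blast
        then show "AE x in \<sigma> k. norm (f (dyadic_floor N x)) \<le> b"
          using aeD[of k] by (auto elim: eventually_mono)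
      qed (rule flk)
      have "(\<integral>x. f (dyadic_floor N x) \<partial>\<sigma> k)
          = (\<integral>x. (\<Sum>y\<in>P. f y * indicator {x \<in> D. dyadic_floor N x \<in> {y}} x) \<partial>\<sigma> k)"
      proof (rule integral_cong_AE)
        show "AE x in \<sigma> k. f (dyadic_floor N x) = (\<Sum>y\<in>P. f y * indicator {x \<in> D. dyadic_floor N x \<in> {y}} x)"
          using aeD[of k]
        proof (eventually_elim)
          case (elim x)
          have "(\<Sum>y\<in>P. f y * indicator {x \<in> D. dyadic_floor N x \<in> {y}} x)
              = (\<Sum>y\<in>P. if dyadic_floor N x = y then f y else 0)"
            using elim by (intro sum.cong) (auto simp: indicator_def)
          also have "\<dots> = f (dyadic_floor N x)" using P elim by (simp add: P_def)
          finally show ?case by simp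
        qed
        show "(\<lambda>x. \<Sum>y\<in>P. f y * indicator {x \<in> D. dyadic_floor N x \<in> {y}} x) \<in> borel_measurable (\<sigma> k)"
          using fl by (intro borel_measurable_sum borel_measurable_times borel_measurable_indicator) auto
      qed (rule flk)
      also have "\<dots> = (\<Sum>y\<in>P. \<integral>x. f y * indicator {x \<in> D. dyadic_floor N x \<in> {y}} x \<partial>\<sigma> k)"
        using fl by (intro Bochner_Integration.integral_sum integrable_mult_right integrable_real_indicator)
          (auto simp: top.not_eq_extremum[symmetric])
      also have "\<dots> = (\<Sum>y\<in>P. f y * measure (\<sigma> k) {x \<in> D. dyadic_floor N x \<in> {y}})"
        by (simp add: sp)
      finally have eq: "(\<integral>x. f (dyadic_floor N x) \<partial>\<sigma> k) = (\<Sum>y\<in>P. f y * measure (\<sigma> k) {x \<in> D. dyadic_floor N x \<in> {y}})" .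
      have "\<bar>(\<integral>x. f x \<partial>\<sigma> k) - (\<integral>x. f (dyadic_floor N x) \<partial>\<sigma> k)\<bar> = \<bar>\<integral>x. f x - f (dyadic_floor N x) \<partial>\<sigma> k\<bar>"
        using i1 i2 by simp
      also have "\<dots> \<le> (\<integral>x. \<bar>f x - f (dyadic_floor N x)\<bar> \<partial>\<sigma> k)"
        using integral_norm_bound[of "\<sigma> k" "\<lambda>x. f x - f (dyadic_floor N x)"] by simp
      also have "\<dots> \<le> (\<integral>x. e' \<partial>\<sigma> k)"
      proof (rule integral_mono_AE)
        show "AE x in \<sigma> k. \<bar>f x - f (dyadic_floor N x)\<bar> \<le> e'"
          using aeD[of k]
        proof eventually_elim
          case (elim x)
          have "dist x (dyadic_floor N x) < d"
            using dyadic_floor_dist[of x N] N by (simp add: dist_norm w_def)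
          then show ?case
            using d(2)[of "dyadic_floor N x" x] elim flE[OF elim, of N] sub by (force simp: dist_real_def)
        qed
      qed (use i1 i2 in auto)
      also have "\<dots> = e' * measure (\<sigma> k) UNIV" by (simp add: sp)
      also have "\<dots> \<le> e' * C" using mass e' by (intro mult_left_mono) auto
      finally show ?thesis unfolding eq .
    qed
    \<comment> \<open>The same comparison in the limit space: the coordinate
      \<open>\<omega> N\<close> takes the place of the rounded point and \<open>lim \<omega>\<close>
      that of the point itself.\<close>
    have est2: "\<bar>(\<integral>x. f x \<partial>\<tau>) - (\<Sum>y\<in>P. f y * measure M (cylinder D N {y}))\<bar> \<le> e' * C"
    proof -
      have "(\<integral>x. f x \<partial>\<tau>) = (\<integral>\<omega>. f (lim \<omega>) \<partial>M)" unfolding \<tau>_def by (rule integral_distr) measurable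
      moreover have "(\<integral>\<omega>. f (\<omega> N) \<partial>M) = (\<Sum>y\<in>P. f y * measure M (cylinder D N {y}))"
      proof -
        have "(\<integral>\<omega>. f (\<omega> N) \<partial>M) = (\<integral>\<omega>. (\<Sum>y\<in>P. f y * indicator (cylinder D N {y}) \<omega>) \<partial>M)"
        proof (rule Bochner_Integration.integral_cong[OF refl])
          fix \<omega> assume \<omega>: "\<omega> \<in> space M"
          have "(\<Sum>y\<in>P. f y * indicator (cylinder D N {y}) \<omega>) = (\<Sum>y\<in>P. if \<omega> N = y then f y else 0)"
            using \<omega> by (intro sum.cong) (auto simp: cylinder_def M(2) indicator_def)
          also have "\<dots> = f (\<omega> N)"
            using dyadic_seqsD(1)[OF D(1), of \<omega> N] \<omega> P by (simp add: M(2) P_def)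
          finally show "f (\<omega> N) = (\<Sum>y\<in>P. f y * indicator (cylinder D N {y}) \<omega>)" by simp
        qed
        also have "\<dots> = (\<Sum>y\<in>P. \<integral>\<omega>. f y * indicator (cylinder D N {y}) \<omega> \<partial>M)"
          using M(3) by (intro Bochner_Integration.integral_sum integrable_mult_right integrable_real_indicator)
            (auto simp: top.not_eq_extremum[symmetric])
        also have "\<dots> = (\<Sum>y\<in>P. f y * measure M (cylinder D N {y}))"
          using M(3)[of N] sets.sets_into_space[OF M(3)[of N]] by (intro sum.cong) (auto simp: Int_absorb2)
        finally show ?thesis .
      qed
      moreover have "\<bar>(\<integral>\<omega>. f (lim \<omega>) \<partial>M) - (\<integral>\<omega>. f (\<omega> N) \<partial>M)\<bar> \<le> e' * C"
      proof -
        have i1: "integrable M (\<lambda>\<omega>. f (lim \<omega>))"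
          using limE b M(2) by (intro M.integrable_const_bound[where B = b]) auto
        have i2: "integrable M (\<lambda>\<omega>. f (\<omega> N))"
        proof (rule M.integrable_const_bound[where B = b])
          have "\<bar>f (\<omega> N)\<bar> \<le> b" if "\<omega> \<in> space M" for \<omega>
            using seqE[of \<omega> N] that b sub M(2) by blast
          then show "AE \<omega> in M. norm (f (\<omega> N)) \<le> b" by (simp add: AE_I2)
          show "(\<lambda>\<omega>. f (\<omega> N)) \<in> borel_measurable M"
            by (rule measurable_compose[OF coord]) measurable
        qed
        have "\<bar>(\<integral>\<omega>. f (lim \<omega>) \<partial>M) - (\<integral>\<omega>. f (\<omega> N) \<partial>M)\<bar> = \<bar>\<integral>\<omega>. f (lim \<omega>) - f (\<omega> N) \<partial>M\<bar>"
          using i1 i2 by simp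
        also have "\<dots> \<le> (\<integral>\<omega>. \<bar>f (lim \<omega>) - f (\<omega> N)\<bar> \<partial>M)"
          using integral_norm_bound[of M "\<lambda>\<omega>. f (lim \<omega>) - f (\<omega> N)"] by simp
        also have "\<dots> \<le> (\<integral>\<omega>. e' \<partial>M)"
        proof (rule integral_mono)
          fix \<omega> assume "\<omega> \<in> space M"
          then have \<omega>: "\<omega> \<in> dyadic_seqs D" by (simp add: M(2))
          have "dist (lim \<omega>) (\<omega> N) < d" using lim_near[OF \<omega>, of N] N by (simp add: dist_norm)
          then show "\<bar>f (lim \<omega>) - f (\<omega> N)\<bar> \<le> e'"
            using d(2)[of "\<omega> N" "lim \<omega>"] limE[OF \<omega>] seqE[OF \<omega>, of N] sub by (force simp: dist_real_def)
        qed (use i1 i2 in auto)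
        also have "\<dots> = e' * measure M (space M)" by simp
        also have "\<dots> \<le> e' * C" using M_le e' by (intro mult_left_mono) auto
        finally show ?thesis .
      qed
      ultimately show ?thesis by simp
    qed
    have "(\<lambda>k. \<Sum>y\<in>P. f y * measure (\<sigma> (r k)) {x \<in> D. dyadic_floor N x \<in> {y}})
        \<longlonglongrightarrow> (\<Sum>y\<in>P. f y * measure M (cylinder D N {y}))"
      by (intro tendsto_sum tendsto_mult_left M(4))
    from LIMSEQ_D[OF this e'] obtain k0 where k0: "\<And>k. k \<ge> k0 \<Longrightarrow>
        \<bar>(\<Sum>y\<in>P. f y * measure (\<sigma> (r k)) {x \<in> D. dyadic_floor N x \<in> {y}}) - (\<Sum>y\<in>P. f y * measure M (cylinder D N {y}))\<bar> < e'"
      unfolding real_norm_def by blast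
    have "2 * (e' * C) + e' < e"
    proof -
      have "C + 1 \<noteq> 0" using C by simp
      then have "e' * (C + 1) = e / 3" by (metis e'_def nonzero_eq_divide_eq)
      then have "e = 3 * (e' * C) + 3 * e'" by (simp add: distrib_left)
      moreover have "e' * C \<ge> 0" using e' C by simp
      ultimately show ?thesis using e' by linarith
    qed
    show "\<exists>k0. \<forall>k\<ge>k0. norm ((\<integral>x. f x \<partial>\<sigma> (r k)) - (\<integral>x. f x \<partial>\<tau>)) < e"
    proof (intro exI[of _ k0] allI impI)
      fix k assume "k \<ge> k0"
      from k0[OF this] est1[of "r k"] est2 \<open>2 * (e' * C) + e' < e\<close>
      show "norm ((\<integral>x. f x \<partial>\<sigma> (r k)) - (\<integral>x. f x \<partial>\<tau>)) < e"
        unfolding real_norm_def by linarith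
    qed
  qed
  then show ?thesis
    by (intro that[OF r(1), of \<tau>]) (auto simp: \<tau>_def intro!: M.finite_measure_distr)
qed

section \<open>The pairing and its product rule\<close>

text \<open>The set where a continuous function exceeds its essential bound is open and negligible,
  hence empty. So the bound holds at every point, also on Lebesgue null sets that \<open>F\<close>
  may charge.\<close>

lemma W1_inf_bounded:
  fixes \<Omega> :: "'a::euclidean_space set"
  assumes \<Omega>: "open \<Omega>" and \<phi>: "\<phi> \<in> W1_inf \<Omega>"
  obtains C where "C \<ge> 0" "\<And>x. x \<in> \<Omega> \<Longrightarrow> \<bar>\<phi> x\<bar> \<le> C"
proof -
  obtain C where C: "AE x in lebesgue_on \<Omega>. norm (\<phi> x) \<le> C"
    using \<phi> unfolding W1_inf_def L_inf_def by blast
  have cont: "continuous_on \<Omega> \<phi>" using \<phi> unfolding W1_inf_def by blast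
  have \<Omega>s: "\<Omega> \<in> sets lebesgue" using \<Omega> by (simp add: borel_open)
  define S where "S = \<Omega> \<inter> \<phi> -` {y. C < \<bar>y\<bar>}"
  have "open S" unfolding S_def
    by (rule continuous_open_preimage[OF cont \<Omega>]) (intro open_Collect_less continuous_intros)
  moreover have "negligible S"
  proof -
    have "AE x in lebesgue. x \<in> \<Omega> \<longrightarrow> norm (\<phi> x) \<le> C"
      using C \<Omega>s by (simp add: AE_restrict_space_iff)
    then have "AE x in lebesgue. x \<notin> S" by (rule AE_mp) (auto simp: S_def intro!: AE_I2)
    moreover have "S \<in> sets lebesgue" using \<open>open S\<close> by (simp add: borel_open)
    ultimately show ?thesis by (simp add: negligible_iff_null_sets AE_iff_null_sets)
  qed
  ultimately have "S = {}" using open_not_negligible by blast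
  then have "\<bar>\<phi> x\<bar> \<le> max 0 C" if "x \<in> \<Omega>" for x using that by (force simp: S_def max.coboundedI2)
  then show ?thesis by (intro that[of "max 0 C"]) (auto simp: max.cobounded1)
qed

lemma W1_inf_continuous: "\<phi> \<in> W1_inf \<Omega> \<Longrightarrow> continuous_on \<Omega> \<phi>"
  unfolding W1_inf_def by blast

lemma integrable_componentwiseI:
  fixes f :: "'b \<Rightarrow> 'a::euclidean_space"
  assumes "\<And>b. b \<in> Basis \<Longrightarrow> integrable m (\<lambda>x. f x \<bullet> b)"
  shows "integrable m f"
proof -
  have "integrable m (\<lambda>x. \<Sum>b\<in>Basis. (f x \<bullet> b) *\<^sub>R b)"
    using assms by (intro Bochner_Integration.integrable_sum integrable_scaleR_left) auto
  then show ?thesis by (simp add: euclidean_representation)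
qed

lemma at_right_0_sequentiallyI:
  fixes f :: "real \<Rightarrow> real"
  assumes "\<And>X. (\<And>i::nat. X i > 0) \<Longrightarrow> X \<longlonglongrightarrow> 0 \<Longrightarrow> (\<lambda>i. f (X i)) \<longlonglongrightarrow> l"
  shows "(f \<longlongrightarrow> l) (at_right 0)"
  unfolding tendsto_at_iff_sequentially using assms by (auto simp: o_def)

lemma eventually_cball_subset:
  fixes K \<Omega> :: "'a::euclidean_space set"
  assumes "compact K" "open \<Omega>" "K \<subseteq> \<Omega>"
  shows "\<forall>\<^sub>F \<delta> in at_right 0. \<forall>x\<in>K. cball x \<delta> \<subseteq> \<Omega>"
proof -
  obtain d where d: "d > 0" "\<And>x y. x \<in> K \<Longrightarrow> y \<in> -\<Omega> \<Longrightarrow> d \<le> dist x y"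
    using separate_compact_closed[OF assms(1), of "-\<Omega>"] assms(2,3) by (metis closed_Compl Diff_eq Diff_eq_empty_iff)
  have "cball x \<delta> \<subseteq> \<Omega>" if "\<delta> < d" "x \<in> K" for x \<delta>
    using d(2)[OF that(2)] that(1) by (force simp: mem_cball)
  then show ?thesis using d(1) by (intro eventually_at_rightI[of 0 d]) auto
qed

section \<open>Mollification of a Sobolev function\<close>

context
  fixes \<Omega> :: "'a::euclidean_space set" and \<rho> \<phi> :: "'a \<Rightarrow> real"
  assumes \<Omega>: "open \<Omega>" and \<rho>: "standard_mollifier \<rho>" and \<phi>: "\<phi> \<in> W1_inf \<Omega>"
begin

lemma extension_measurable [measurable]: "(\<lambda>y. indicator \<Omega> y * \<phi> y) \<in> borel_measurable borel"
  using borel_measurable_continuous_on_indicator[OF borel_open[OF \<Omega>] W1_inf_continuous[OF \<phi>]] by simp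

text \<open>Passes from integrals over \<open>lebesgue_on \<Omega>\<close> to Borel integrals over
  the whole space, to which the convolution estimates apply.\<close>

lemma mollify_eq_convol: "mollify \<rho> \<Omega> \<delta> \<phi> = convol (\<lambda>y. indicator \<Omega> y * \<phi> y) (mollifier_kernel \<rho> \<delta>)"
proof
  fix x
  have [measurable]: "\<rho> \<in> borel_measurable borel"
    using \<rho> unfolding standard_mollifier_def
    using Cc_inf_Cc Cc_continuous borel_measurable_continuous_onI by blast
  have "mollify \<rho> \<Omega> \<delta> \<phi> x = (\<integral>y. indicator \<Omega> y *\<^sub>R (\<phi> y * mollifier_kernel \<rho> \<delta> (x - y)) \<partial>lebesgue)"
    unfolding mollify_def mollifier_kernel_def using \<Omega> by (intro integral_restrict_space) (simp add: borel_open)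
  also have "\<dots> = (\<integral>y. (indicator \<Omega> y * \<phi> y) * mollifier_kernel \<rho> \<delta> (x - y) \<partial>lebesgue)"
    by (simp add: mult.assoc)
  also have "\<dots> = (\<integral>y. (indicator \<Omega> y * \<phi> y) * mollifier_kernel \<rho> \<delta> (x - y) \<partial>lborel)"
    unfolding mollifier_kernel_def by (intro integral_completion) measurable
  finally show "mollify \<rho> \<Omega> \<delta> \<phi> x = convol (\<lambda>y. indicator \<Omega> y * \<phi> y) (mollifier_kernel \<rho> \<delta>) x"
    by (simp add: convol_def)
qed

lemma extension_bounded:
  obtains C where "C \<ge> 0" "\<And>y. \<bar>indicator \<Omega> y * \<phi> y\<bar> \<le> C" "\<And>x. x \<in> \<Omega> \<Longrightarrow> \<bar>\<phi> x\<bar> \<le> C"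
proof -
  obtain C where C: "C \<ge> 0" "\<And>x. x \<in> \<Omega> \<Longrightarrow> \<bar>\<phi> x\<bar> \<le> C" using W1_inf_bounded[OF \<Omega> \<phi>] by metis
  then show ?thesis by (intro that[of C]) (auto simp: indicator_def)
qed

lemma Ck_mollify:
  assumes \<delta>: "\<delta> > 0" shows "Ck k (mollify \<rho> \<Omega> \<delta> \<phi>)"
proof -
  obtain C where "C \<ge> 0" and C: "\<And>y. \<bar>indicator \<Omega> y * \<phi> y\<bar> \<le> C"
    and "\<And>x. x \<in> \<Omega> \<Longrightarrow> \<bar>\<phi> x\<bar> \<le> C" by (rule extension_bounded) (rule that)
  show ?thesis
    unfolding mollify_eq_convol by (rule Ck_convol[OF extension_measurable C mollifier_kernel_Cc_inf[OF \<rho> \<delta>]])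
qed

lemma mollify_bounded:
  assumes "\<delta> > 0" "\<And>y. \<bar>indicator \<Omega> y * \<phi> y\<bar> \<le> C" shows "\<bar>mollify \<rho> \<Omega> \<delta> \<phi> x\<bar> \<le> C"
  using convol_mollifier_bound[OF \<rho> assms(1) extension_measurable assms(2), of x 0 C] assms(2)
  unfolding mollify_eq_convol by simp

lemma mollify_tendsto:
  assumes x: "x \<in> \<Omega>" and X: "\<And>i::nat. X i > 0" "X \<longlonglongrightarrow> 0"
  shows "(\<lambda>i. mollify \<rho> \<Omega> (X i) \<phi> x) \<longlonglongrightarrow> \<phi> x"
proof (rule LIMSEQ_I)
  fix e :: real assume e: "e > 0"
  obtain C where "C \<ge> 0" and C: "\<And>y. \<bar>indicator \<Omega> y * \<phi> y\<bar> \<le> C"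
    and "\<And>x. x \<in> \<Omega> \<Longrightarrow> \<bar>\<phi> x\<bar> \<le> C" by (rule extension_bounded) (rule that)
  have "isCont \<phi> x" using W1_inf_continuous[OF \<phi>] \<Omega> x continuous_on_eq_continuous_at by blast
  then obtain d where d: "d > 0" "\<And>y. dist y x < d \<Longrightarrow> \<bar>\<phi> y - \<phi> x\<bar> < e / 2"
    using e unfolding continuous_at_eps_delta by (metis dist_real_def half_gt_zero)
  \<comment> \<open>Within \<open>d'\<close> of \<open>x\<close> the extension by zero coincides
    with \<phi>.\<close>
  obtain d' where d': "d' > 0" "ball x d' \<subseteq> \<Omega>" using \<Omega> x open_contains_ball by blast
  have "\<forall>\<^sub>F i in sequentially. X i < min d d'" using X d(1) d'(1) by (intro order_tendstoD) auto
  then obtain n where n: "\<And>i. i \<ge> n \<Longrightarrow> X i < min d d'" by (auto simp: eventually_sequentially)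
  have "norm (mollify \<rho> \<Omega> (X i) \<phi> x - \<phi> x) < e" if "i \<ge> n" for i
  proof -
    have "\<bar>mollify \<rho> \<Omega> (X i) \<phi> x - \<phi> x\<bar> \<le> e / 2"
      unfolding mollify_eq_convol
    proof (rule convol_mollifier_bound[OF \<rho> X(1) extension_measurable C])
      fix y assume "norm (x - y) \<le> X i"
      then have "dist y x < d" "y \<in> ball x d'"
        using n[OF that] by (auto simp: dist_norm norm_minus_commute)
      then show "\<bar>indicator \<Omega> y * \<phi> y - \<phi> x\<bar> \<le> e / 2"
        using d(2)[of y] d'(2) by (auto simp: indicator_def less_imp_le)
    qed
    then show ?thesis using e by simp
  qed
  then show "\<exists>n. \<forall>i\<ge>n. norm (mollify \<rho> \<Omega> (X i) \<phi> x - \<phi> x) < e" by blast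
qed

text \<open>Inside \<open>\<Omega>\<close> the gradient of a mollification is the mollification of the weak gradient.\<close>

lemma grad_mollify_bound:
  obtains G where "G \<ge> 0"
    "\<And>\<delta> x. \<delta> > 0 \<Longrightarrow> cball x \<delta> \<subseteq> \<Omega> \<Longrightarrow> norm (grad (mollify \<rho> \<Omega> \<delta> \<phi>) x) \<le> G"
proof -
  obtain g where g: "g \<in> L_inf \<Omega>" and weak: "\<And>\<psi>. \<psi> \<in> Cc_inf \<Omega> \<Longrightarrow>
     (\<integral>x. \<phi> x *\<^sub>R grad \<psi> x \<partial>lebesgue_on \<Omega>) = - (\<integral>x. \<psi> x *\<^sub>R g x \<partial>lebesgue_on \<Omega>)"
    using \<phi> unfolding W1_inf_def by blast
  obtain G0 where G0: "AE x in lebesgue_on \<Omega>. norm (g x) \<le> G0" using g unfolding L_inf_def by blast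
  define G where "G = max 0 G0"
  have G: "AE x in lebesgue_on \<Omega>. norm (g x) \<le> G" 
    by (rule eventually_mono[OF G0]) (simp add: G_def)
  have [measurable]: "g \<in> borel_measurable (lebesgue_on \<Omega>)" using g unfolding L_inf_def by blast
  have \<Omega>s: "\<Omega> \<inter> space lebesgue \<in> sets lebesgue" using \<Omega> by (simp add: borel_open)
  obtain C where "C \<ge> 0" and C: "\<And>y. \<bar>indicator \<Omega> y * \<phi> y\<bar> \<le> C"
    and "\<And>x. x \<in> \<Omega> \<Longrightarrow> \<bar>\<phi> x\<bar> \<le> C" by (rule extension_bounded) (rule that)
  have "norm (grad (mollify \<rho> \<Omega> \<delta> \<phi>) x) \<le> G" if \<delta>: "\<delta> > 0" and x: "cball x \<delta> \<subseteq> \<Omega>" for \<delta> x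
  proof -
    let ?k = "mollifier_kernel \<rho> \<delta>"
    note k = mollifier_kernel_Cc_inf[OF \<rho> \<delta>]
    \<comment> \<open>As a function of \<open>y\<close> the kernel is supported in
      \<open>cball x \<delta>\<close> and so may be used in the weak gradient identity. The
      reflection contributes a sign that cancels the one from integration by parts.\<close>
    define \<psi> where "\<psi> y = ?k (x - y)" for y
    have \<psi>_affine: "\<psi> = (\<lambda>y. ?k ((-1) *\<^sub>R y + x))" by (simp add: \<psi>_def fun_eq_iff)
    have Ck: "Ck j \<psi>" for j unfolding \<psi>_affine by (intro Ck_affine Cc_inf_Ck[OF k])
    have \<psi>0: "\<psi> y = 0" if "y \<notin> cball x \<delta>" for y
      using mollifier_kernel_eq_0[OF \<rho> \<delta>, of "x - y"] that by (simp add: \<psi>_def dist_norm)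
    have \<psi>: "\<psi> \<in> Cc_inf \<Omega>"
    proof -
      have "continuous_on UNIV \<psi>" using Ck[of 0] by simp
      then have "\<psi> \<in> Cc \<Omega>" using \<psi>0 x by (intro CcI[of _ "cball x \<delta>"]) auto
      then show ?thesis using Ck by (simp add: Cc_inf_def)
    qed
    have grad\<psi>: "grad \<psi> y = - grad ?k (x - y)" for y
    proof -
      have "GDERIV ?k ((-1) *\<^sub>R y + x) :> grad ?k (x - y)" using Cc_inf_GDERIV[OF k, of "x - y"] by simp
      from GDERIV_grad[OF GDERIV_affine[OF this]] show ?thesis by (simp add: \<psi>_affine)
    qed
    have "grad (mollify \<rho> \<Omega> \<delta> \<phi>) x = convol (\<lambda>y. indicator \<Omega> y * \<phi> y) (grad ?k) x"
      unfolding mollify_eq_convol by (rule GDERIV_grad[OF GDERIV_convol[OF extension_measurable C k]])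
    also have "\<dots> = (\<integral>y. (indicator \<Omega> y * \<phi> y) *\<^sub>R grad ?k (x - y) \<partial>lebesgue)"
    proof -
      have [measurable]: "grad ?k \<in> borel_measurable borel"
        using continuous_grad[OF k] by (rule borel_measurable_continuous_onI)
      show ?thesis unfolding convol_def by (intro integral_completion[symmetric]) measurable
    qed
    also have "\<dots> = (\<integral>y. \<phi> y *\<^sub>R grad ?k (x - y) \<partial>lebesgue_on \<Omega>)"
      by (subst integral_restrict_space[OF \<Omega>s]) simp
    also have "\<dots> = - (\<integral>y. \<phi> y *\<^sub>R grad \<psi> y \<partial>lebesgue_on \<Omega>)"
      by (simp add: grad\<psi>)
    also have "\<dots> = (\<integral>y. \<psi> y *\<^sub>R g y \<partial>lebesgue_on \<Omega>)" using weak[OF \<psi>] by simp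
    finally have eq: "grad (mollify \<rho> \<Omega> \<delta> \<phi>) x = (\<integral>y. \<psi> y *\<^sub>R g y \<partial>lebesgue_on \<Omega>)" .
    have nn: "\<psi> y \<ge> 0" for y unfolding \<psi>_def by (rule mollifier_kernel_nonneg[OF \<rho> \<delta>])
    have \<psi>m: "\<psi> \<in> borel_measurable borel" using Ck[of 0] by (simp add: borel_measurable_continuous_onI)
    have \<psi>int: "integrable lborel \<psi>" "(\<integral>y. \<psi> y \<partial>lborel) = 1"
      using mollifier_kernel_integrable[OF \<rho> \<delta>] integral_mollifier_kernel[OF \<rho> \<delta>] by (simp_all add: \<psi>_def[abs_def])
    have ind: "indicator \<Omega> y *\<^sub>R \<psi> y = \<psi> y" for y
    proof (cases "y \<in> \<Omega>")
      case False
      then have "y \<notin> cball x \<delta>" using x by blast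
      then show ?thesis using \<psi>0 by simp
    qed simp
    have \<psi>on: "integrable (lebesgue_on \<Omega>) \<psi>" "(\<integral>y. \<psi> y \<partial>lebesgue_on \<Omega>) = 1"
      using \<psi>int \<psi>m integrable_completion[of \<psi> lborel] integral_completion[of \<psi> lborel]
      by (simp_all add: integrable_restrict_space[OF \<Omega>s] integral_restrict_space[OF \<Omega>s] ind del: real_scaleR_def)
    have bd: "AE y in lebesgue_on \<Omega>. norm (\<psi> y *\<^sub>R g y) \<le> G * \<psi> y"
      using G by eventually_elim (use nn in \<open>simp add: mult.commute[of G] mult_left_mono\<close>)
    have \<psi>g: "integrable (lebesgue_on \<Omega>) (\<lambda>y. \<psi> y *\<^sub>R g y)"
    proof (rule Bochner_Integration.integrable_bound[OF integrable_mult_right[OF \<psi>on(1), of G]])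
      show "(\<lambda>y. \<psi> y *\<^sub>R g y) \<in> borel_measurable (lebesgue_on \<Omega>)"
        using \<psi>on(1) by (intro borel_measurable_scaleR) (auto simp: borel_measurable_integrable)
      show "AE y in lebesgue_on \<Omega>. norm (\<psi> y *\<^sub>R g y) \<le> norm (G * \<psi> y)"
        using bd by eventually_elim simp
    qed
    have "norm (\<integral>y. \<psi> y *\<^sub>R g y \<partial>lebesgue_on \<Omega>) \<le> (\<integral>y. norm (\<psi> y *\<^sub>R g y) \<partial>lebesgue_on \<Omega>)"
      by (rule integral_norm_bound)
    also have "\<dots> \<le> (\<integral>y. G * \<psi> y \<partial>lebesgue_on \<Omega>)"
      by (rule integral_mono_AE[OF integrable_norm[OF \<psi>g] integrable_mult_right[OF \<psi>on(1)] bd])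
    also have "\<dots> = G" using \<psi>on(2) by simp
    finally show ?thesis unfolding eq .
  qed
  moreover have "G \<ge> 0" by (simp add: G_def)
  ultimately show ?thesis by (rule that[rotated])
qed

end

lemma is_divergence_divergence:
  fixes \<Omega> :: "'a::euclidean_space set"
  assumes \<Omega>: "open \<Omega>" and \<rho>: "standard_mollifier (\<rho> :: 'a \<Rightarrow> real)" and F: "F \<in> DM_ext \<Omega>"
  shows "is_divergence \<Omega> F (divergence \<Omega> F)"
proof -
  obtain \<mu> where \<mu>: "is_divergence \<Omega> F \<mu>" using F unfolding DM_ext_def by blast
  have "divergence \<Omega> F = \<mu>"
    unfolding divergence_def
  proof (rule the_equality, rule \<mu>)
    fix \<nu> assume "is_divergence \<Omega> F \<nu>"
    with \<mu> show "\<nu> = \<mu>"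
      unfolding is_divergence_def by (intro radon_measure_on_eqI[OF \<rho> \<Omega>]) auto
  qed
  with \<mu> show ?thesis by simp
qed

lemma DM_ext_radon: "F \<in> DM_ext \<Omega> \<Longrightarrow> radon_measure_on \<Omega> F"
  unfolding DM_ext_def by blast

lemma divergence_radon:
  assumes "open (\<Omega> :: 'a::euclidean_space set)" "standard_mollifier (\<rho> :: 'a \<Rightarrow> real)" "F \<in> DM_ext \<Omega>"
  shows "radon_measure_on \<Omega> (divergence \<Omega> F)"
  using is_divergence_divergence[OF assms] unfolding is_divergence_def by blast

lemma signed_integral_divergence:
  assumes "open (\<Omega> :: 'a::euclidean_space set)" "standard_mollifier (\<rho> :: 'a \<Rightarrow> real)" "F \<in> DM_ext \<Omega>" "\<psi> \<in> Cc_inf \<Omega>"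
  shows "signed_integral \<Omega> (divergence \<Omega> F) \<psi> = - vector_integral \<Omega> F (grad \<psi>)"
  using is_divergence_divergence[OF assms(1,2,3)] assms(4) unfolding is_divergence_def by blast

lemma continuous_borel_subsets_measurable:
  fixes f :: "'a::topological_space \<Rightarrow> 'b::topological_space"
  assumes "sets m = borel_subsets \<Omega>" "continuous_on UNIV f" shows "f \<in> borel_measurable m"
  using measurable_restrict_space1[OF borel_measurable_continuous_onI[OF assms(2)]]
  by (simp add: measurable_cong_sets[OF assms(1) refl])

lemma W1_inf_measurable:
  assumes "\<phi> \<in> W1_inf \<Omega>" "sets m = borel_subsets \<Omega>" shows "\<phi> \<in> borel_measurable m"
  using borel_measurable_continuous_on_restrict[OF W1_inf_continuous[OF assms(1)]]
  by (simp add: measurable_cong_sets[OF assms(2) refl])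

section \<open>Construction of the pairing\<close>

context
  fixes \<Omega> :: "'a::euclidean_space set" and \<rho> \<phi> :: "'a \<Rightarrow> real" and F :: "'a set \<Rightarrow> 'a"
  assumes \<Omega>: "open \<Omega>" and \<rho>: "standard_mollifier \<rho>" and \<phi>: "\<phi> \<in> W1_inf \<Omega>" and F: "F \<in> DM_ext \<Omega>"
begin

abbreviation mollified_pairing :: "('a \<Rightarrow> real) \<Rightarrow> real \<Rightarrow> real" where
  "mollified_pairing \<psi> \<delta> \<equiv> vector_integral \<Omega> F (\<lambda>x. \<psi> x *\<^sub>R grad (mollify \<rho> \<Omega> \<delta> \<phi>) x)"

lemmas F_radon = DM_ext_radon[OF F]
  and div_radon = divergence_radon[OF \<Omega> \<rho> F]
  and div_eq = signed_integral_divergence[OF \<Omega> \<rho> F]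
  and \<phi>_measurable = W1_inf_measurable[OF \<phi>]

text \<open>The rule \<open>div (\<phi> F) = \<phi> div F + pairing\<close>, tested with \<psi> and
  solved for the pairing term. It contains no derivative of \<phi>.\<close>

definition product_functional :: "('a \<Rightarrow> real) \<Rightarrow> real" where
  "product_functional \<psi> = - signed_integral \<Omega> (divergence \<Omega> F) (\<lambda>x. \<psi> x * \<phi> x)
     - vector_integral \<Omega> F (\<lambda>x. \<phi> x *\<^sub>R grad \<psi> x)"

text \<open>The divergence equation is tested with \<psi> times the mollified \<phi>. By the product
  rule its other terms contain no derivative of \<phi>; they converge because mollifications are
  uniformly bounded and converge at every point of \<Omega>.\<close>

lemma mollified_pairing_tendsto:
  assumes \<psi>: "\<psi> \<in> Cc_inf \<Omega>"
  shows "((\<lambda>\<delta>. mollified_pairing \<psi> \<delta>)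
     \<longlongrightarrow> product_functional \<psi>) (at_right 0)"
proof (rule at_right_0_sequentiallyI)
  fix X :: "nat \<Rightarrow> real" assume X: "\<And>i. X i > 0" "X \<longlonglongrightarrow> 0"
  obtain C where "C \<ge> 0" and C: "\<And>y. \<bar>indicator \<Omega> y * \<phi> y\<bar> \<le> C"
    and C\<phi>: "\<And>x. x \<in> \<Omega> \<Longrightarrow> \<bar>\<phi> x\<bar> \<le> C" by (rule extension_bounded[OF \<Omega> \<rho> \<phi>]) (rule that)
  define h where "h i = mollify \<rho> \<Omega> (X i) \<phi>" for i
  have hC: "\<bar>h i x\<bar> \<le> C" for i x unfolding h_def by (rule mollify_bounded[OF \<Omega> \<rho> \<phi> X(1) C])
  have hCk: "Ck k (h i)" for i k unfolding h_def by (rule Ck_mollify[OF \<Omega> \<rho> \<phi> X(1)])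
  have hc: "continuous_on UNIV (h i)" for i using hCk[of 0] by simp
  have hlim: "(\<lambda>i. h i x) \<longlonglongrightarrow> \<phi> x" if "x \<in> \<Omega>" for x
    unfolding h_def by (rule mollify_tendsto[OF \<Omega> \<rho> \<phi> that X])
  have hG: "GDERIV (h i) x :> grad (h i) x" for i x using Ck_Suc_GDERIV[OF hCk[of "Suc 0"]] .
  have gradh: "continuous_on UNIV (grad (h i))" for i
    using hCk[of "Suc 0" i] by (subst continuous_on_componentwise) auto
  obtain m where m: "dominates m \<Omega> F" using exists_dominates[OF F_radon] .
  obtain m' where m': "dominates m' \<Omega> (divergence \<Omega> F)" using exists_dominates[OF div_radon] .
  note mD = dominatesD[OF m] and mD' = dominatesD[OF m']
  obtain C1 where C1: "C1 \<ge> 0" "\<And>x. \<bar>\<psi> x\<bar> \<le> C1" by (rule Cc_bounded[OF Cc_inf_Cc[OF \<psi>]]) (rule that)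
  obtain C2 where C2: "C2 \<ge> 0" "\<And>x. norm (grad \<psi> x) \<le> C2" by (rule Cc_inf_grad_bounded[OF \<psi>]) (rule that)
  have grad\<psi>: "continuous_on UNIV (grad \<psi>)" by (rule continuous_grad[OF \<psi>])
  have \<psi>c: "continuous_on UNIV \<psi>" using Cc_continuous[OF Cc_inf_Cc[OF \<psi>]] .
  have i1: "integrable m (\<lambda>x. h i x *\<^sub>R grad \<psi> x)" for i
    by (rule finite_measure_integrable_bounded[OF mD(1), of _ "C * C2"])
      (use hC C2 \<open>C \<ge> 0\<close> hc grad\<psi> mD(2) in \<open>auto intro!: mult_mono continuous_borel_subsets_measurable[of _ \<Omega>] continuous_intros\<close>)
  have i2: "integrable m (\<lambda>x. \<phi> x *\<^sub>R grad \<psi> x)"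
  proof (rule finite_measure_integrable_bounded[OF mD(1)])
    show "(\<lambda>x. \<phi> x *\<^sub>R grad \<psi> x) \<in> borel_measurable m"
      by (intro borel_measurable_scaleR \<phi>_measurable continuous_borel_subsets_measurable[OF mD(2)] mD(2) grad\<psi>)
    show "norm (\<phi> x *\<^sub>R grad \<psi> x) \<le> C * C2" if "x \<in> space m" for x
      using that mD(3) C\<phi> C2 \<open>C \<ge> 0\<close> by (auto intro!: mult_mono)
  qed
  have i3: "integrable m (\<lambda>x. \<psi> x *\<^sub>R grad (h i) x)" for i
  proof -
    have "(\<lambda>x. \<psi> x * (grad (h i) x \<bullet> b)) \<in> Cc \<Omega>" if "b \<in> Basis" for b
      by (rule Cc_mult[OF Cc_inf_Cc[OF \<psi>] continuous_on_inner[OF gradh continuous_on_const]])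
    from Cc_integrable[OF this mD(2,1)] have "integrable m (\<lambda>x. (\<psi> x *\<^sub>R grad (h i) x) \<bullet> b)" if "b \<in> Basis" for b
      using that by (simp only: inner_scaleR_left)
    then show ?thesis by (rule integrable_componentwiseI)
  qed
  have step: "vector_integral \<Omega> F (\<lambda>x. \<psi> x *\<^sub>R grad (h i) x)
      = - signed_integral \<Omega> (divergence \<Omega> F) (\<lambda>x. \<psi> x * h i x) - vector_integral \<Omega> F (\<lambda>x. h i x *\<^sub>R grad \<psi> x)" for i
  proof -
    have "(\<lambda>x. \<psi> x * h i x) \<in> Cc_inf \<Omega>" using \<psi> hCk by (rule Cc_inf_mult)
    moreover have "grad (\<lambda>x. \<psi> x * h i x) = (\<lambda>x. \<psi> x *\<^sub>R grad (h i) x + h i x *\<^sub>R grad \<psi> x)"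
      by (rule ext) (rule grad_mult[OF Cc_inf_GDERIV[OF \<psi>] hG])
    ultimately have "signed_integral \<Omega> (divergence \<Omega> F) (\<lambda>x. \<psi> x * h i x)
        = - vector_integral \<Omega> F (\<lambda>x. \<psi> x *\<^sub>R grad (h i) x + h i x *\<^sub>R grad \<psi> x)"
      using div_eq by metis
    then show ?thesis using vector_integral_add[OF F_radon m i3 i1] by simp
  qed
  have "(\<lambda>i. signed_integral \<Omega> (divergence \<Omega> F) (\<lambda>x. \<psi> x * h i x))
      \<longlonglongrightarrow> signed_integral \<Omega> (divergence \<Omega> F) (\<lambda>x. \<psi> x * \<phi> x)"
  proof (rule signed_integral_tendsto[OF div_radon m'])
    have fin: "integrable m' (\<lambda>x. C1 * C)" using finite_measure.integrable_const[OF mD'(1)] .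
    have meas: "(\<lambda>x. \<psi> x * \<phi> x) \<in> borel_measurable m'" "(\<lambda>x. \<psi> x * h i x) \<in> borel_measurable m'" for i
      by (intro borel_measurable_times \<phi>_measurable continuous_borel_subsets_measurable[OF mD'(2)] mD'(2) \<psi>c hc)+
    have lim: "(\<lambda>i. \<psi> x * h i x) \<longlonglongrightarrow> \<psi> x * \<phi> x" if "x \<in> space m'" for x
      using that hlim mD'(3) by (intro tendsto_mult_left) simp
    have bd: "\<bar>\<psi> x * h i x\<bar> \<le> C1 * C" for i x
      using C1 hC unfolding abs_mult by (intro mult_mono) auto
    show "(\<lambda>i. \<integral>x. \<bar>\<psi> x * h i x - \<psi> x * \<phi> x\<bar> \<partial>m') \<longlonglongrightarrow> 0" "integrable m' (\<lambda>x. \<psi> x * \<phi> x)"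
      "integrable m' (\<lambda>x. \<psi> x * h i x)" for i
      using L1_dominated_convergence[OF fin meas lim bd] by auto
  qed
  moreover have "(\<lambda>i. vector_integral \<Omega> F (\<lambda>x. h i x *\<^sub>R grad \<psi> x)) \<longlonglongrightarrow> vector_integral \<Omega> F (\<lambda>x. \<phi> x *\<^sub>R grad \<psi> x)"
  proof (rule vector_integral_tendsto[OF F_radon m i1 i2])
    have fin: "integrable m (\<lambda>x. C * C2)" using finite_measure.integrable_const[OF mD(1)] .
    \<comment> \<open>The norm of the vector difference is the absolute value of a difference of
      scalars weighted by \<open>norm (grad \<psi> x)\<close>, so the scalar convergence theorem
      applies.\<close>
    have meas: "(\<lambda>x. \<phi> x * norm (grad \<psi> x)) \<in> borel_measurable m" "(\<lambda>x. h i x * norm (grad \<psi> x)) \<in> borel_measurable m" for i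
      by (intro borel_measurable_times \<phi>_measurable continuous_borel_subsets_measurable[OF mD(2)] mD(2) continuous_on_norm grad\<psi> hc)+
    have lim: "(\<lambda>i. h i x * norm (grad \<psi> x)) \<longlonglongrightarrow> \<phi> x * norm (grad \<psi> x)" if "x \<in> space m" for x
      using that hlim mD(3) by (intro tendsto_mult_right) simp
    have bd: "\<bar>h i x * norm (grad \<psi> x)\<bar> \<le> C * C2" for i x
      using C2 hC \<open>C \<ge> 0\<close> unfolding abs_mult by (intro mult_mono) auto
    have "norm (h i x *\<^sub>R grad \<psi> x - \<phi> x *\<^sub>R grad \<psi> x) = \<bar>h i x * norm (grad \<psi> x) - \<phi> x * norm (grad \<psi> x)\<bar>" for i x
      by (simp flip: scaleR_diff_left left_diff_distrib add: abs_mult)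
    then show "(\<lambda>i. \<integral>x. norm (h i x *\<^sub>R grad \<psi> x - \<phi> x *\<^sub>R grad \<psi> x) \<partial>m) \<longlonglongrightarrow> 0"
      using L1_dominated_convergence(1)[OF fin meas lim bd] by simp
  qed
  ultimately have "(\<lambda>i. vector_integral \<Omega> F (\<lambda>x. \<psi> x *\<^sub>R grad (h i) x)) \<longlonglongrightarrow> product_functional \<psi>"
    unfolding step product_functional_def by (intro tendsto_diff tendsto_minus)
  then show "(\<lambda>i. vector_integral \<Omega> F (\<lambda>x. \<psi> x *\<^sub>R grad (mollify \<rho> \<Omega> (X i) \<phi>) x)) \<longlonglongrightarrow> product_functional \<psi>"
    by (simp add: h_def)
qed

lemma mollified_pairing_integrable:
  assumes m: "finite_measure m" "sets m = borel_subsets \<Omega>" and \<psi>: "\<psi> \<in> Cc \<Omega>" and \<delta>: "\<delta> > 0"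
  shows "integrable m (\<lambda>x. \<psi> x *\<^sub>R grad (mollify \<rho> \<Omega> \<delta> \<phi>) x)"
proof -
  have Ck: "Ck (Suc 0) (mollify \<rho> \<Omega> \<delta> \<phi>)" by (rule Ck_mollify[OF \<Omega> \<rho> \<phi> \<delta>])
  have "integrable m (\<lambda>x. (\<psi> x *\<^sub>R grad (mollify \<rho> \<Omega> \<delta> \<phi>) x) \<bullet> b)" if "b \<in> Basis" for b
    unfolding inner_scaleR_left using Ck that by (intro Cc_integrable[OF Cc_mult[OF \<psi>] m(2,1)]) auto
  then show ?thesis by (rule integrable_componentwiseI)
qed

text \<open>The bound on the mollified gradient holds only where a ball of radius \<delta> fits into
  \<Omega>, so the threshold for \<delta> depends on the support of \<psi>. The constant
  \<open>B\<close> does not, which makes the limit functional bounded in L^1.\<close>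

lemma mollified_pairing_bound:
  assumes m: "dominates m \<Omega> F"
  obtains B where "B \<ge> 0" "\<And>\<psi>. \<psi> \<in> Cc \<Omega> \<Longrightarrow>
    \<forall>\<^sub>F \<delta> in at_right 0. \<bar>mollified_pairing \<psi> \<delta>\<bar> \<le> B * (\<integral>x. \<bar>\<psi> x\<bar> \<partial>m)"
proof -
  note mD = dominatesD[OF m]
  obtain G where G: "G \<ge> 0"
    "\<And>\<delta> x. \<delta> > 0 \<Longrightarrow> cball x \<delta> \<subseteq> \<Omega> \<Longrightarrow> norm (grad (mollify \<rho> \<Omega> \<delta> \<phi>) x) \<le> G"
    by (rule grad_mollify_bound[OF \<Omega> \<rho> \<phi>]) (rule that)
  have "\<forall>\<^sub>F \<delta> in at_right 0. \<bar>mollified_pairing \<psi> \<delta>\<bar>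
      \<le> (2 * DIM('a) * G) * (\<integral>x. \<bar>\<psi> x\<bar> \<partial>m)" if \<psi>: "\<psi> \<in> Cc \<Omega>" for \<psi>
  proof -
    obtain K where K: "compact K" "K \<subseteq> \<Omega>" "\<And>x. x \<notin> K \<Longrightarrow> \<psi> x = 0" using CcE[OF \<psi>] by metis
    have "\<forall>\<^sub>F \<delta> in at_right 0. (\<forall>x\<in>K. cball x \<delta> \<subseteq> \<Omega>) \<and> (\<delta>::real) > 0"
      using eventually_cball_subset[OF K(1) \<Omega> K(2)] eventually_at_right_less[of "0::real"] by (rule eventually_conj)
    then show ?thesis
    proof (rule eventually_mono, elim conjE)
      fix \<delta> :: real assume \<delta>: "\<forall>x\<in>K. cball x \<delta> \<subseteq> \<Omega>" "\<delta> > 0"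
      have i: "integrable m (\<lambda>x. \<psi> x *\<^sub>R grad (mollify \<rho> \<Omega> \<delta> \<phi>) x)"
        by (rule mollified_pairing_integrable[OF mD(1,2) \<psi> \<delta>(2)])
      have "\<bar>mollified_pairing \<psi> \<delta>\<bar>
          \<le> (2 * DIM('a)) * (\<integral>x. norm (\<psi> x *\<^sub>R grad (mollify \<rho> \<Omega> \<delta> \<phi>) x) \<partial>m)"
        by (rule vector_integral_bound[OF F_radon m i])
      also have "\<dots> \<le> (2 * DIM('a)) * (\<integral>x. G * \<bar>\<psi> x\<bar> \<partial>m)"
      proof (intro mult_left_mono integral_mono)
        show "norm (\<psi> x *\<^sub>R grad (mollify \<rho> \<Omega> \<delta> \<phi>) x) \<le> G * \<bar>\<psi> x\<bar>" for x
        proof (cases "x \<in> K")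
          case True
          then have "norm (grad (mollify \<rho> \<Omega> \<delta> \<phi>) x) \<le> G" using G(2)[OF \<delta>(2)] \<delta>(1) by blast
          then show ?thesis by (simp add: mult.commute[of G] mult_left_mono)
        qed (simp add: K(3))
        show "integrable m (\<lambda>x. norm (\<psi> x *\<^sub>R grad (mollify \<rho> \<Omega> \<delta> \<phi>) x))" using i by (rule integrable_norm)
      qed (use Cc_integrable[OF \<psi> mD(2,1)] in auto)
      finally show "\<bar>mollified_pairing \<psi> \<delta>\<bar>
          \<le> (2 * DIM('a) * G) * (\<integral>x. \<bar>\<psi> x\<bar> \<partial>m)" by (simp add: mult.assoc)
    qed
  qed
  then show ?thesis using G(1) by (intro that[of "2 * DIM('a) * G"]) auto
qed

text \<open>Linearity is read off the mollified pairings at fixed \<delta> and passed to the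
  limit.\<close>

lemma product_functional_add:
  assumes f: "f \<in> Cc_inf \<Omega>" and g: "g \<in> Cc_inf \<Omega>"
  shows "product_functional (\<lambda>x. f x + g x) = product_functional f + product_functional g"
proof -
  obtain m where m: "dominates m \<Omega> F" using exists_dominates[OF F_radon] .
  note int = mollified_pairing_integrable[OF dominatesD(1,2)[OF m]]
  have "\<forall>\<^sub>F \<delta> in at_right 0. mollified_pairing f \<delta> + mollified_pairing g \<delta> = mollified_pairing (\<lambda>x. f x + g x) \<delta>"
    using eventually_at_right_less[of "0::real"]
  proof eventually_elim
    case (elim \<delta>)
    show ?case using vector_integral_add[OF F_radon m int[OF Cc_inf_Cc[OF f] elim] int[OF Cc_inf_Cc[OF g] elim]]
      by (simp add: scaleR_add_left)
  qed
  with tendsto_add[OF mollified_pairing_tendsto[OF f] mollified_pairing_tendsto[OF g]]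
  have "(mollified_pairing (\<lambda>x. f x + g x) \<longlongrightarrow> product_functional f + product_functional g) (at_right 0)"
    by (rule Lim_transform_eventually)
  then show ?thesis
    using tendsto_unique[OF _ mollified_pairing_tendsto[OF Cc_inf_add[OF f g]]] by simp
qed

lemma product_functional_scale:
  assumes f: "f \<in> Cc_inf \<Omega>"
  shows "product_functional (\<lambda>x. c * f x) = c * product_functional f"
  using tendsto_mult_left[OF mollified_pairing_tendsto[OF f], of c]
    tendsto_unique[OF _ mollified_pairing_tendsto[OF Cc_inf_cmult[OF f, of c]]]
  by (simp add: vector_integral_scaleR flip: scaleR_scaleR)

text \<open>Smooth \<psi> are handled by the representation lemma. A merely continuous \<psi> is
  approximated by smooth functions in L^1 of \<open>m\<close>; the uniform bound controls the
  mollified pairings, and domination controls the limit measure.\<close>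

lemma exists_pairing:
  obtains \<mu> where "radon_measure_on \<Omega> \<mu>"
    "\<And>\<psi>. \<psi> \<in> Cc \<Omega> \<Longrightarrow> ((\<lambda>\<delta>. mollified_pairing \<psi> \<delta>)
        \<longlongrightarrow> signed_integral \<Omega> \<mu> \<psi>) (at_right 0)"
proof -
  obtain m where m: "dominates m \<Omega> F" using exists_dominates[OF F_radon] .
  note mD = dominatesD[OF m]
  obtain B where B: "B \<ge> 0"
    "\<And>\<psi>. \<psi> \<in> Cc \<Omega> \<Longrightarrow> \<forall>\<^sub>F \<delta> in at_right 0. \<bar>mollified_pairing \<psi> \<delta>\<bar> \<le> B * (\<integral>x. \<bar>\<psi> x\<bar> \<partial>m)"
    by (rule mollified_pairing_bound[OF m]) (rule that)
  \<comment> \<open>\<open>B\<close> is absorbed into the measure, as the representation lemma asks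
    for a bound with constant 1.\<close>
  define M where "M = density m (\<lambda>_. ennreal B)"
  have Ms: "sets M = borel_subsets \<Omega>" by (simp add: M_def mD)
  have Mf: "finite_measure M"
    using finite_measure.emeasure_finite[OF mD(1), of "space m"] unfolding M_def
    by (intro finite_measureI) (simp add: emeasure_density nn_integral_cmult ennreal_mult_eq_top_iff)
  have Mint: "(\<integral>x. \<bar>f x\<bar> \<partial>M) = B * (\<integral>x. \<bar>f x\<bar> \<partial>m)" if "f \<in> Cc \<Omega>" for f
    unfolding M_def using Cc_measurable[OF that mD(2)] B(1) by (subst integral_density) auto
  have bd: "\<bar>product_functional f\<bar> \<le> (\<integral>x. \<bar>f x\<bar> \<partial>M)" if f: "f \<in> Cc_inf \<Omega>" for f
    unfolding Mint[OF Cc_inf_Cc[OF f]]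
    by (rule tendsto_upperbound[OF tendsto_rabs[OF mollified_pairing_tendsto[OF f]] B(2)[OF Cc_inf_Cc[OF f]]]) simp
  obtain \<mu> where \<mu>: "radon_measure_on \<Omega> \<mu>" "dominates M \<Omega> \<mu>"
    "\<And>f. f \<in> Cc_inf \<Omega> \<Longrightarrow> signed_integral \<Omega> \<mu> f = product_functional f"
    by (rule L1_bounded_functional_representation[OF \<rho> \<Omega> Mf Ms product_functional_add product_functional_scale bd]) (assumption | rule that)+
  show ?thesis
  proof (rule that[OF \<mu>(1)])
    fix \<psi> assume \<psi>: "\<psi> \<in> Cc \<Omega>"
    show "(mollified_pairing \<psi> \<longlongrightarrow> signed_integral \<Omega> \<mu> \<psi>) (at_right 0)"
    proof (rule tendstoI)
      fix e :: real assume e: "e > 0"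
      \<comment> \<open>The errors are \<open>2 * (B * e')\<close> from the limit measure,
        \<open>B * e'\<close> from the mollified pairing and less than \<open>e'\<close> from the
        convergence at the smooth function; a further \<open>e'\<close> is slack.\<close>
      define e' where "e' = e / (3 * B + 2)"
      have e': "e' > 0" using e B(1) by (simp add: e'_def)
      have e'e: "3 * (B * e') + 2 * e' = e"
      proof -
        have "3 * B + 2 \<noteq> 0" using B(1) by simp
        then have "e' * (3 * B + 2) = e" by (metis e'_def nonzero_eq_divide_eq)
        then show ?thesis by (simp add: algebra_simps)
      qed
      obtain f where f: "f \<in> Cc_inf \<Omega>" "(\<integral>x. \<bar>\<psi> x - f x\<bar> \<partial>m) < e'"
        using Cc_inf_L1_dense[OF \<rho> \<Omega> mD(1,2) Cc_integrable[OF \<psi> mD(2,1)] e'] .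
      have d: "(\<lambda>x. \<psi> x - f x) \<in> Cc \<Omega>"
        using Cc_add[OF \<psi> Cc_inf_Cc[OF Cc_inf_cmult[OF f(1), of "-1"]]] by simp
      have Bd: "B * (\<integral>x. \<bar>\<psi> x - f x\<bar> \<partial>m) \<le> B * e'" using f(2) B(1) by (intro mult_left_mono) auto
      have 1: "\<bar>signed_integral \<Omega> \<mu> \<psi> - signed_integral \<Omega> \<mu> f\<bar> \<le> 2 * (B * e')"
      proof -
        note i = Cc_integrable[OF _ Ms Mf]
        have "\<bar>signed_integral \<Omega> \<mu> (\<lambda>x. \<psi> x - f x)\<bar> \<le> 2 * (\<integral>x. \<bar>\<psi> x - f x\<bar> \<partial>M)"
          by (rule signed_integral_bound[OF \<mu>(1,2) i[OF d]])
        then show ?thesis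
          using Mint[OF d] Bd signed_integral_diff[OF \<mu>(1,2) i[OF \<psi>] i[OF Cc_inf_Cc[OF f(1)]]] by simp
      qed
      have 2: "\<forall>\<^sub>F \<delta> in at_right 0. dist (mollified_pairing f \<delta>) (signed_integral \<Omega> \<mu> f) < e'"
        unfolding \<mu>(3)[OF f(1)] using e' by (intro tendstoD mollified_pairing_tendsto f(1))
      show "\<forall>\<^sub>F \<delta> in at_right 0. dist (mollified_pairing \<psi> \<delta>) (signed_integral \<Omega> \<mu> \<psi>) < e"
        using 2 B(2)[OF d] eventually_at_right_less[of "0::real"]
      proof eventually_elim
        case (elim \<delta>)
        note i = mollified_pairing_integrable[OF mD(1,2) _ elim(3)]
        have "mollified_pairing (\<lambda>x. \<psi> x - f x) \<delta> = mollified_pairing \<psi> \<delta> - mollified_pairing f \<delta>"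
          using vector_integral_diff[OF F_radon m i[OF \<psi>] i[OF Cc_inf_Cc[OF f(1)]]] by (simp add: scaleR_diff_left)
        then have "\<bar>mollified_pairing \<psi> \<delta> - mollified_pairing f \<delta>\<bar> \<le> B * e'" using elim(2) Bd by simp
        then show ?case using 1 elim(1) e'e e' unfolding dist_real_def by linarith
      qed
    qed
  qed
qed

text \<open>For smooth \<psi> the same mollified pairings converge both to the integral of the
  pairing and to \<open>product_functional \<psi>\<close>; uniqueness of limits gives the product
  rule.\<close>

lemma pairing_properties:
  shows pairing_radon: "radon_measure_on \<Omega> (pairing \<rho> \<Omega> \<phi> F)"
    and pairing_product_rule: "\<psi> \<in> Cc_inf \<Omega> \<Longrightarrow> signed_integral \<Omega> (pairing \<rho> \<Omega> \<phi> F) \<psi> =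
      - signed_integral \<Omega> (divergence \<Omega> F) (\<lambda>x. \<psi> x * \<phi> x) - vector_integral \<Omega> F (\<lambda>x. \<phi> x *\<^sub>R grad \<psi> x)"
proof -
  obtain \<mu> where \<mu>: "radon_measure_on \<Omega> \<mu>"
    "\<And>\<psi>. \<psi> \<in> Cc \<Omega> \<Longrightarrow> ((\<lambda>\<delta>. mollified_pairing \<psi> \<delta>)
        \<longlongrightarrow> signed_integral \<Omega> \<mu> \<psi>) (at_right 0)" by (rule exists_pairing) (rule that)
  have eq: "pairing \<rho> \<Omega> \<phi> F = \<mu>"
    unfolding pairing_def
  proof (rule the_equality)
    fix \<nu> assume \<nu>: "radon_measure_on \<Omega> \<nu> \<and> (\<forall>\<psi>\<in>Cc \<Omega>. ((\<lambda>\<delta>. mollified_pairing \<psi> \<delta>)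
        \<longlongrightarrow> signed_integral \<Omega> \<nu> \<psi>) (at_right 0))"
    show "\<nu> = \<mu>"
    proof (rule radon_measure_on_eqI[OF \<rho> \<Omega>])
      fix \<psi> assume "\<psi> \<in> Cc_inf \<Omega>"
      then have "\<psi> \<in> Cc \<Omega>" by (rule Cc_inf_Cc)
      then show "signed_integral \<Omega> \<nu> \<psi> = signed_integral \<Omega> \<mu> \<psi>"
        using \<nu> \<mu>(2) tendsto_unique[OF trivial_limit_at_right_real] by blast
    qed (use \<nu> \<mu> in auto)
  qed (use \<mu> in auto)
  show "radon_measure_on \<Omega> (pairing \<rho> \<Omega> \<phi> F)" using \<mu>(1) eq by simp
  show "signed_integral \<Omega> (pairing \<rho> \<Omega> \<phi> F) \<psi> =
      - signed_integral \<Omega> (divergence \<Omega> F) (\<lambda>x. \<psi> x * \<phi> x) - vector_integral \<Omega> F (\<lambda>x. \<phi> x *\<^sub>R grad \<psi> x)"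
    if \<psi>: "\<psi> \<in> Cc_inf \<Omega>"
    using tendsto_unique[OF trivial_limit_at_right_real \<mu>(2)[OF Cc_inf_Cc[OF \<psi>]] mollified_pairing_tendsto[OF \<psi>]]
    by (simp add: eq product_functional_def)
qed

end

section \<open>Shells around the boundary\<close>

text \<open>The value 0 outside \<open>U\<close> makes the function 1-Lipschitz on the whole space
  and turns \<open>inner_set U \<epsilon>\<close> into a superlevel set.\<close>

definition depth :: "'a::euclidean_space set \<Rightarrow> 'a \<Rightarrow> real" where
  "depth U x = (if x \<in> U then infdist x (frontier U) else 0)"

text \<open>Inside \<open>U\<close> this is the Lipschitz property of \<open>infdist\<close>. For
  one point inside and one outside, the segment joining them meets the frontier, so the inner point
  is at least as close to the frontier as to the outer point.\<close>

lemma depth_lipschitz: "\<bar>depth U x - depth U y\<bar> \<le> dist x y"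
proof -
  have *: "infdist x (frontier U) \<le> dist x y" if xy: "x \<in> U" "y \<notin> U" for x y
  proof -
    have "closed_segment x y \<inter> frontier U \<noteq> {}"
      using xy by (intro connected_Int_frontier) auto
    then obtain z where z: "z \<in> closed_segment x y" "z \<in> frontier U" by blast
    have "infdist x (frontier U) \<le> dist x z" by (rule infdist_le[OF z(2)])
    also have "\<dots> \<le> dist x y" using dist_in_closed_segment[OF z(1)] by (simp add: dist_commute)
    finally show ?thesis .
  qed
  show ?thesis
    using infdist_triangle_abs[of x "frontier U" y] *[of x y] *[of y x] infdist_nonneg[of _ "frontier U"]
    by (auto simp: depth_def dist_commute)
qed

lemma continuous_on_depth: "continuous_on UNIV (depth U)"
proof (rule continuous_onI)
  fix x e assume "e > (0::real)"
  then show "\<exists>d>0. \<forall>x'\<in>UNIV. dist x' x < d \<longrightarrow> dist (depth U x') (depth U x) \<le> e"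
    using depth_lipschitz[of U] unfolding dist_real_def
    by (intro exI[of _ e]) (auto intro: order_trans[OF _ less_imp_le])
qed

lemma depth_measurable [measurable]: "depth U \<in> borel_measurable borel"
  by (rule borel_measurable_continuous_onI[OF continuous_on_depth])

lemma inner_set_eq: "\<epsilon> \<ge> 0 \<Longrightarrow> inner_set U \<epsilon> = {x. \<epsilon> < depth U x}"
  by (auto simp: inner_set_def depth_def)

lemma open_inner_set: "\<epsilon> \<ge> 0 \<Longrightarrow> open (inner_set U \<epsilon>)"
  unfolding inner_set_eq by (intro open_Collect_less continuous_on_depth continuous_on_const)

lemma inner_set_subset: "inner_set U \<epsilon> \<subseteq> U"
  by (auto simp: inner_set_def)

section \<open>Smooth cutoffs across a shell\<close>

lemma GDERIV_norm_le_lipschitz: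
  assumes D: "GDERIV f x :> D" and L: "\<And>y. \<bar>f y - f x\<bar> \<le> L * norm (y - x)" "L \<ge> 0"
  shows "norm D \<le> L"
proof (rule field_le_epsilon)
  fix e :: real assume e: "e > 0"
  obtain d where d: "d > 0" "\<And>y. norm (y - x) < d \<Longrightarrow> norm (f y - f x - (y - x) \<bullet> D) \<le> e * norm (y - x)"
    using D e unfolding gderiv_def has_derivative_at_alt by blast
  show "norm D \<le> L + e"
  proof (cases "D = 0")
    case False
    \<comment> \<open>A step of length \<open>d / 2\<close> in the direction of \<open>D\<close>
      itself, which exposes the full norm of the gradient.\<close>
    define t where "t = d / (2 * norm D)"
    have t: "t > 0" using d False by (simp add: t_def)
    define y where "y = x + t *\<^sub>R D"
    have ny: "norm (y - x) = t * norm D" using t by (simp add: y_def)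
    have "norm (y - x) < d" using d False by (simp add: ny t_def)
    from d(2)[OF this] L(1)[of y]
    have "\<bar>(y - x) \<bullet> D\<bar> \<le> (L + e) * norm (y - x)" by (simp add: distrib_right)
    moreover have "(y - x) \<bullet> D = t * (norm D)\<^sup>2" by (simp add: y_def power2_norm_eq_inner)
    ultimately have "(t * norm D) * norm D \<le> (t * norm D) * (L + e)"
      using t by (simp add: ny power2_eq_square mult_ac)
    then show ?thesis using t False by (simp add: mult_le_cancel_left_pos)
  qed (use L e in simp)
qed

lemma convol_mollifier_lipschitz:
  assumes \<rho>: "standard_mollifier \<rho>" and \<delta>: "\<delta> > 0"
    and f: "f \<in> borel_measurable borel" "\<And>y. \<bar>f y\<bar> \<le> C"
    and L: "\<And>x y. \<bar>f x - f y\<bar> \<le> L * norm (x - y)"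
  shows "\<bar>convol f (mollifier_kernel \<rho> \<delta>) x - convol f (mollifier_kernel \<rho> \<delta>) y\<bar> \<le> L * norm (x - y)"
proof -
  let ?k = "mollifier_kernel \<rho> \<delta>"
  have [measurable]: "?k \<in> borel_measurable borel" by (rule mollifier_kernel_measurable[OF \<rho> \<delta>])
  have [measurable]: "f \<in> borel_measurable borel" by (rule f)
  \<comment> \<open>After the substitution the shift sits on \<open>f\<close>, where the Lipschitz
    bound applies.\<close>
  have eq: "convol f ?k x = (\<integral>w. f (x - w) * ?k w \<partial>lborel)" for x
    using lborel_integral_affine[of "\<lambda>y. f y * ?k (x - y)" "-1" x] by (simp add: convol_def)
  have k1: "(\<integral>w. ?k w \<partial>lborel) = 1"
    using lborel_integral_affine[of ?k "-1" 0] integral_mollifier_kernel[OF \<rho> \<delta>, of 0] by simp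
  \<comment> \<open>The integral of a function that is not integrable is 0 by convention, so the
    value 1 yields integrability.\<close>
  then have kint: "integrable lborel ?k" using not_integrable_integral_eq[of lborel ?k] by force
  have kn: "?k w \<ge> 0" for w by (rule mollifier_kernel_nonneg[OF \<rho> \<delta>])
  have i: "integrable lborel (\<lambda>w. f (x - w) * ?k w)" for x
  proof (rule Bochner_Integration.integrable_bound[OF integrable_mult_right[OF kint, of C]])
    show "AE w in lborel. norm (f (x - w) * ?k w) \<le> norm (C * ?k w)"
      using f(2) kn by (intro AE_I2) (auto simp: abs_mult intro!: mult_right_mono intro: order_trans[OF _ abs_ge_self])
  qed measurable
  have "\<bar>convol f ?k x - convol f ?k y\<bar> = \<bar>\<integral>w. f (x - w) * ?k w - f (y - w) * ?k w \<partial>lborel\<bar>"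
    unfolding eq using i by simp
  also have "\<dots> \<le> (\<integral>w. \<bar>f (x - w) * ?k w - f (y - w) * ?k w\<bar> \<partial>lborel)"
    using integral_norm_bound[of lborel "\<lambda>w. f (x - w) * ?k w - f (y - w) * ?k w"] by simp
  also have "\<dots> \<le> (\<integral>w. (L * norm (x - y)) * ?k w \<partial>lborel)"
  proof (rule integral_mono)
    show "\<bar>f (x - w) * ?k w - f (y - w) * ?k w\<bar> \<le> (L * norm (x - y)) * ?k w" for w
      using mult_right_mono[OF L[of "x - w" "y - w"] kn[of w]] kn[of w]
      by (simp flip: left_diff_distrib add: abs_mult)
  qed (use i kint in auto)
  also have "\<dots> = L * norm (x - y)" by (simp add: k1)
  finally show ?thesis .
qed

lemma clamp_lipschitz: "\<bar>max 0 (min 1 a) - max 0 (min 1 b)\<bar> \<le> \<bar>a - b\<bar>" for a b :: real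
  by linarith

text \<open>A piecewise linear ramp in the depth is mollified. Mollification preserves the Lipschitz
  constant \<open>2 / h\<close>, which bounds the gradient, and margins on both sides keep the
  gradient inside the shell.\<close>

lemma depth_cutoff:
  fixes U :: "'a::euclidean_space set"
  assumes \<rho>: "standard_mollifier (\<rho> :: 'a \<Rightarrow> real)" and \<epsilon>: "\<epsilon> > 0" and h: "h > 0"
    and U: "compact (closure U)" "closure U \<subseteq> \<Omega>"
  obtains \<eta> where "\<eta> \<in> Cc_inf \<Omega>" "\<And>x. 0 \<le> \<eta> x" "\<And>x. \<eta> x \<le> 1" "\<And>x. norm (grad \<eta> x) \<le> 2 / h"
    "\<And>x. grad \<eta> x \<noteq> 0 \<Longrightarrow> \<epsilon> < depth U x \<and> depth U x \<le> \<epsilon> + h"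
    "\<And>x. depth U x \<le> \<epsilon> \<Longrightarrow> \<eta> x = 0" "\<And>x. \<epsilon> + h \<le> depth U x \<Longrightarrow> \<eta> x = 1"
proof -
  \<comment> \<open>The ramp defined next occupies depths from \<open>\<epsilon> + h/4\<close> to
    \<open>\<epsilon> + 3*h/4\<close>. Mollifying at scale \<open>h/8\<close> widens this at most to
    the range from \<open>\<epsilon> + h/8\<close> to \<open>\<epsilon> + 7*h/8\<close>, still
    strictly inside the shell.\<close>
  define \<delta> where "\<delta> = h / 8"
  have \<delta>: "\<delta> > 0" using h by (simp add: \<delta>_def)
  define c where "c x = max 0 (min 1 ((depth U x - \<epsilon> - h / 4) * (2 / h)))" for x
  have c: "c \<in> borel_measurable borel" "\<And>y. \<bar>c y\<bar> \<le> 1"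
    unfolding c_def[abs_def] by measurable
  have cL: "\<bar>c x - c y\<bar> \<le> 2 / h * norm (x - y)" for x y
  proof -
    have "\<bar>c x - c y\<bar> \<le> \<bar>(depth U x - \<epsilon> - h / 4) * (2 / h) - (depth U y - \<epsilon> - h / 4) * (2 / h)\<bar>"
      unfolding c_def by (rule clamp_lipschitz)
    also have "\<dots> = \<bar>depth U x - depth U y\<bar> * (2 / h)"
    proof -
      have "(a - \<epsilon> - h / 4) * s - (b - \<epsilon> - h / 4) * s = (a - b) * s" for a b s by (simp add: algebra_simps)
      then show ?thesis using h by (simp only: abs_mult) simp
    qed
    also have "\<dots> \<le> norm (x - y) * (2 / h)"
      using depth_lipschitz[of U x y] h by (intro mult_right_mono) (auto simp: dist_norm)
    finally show ?thesis by (simp add: mult.commute)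
  qed
  define \<eta> where "\<eta> = convol c (mollifier_kernel \<rho> \<delta>)"
  have Ck: "Ck k \<eta>" for k unfolding \<eta>_def by (rule Ck_convol[OF c mollifier_kernel_Cc_inf[OF \<rho> \<delta>]])
  have GD: "GDERIV \<eta> x :> grad \<eta> x" for x using Ck_Suc_GDERIV[OF Ck[of "Suc 0"]] .
  have near: "\<bar>depth U x - depth U y\<bar> \<le> h / 8" if "norm (x - y) \<le> \<delta>" for x y
    using depth_lipschitz[of U x y] that by (simp add: dist_norm \<delta>_def)
  have zero: "\<eta> x = 0" if x: "depth U x < \<epsilon> + h / 8" for x
  proof -
    have "\<bar>\<eta> x - 0\<bar> \<le> 0"
      unfolding \<eta>_def
    proof (rule convol_mollifier_bound[OF \<rho> \<delta> c])
      fix y assume "norm (x - y) \<le> \<delta>"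
      then have "depth U y - \<epsilon> - h / 4 \<le> 0" using near[of x y] x by linarith
      then have "(depth U y - \<epsilon> - h / 4) * (2 / h) \<le> 0" using h by (intro mult_nonpos_nonneg) auto
      then show "\<bar>c y - 0\<bar> \<le> 0" by (simp add: c_def)
    qed
    then show ?thesis by simp
  qed
  have one: "\<eta> x = 1" if x: "\<epsilon> + 7 * h / 8 < depth U x" for x
  proof -
    have "\<bar>\<eta> x - 1\<bar> \<le> 0"
      unfolding \<eta>_def
    proof (rule convol_mollifier_bound[OF \<rho> \<delta> c])
      fix y assume "norm (x - y) \<le> \<delta>"
      then have "h / 2 \<le> depth U y - \<epsilon> - h / 4" using near[of x y] x by linarith
      then have "h / 2 * (2 / h) \<le> (depth U y - \<epsilon> - h / 4) * (2 / h)" using h by (intro mult_right_mono) auto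
      then show "\<bar>c y - 1\<bar> \<le> 0" using h by (simp add: c_def)
    qed
    then show ?thesis by simp
  qed
  have "\<eta> \<in> Cc \<Omega>"
  proof (rule CcI[OF _ U])
    show "continuous_on UNIV \<eta>" using Ck[of 0] by simp
    fix x assume "x \<notin> closure U"
    then have "x \<notin> U" using closure_subset by blast
    then show "\<eta> x = 0" using \<epsilon> h by (intro zero) (simp add: depth_def)
  qed
  then have 1: "\<eta> \<in> Cc_inf \<Omega>" using Ck by (simp add: Cc_inf_def)
  have half: "\<bar>\<eta> x - 1/2\<bar> \<le> 1/2" for x
    unfolding \<eta>_def
  proof (rule convol_mollifier_bound[OF \<rho> \<delta> c])
    show "\<bar>c y - 1 / 2\<bar> \<le> 1 / 2" for y
      unfolding c_def by (simp add: max_def min_def abs_if)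
  qed
  have 4: "norm (grad \<eta> x) \<le> 2 / h" for x
    using convol_mollifier_lipschitz[OF \<rho> \<delta> c cL] h
    by (intro GDERIV_norm_le_lipschitz[OF GD]) (auto simp: \<eta>_def)
  have 5: "\<epsilon> < depth U x \<and> depth U x \<le> \<epsilon> + h" if g: "grad \<eta> x \<noteq> 0" for x
  proof (rule ccontr)
    assume "\<not> ?thesis"
    \<comment> \<open>These two regions are open and cover the complement of the shell, and \<eta>
      is constant on each.\<close>
    then consider "depth U x < \<epsilon> + h / 8" | "\<epsilon> + 7 * h / 8 < depth U x" using h by fastforce
    then show False
    proof cases
      case 1
      have "open {x. depth U x < \<epsilon> + h / 8}" by (intro open_Collect_less continuous_on_depth continuous_on_const)
      from grad_eq_0[OF this, of x \<eta> 0] 1 zero g show False by auto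
    next
      case 2
      have "open {x. \<epsilon> + 7 * h / 8 < depth U x}" by (intro open_Collect_less continuous_on_depth continuous_on_const)
      from grad_eq_0[OF this, of x \<eta> 1] 2 one g show False by auto
    qed
  qed
  show ?thesis
  proof (rule that[OF 1])
    show "0 \<le> \<eta> x" "\<eta> x \<le> 1" for x using half[of x] by linarith+
    show "\<eta> x = 0" if "depth U x \<le> \<epsilon>" for x using that h by (intro zero) simp
    show "\<eta> x = 1" if "\<epsilon> + h \<le> depth U x" for x using that h by (intro one) simp
  qed (use 4 5 in auto)
qed

text \<open>By Tonelli the average over \<open>\<epsilon>\<close> of the rescaled mass of the shell is at most the total mass;
  Fatou then bounds the lower limit for almost every \<open>\<epsilon>\<close>.\<close>

lemma shell_mass_AE:
  fixes d :: "'b \<Rightarrow> real"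
  assumes m: "finite_measure m" and d[measurable]: "d \<in> borel_measurable m"
  shows "AE \<epsilon> in lborel. \<exists>C::real. \<exists>\<^sub>F k in sequentially.
    (real k + 1) * measure m {x \<in> space m. \<epsilon> < d x \<and> d x \<le> \<epsilon> + 1 / (real k + 1)} \<le> C"
proof -
  interpret finite_measure m by fact
  have sf: "sigma_finite_measure m" by (rule sigma_finite_measure_axioms)
  interpret pair_sigma_finite m lborel
    by (intro pair_sigma_finite.intro) (auto intro: sigma_finite_measure_axioms lborel.sigma_finite_measure_axioms)
  define S where "S k \<epsilon> = {x \<in> space m. \<epsilon> < d x \<and> d x \<le> \<epsilon> + 1 / (real k + 1)}" for k \<epsilon>
  define I :: "nat \<Rightarrow> 'b \<times> real \<Rightarrow> ennreal"
    where "I k = indicator {p. snd p < d (fst p) \<and> d (fst p) \<le> snd p + 1 / (real k + 1)}" for k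
  define u where "u k \<epsilon> = ennreal (real k + 1) * (\<integral>\<^sup>+ x. I k (x, \<epsilon>) \<partial>m)" for k \<epsilon>
  have S[measurable]: "S k \<epsilon> \<in> sets m" for k \<epsilon> unfolding S_def by measurable
  have ueq: "u k \<epsilon> = ennreal ((real k + 1) * measure m (S k \<epsilon>))" for k \<epsilon>
  proof -
    have "(\<integral>\<^sup>+ x. I k (x, \<epsilon>) \<partial>m)
        = (\<integral>\<^sup>+ x. indicator (S k \<epsilon>) x \<partial>m)"
      by (intro nn_integral_cong) (auto simp: I_def S_def indicator_def)
    also have "\<dots> = ennreal (measure m (S k \<epsilon>))" using S by (simp add: emeasure_eq_measure)
    finally show ?thesis by (simp add: u_def ennreal_mult'' flip: ennreal_mult')
  qed
  have meas: "(\<lambda>p. I k p)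
      \<in> borel_measurable (m \<Otimes>\<^sub>M lborel)" for k
  proof -
    have "{p \<in> space (m \<Otimes>\<^sub>M lborel). snd p < d (fst p) \<and> d (fst p) \<le> snd p + 1 / (real k + 1)} \<in> sets (m \<Otimes>\<^sub>M lborel)"
      by measurable
    then show ?thesis
      by (subst measurable_cong[where g = "indicator {p \<in> space (m \<Otimes>\<^sub>M lborel). snd p < d (fst p) \<and> d (fst p) \<le> snd p + 1 / (real k + 1)}"])
        (auto simp: I_def indicator_def)
  qed
  have im: "(\<lambda>\<epsilon>. \<integral>\<^sup>+ x. I k (x, \<epsilon>) \<partial>m) \<in> borel_measurable lborel" for k
    using measurable_compose[OF measurable_pair_swap' meas[of k]]
    by (intro sigma_finite_measure.borel_measurable_nn_integral[OF sf]) (auto simp: split_beta')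
  have um: "u k \<in> borel_measurable lborel" for k
    unfolding u_def[abs_def] by (intro borel_measurable_times_ennreal borel_measurable_const im)
  have ub: "(\<integral>\<^sup>+ \<epsilon>. u k \<epsilon> \<partial>lborel) = emeasure m (space m)" for k
  proof -
    \<comment> \<open>A fixed \<open>x\<close> is counted for \<epsilon> in a half-open interval
      ending at \<open>d x\<close>, whose length is the inverse of the scaling factor.\<close>
    have inner: "(\<integral>\<^sup>+ \<epsilon>. I k (x, \<epsilon>) \<partial>lborel) = ennreal (1 / (real k + 1))" for x
    proof -
      have "(\<integral>\<^sup>+ \<epsilon>. I k (x, \<epsilon>) \<partial>lborel)
          = (\<integral>\<^sup>+ \<epsilon>. indicator {d x - 1 / (real k + 1) ..< d x} \<epsilon> \<partial>lborel)"
        by (intro nn_integral_cong) (auto simp: I_def indicator_def)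
      also have "\<dots> = ennreal (1 / (real k + 1))" by simp
      finally show ?thesis .
    qed
    have "(\<integral>\<^sup>+ \<epsilon>. u k \<epsilon> \<partial>lborel) = ennreal (real k + 1) *
       (\<integral>\<^sup>+ \<epsilon>. \<integral>\<^sup>+ x. I k (x, \<epsilon>) \<partial>m \<partial>lborel)"
      unfolding u_def by (rule nn_integral_cmult[OF im])
    also have "\<dots> = ennreal (real k + 1) * (\<integral>\<^sup>+ x. ennreal (1 / (real k + 1)) \<partial>m)"
      unfolding Fubini[OF meas] inner ..
    also have "\<dots> = (ennreal (real k + 1) * ennreal (1 / (real k + 1))) * emeasure m (space m)"
      by (simp add: mult.assoc)
    also have "ennreal (real k + 1) * ennreal (1 / (real k + 1)) = 1"
      by (subst ennreal_mult'[symmetric]) auto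
    finally show ?thesis by simp
  qed
  have "(\<integral>\<^sup>+ \<epsilon>. liminf (\<lambda>k. u k \<epsilon>) \<partial>lborel) \<le> emeasure m (space m)"
    using nn_integral_liminf[of u lborel] um by (simp add: ub Liminf_const)
  then have "(\<integral>\<^sup>+ \<epsilon>. liminf (\<lambda>k. u k \<epsilon>) \<partial>lborel) \<noteq> \<infinity>"
    using emeasure_finite[of "space m"] by (auto simp: top_unique)
  then have "AE \<epsilon> in lborel. liminf (\<lambda>k. u k \<epsilon>) \<noteq> \<infinity>"
    using um by (intro nn_integral_PInf_AE borel_measurable_liminf) auto
  then show ?thesis
  proof eventually_elim
    case (elim \<epsilon>)
    then obtain C where C: "C \<ge> 0" "liminf (\<lambda>k. u k \<epsilon>) = ennreal C" by (cases "liminf (\<lambda>k. u k \<epsilon>)") auto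
    \<comment> \<open>A finite lower limit gives a bound for infinitely many \<open>k\<close> only,
      so a subsequence will have to be chosen; \<open>C + 1\<close> lies strictly above the lower
      limit.\<close>
    have "\<not> (\<forall>\<^sub>F k in sequentially. ennreal (C + 1) \<le> u k \<epsilon>)"
    proof
      assume "\<forall>\<^sub>F k in sequentially. ennreal (C + 1) \<le> u k \<epsilon>"
      from Liminf_bounded[OF this] C show False by (simp add: ennreal_le_iff)
    qed
    then have "\<exists>\<^sub>F k in sequentially. \<not> ennreal (C + 1) \<le> u k \<epsilon>" by (simp add: not_eventually)
    then have "\<exists>\<^sub>F k in sequentially. (real k + 1) * measure m (S k \<epsilon>) \<le> C + 1"
    proof (rule frequently_elim1)
      fix k assume "\<not> ennreal (C + 1) \<le> u k \<epsilon>"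
      then have "\<not> C + 1 \<le> (real k + 1) * measure m (S k \<epsilon>)" unfolding ueq using ennreal_leI by blast
      then show "(real k + 1) * measure m (S k \<epsilon>) \<le> C + 1" by simp
    qed
    then show ?case unfolding S_def by blast
  qed
qed

section \<open>Limits along cutoff sequences\<close>

lemma signed_integral_dominated_convergence:
  assumes \<mu>: "radon_measure_on \<Omega> \<mu>" and m: "dominates m \<Omega> \<mu>"
    and f: "f \<in> borel_measurable m" and s: "\<And>i::nat. s i \<in> borel_measurable m"
    and lim: "\<And>x. x \<in> \<Omega> \<Longrightarrow> (\<lambda>i. s i x) \<longlonglongrightarrow> f x"
    and bd: "\<And>i x. x \<in> \<Omega> \<Longrightarrow> \<bar>s i x\<bar> \<le> C"
  shows "(\<lambda>i. signed_integral \<Omega> \<mu> (s i)) \<longlonglongrightarrow> signed_integral \<Omega> \<mu> f"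
proof -
  note mD = dominatesD[OF m]
  note L1 = L1_dominated_convergence[where w = "\<lambda>_. C", OF finite_measure.integrable_const[OF mD(1)] f s, unfolded mD(3), OF lim bd]
  show ?thesis by (rule signed_integral_tendsto[OF \<mu> m L1(3,2,1)])
qed

lemma integrable_scaleR_grad:
  fixes \<Omega> :: "'a::euclidean_space set"
  assumes m: "dominates m \<Omega> F" and \<eta>: "\<eta> \<in> Cc_inf \<Omega>" and f: "f \<in> borel_measurable m" "\<And>x. x \<in> \<Omega> \<Longrightarrow> \<bar>f x\<bar> \<le> C"
  shows "integrable m (\<lambda>x. f x *\<^sub>R grad \<eta> x)"
proof -
  note mD = dominatesD[OF m]
  obtain G where G: "G \<ge> 0" "\<And>x. norm (grad \<eta> x) \<le> G" by (rule Cc_inf_grad_bounded[OF \<eta>]) (rule that)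
  show ?thesis
  proof (rule finite_measure_integrable_bounded[OF mD(1)])
    show "(\<lambda>x. f x *\<^sub>R grad \<eta> x) \<in> borel_measurable m"
      by (intro borel_measurable_scaleR f continuous_borel_subsets_measurable[OF mD(2)] mD(2) continuous_grad[OF \<eta>])
    show "norm (f x *\<^sub>R grad \<eta> x) \<le> \<bar>C\<bar> * G" if "x \<in> space m" for x
      using f(2)[of x] that mD(3) G by (auto intro!: mult_mono)
  qed
qed

lemma Cc_integrable_scaleR_grad:
  fixes \<Omega> :: "'a::euclidean_space set"
  assumes m: "dominates m \<Omega> F" and f: "f \<in> Cc \<Omega>" and \<eta>: "\<eta> \<in> Cc_inf \<Omega>"
  shows "integrable m (\<lambda>x. f x *\<^sub>R grad \<eta> x)"
proof -
  obtain C where "C \<ge> 0" "\<And>x. \<bar>f x\<bar> \<le> C" by (rule Cc_bounded[OF f]) (rule that)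
  then show ?thesis
    using Cc_measurable[OF f dominatesD(2)[OF m]] by (intro integrable_scaleR_grad[OF m \<eta>]) auto
qed

context
  fixes \<Omega> :: "'a::euclidean_space set" and \<rho> :: "'a \<Rightarrow> real" and F :: "'a set \<Rightarrow> 'a" and m :: "'a measure"
  assumes \<Omega>: "open \<Omega>" and \<rho>: "standard_mollifier \<rho>" and F: "F \<in> DM_ext \<Omega>" and m: "dominates m \<Omega> F"
begin

context
  fixes \<eta> :: "nat \<Rightarrow> 'a \<Rightarrow> real" and E :: "'a set"
  assumes \<eta>: "\<And>j. \<eta> j \<in> Cc_inf \<Omega>" "\<And>j x. 0 \<le> \<eta> j x" "\<And>j x. \<eta> j x \<le> 1"
    and \<eta>_lim: "\<And>x. (\<lambda>j. \<eta> j x) \<longlonglongrightarrow> indicator E x"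
    and E: "E \<in> sets borel"
begin

lemma cutoff_measurable: "sets m' = borel_subsets \<Omega> \<Longrightarrow> \<eta> j \<in> borel_measurable m'"
  using Cc_measurable[OF Cc_inf_Cc[OF \<eta>(1)]] .

lemma indicator_measurable: "sets m' = borel_subsets \<Omega> \<Longrightarrow> (indicator E :: 'a \<Rightarrow> real) \<in> borel_measurable m'"
  using borel_measurable_indicator[OF E] measurable_restrict_space1 measurable_cong_sets by blast

text \<open>In the product rule tested with \<open>\<eta> j\<close>, the cutoffs enter the other two
  terms without derivative, so bounded pointwise convergence suffices.\<close>

lemma normal_trace_tendsto:
  assumes \<phi>: "\<phi> \<in> W1_inf \<Omega>"
  shows "(\<lambda>j. vector_integral \<Omega> F (\<lambda>x. \<phi> x *\<^sub>R grad (\<eta> j) x)) \<longlonglongrightarrow> normal_trace \<rho> \<Omega> F E \<phi>"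
proof -
  obtain C where C: "C \<ge> 0" "\<And>x. x \<in> \<Omega> \<Longrightarrow> \<bar>\<phi> x\<bar> \<le> C" by (rule W1_inf_bounded[OF \<Omega> \<phi>]) (rule that)
  note dr = divergence_radon[OF \<Omega> \<rho> F] and pr = pairing_radon[OF \<Omega> \<rho> \<phi> F]
  obtain m1 where m1: "dominates m1 \<Omega> (divergence \<Omega> F)" using exists_dominates[OF dr] .
  obtain m2 where m2: "dominates m2 \<Omega> (pairing \<rho> \<Omega> \<phi> F)" using exists_dominates[OF pr] .
  note s1 = dominatesD(2)[OF m1] and s2 = dominatesD(2)[OF m2]
  have eq: "vector_integral \<Omega> F (\<lambda>x. \<phi> x *\<^sub>R grad (\<eta> j) x) =
      - signed_integral \<Omega> (divergence \<Omega> F) (\<lambda>x. \<eta> j x * \<phi> x) - signed_integral \<Omega> (pairing \<rho> \<Omega> \<phi> F) (\<eta> j)" for j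
    using pairing_product_rule[OF \<Omega> \<rho> \<phi> F \<eta>(1)[of j]] by simp
  have 1: "(\<lambda>j. signed_integral \<Omega> (divergence \<Omega> F) (\<lambda>x. \<eta> j x * \<phi> x))
      \<longlonglongrightarrow> signed_integral \<Omega> (divergence \<Omega> F) (\<lambda>x. indicator E x * \<phi> x)"
  proof (rule signed_integral_dominated_convergence[OF dr m1])
    show "(\<lambda>x. indicator E x * \<phi> x) \<in> borel_measurable m1" "(\<lambda>x. \<eta> j x * \<phi> x) \<in> borel_measurable m1" for j
      by (intro borel_measurable_times indicator_measurable cutoff_measurable W1_inf_measurable[OF \<phi>] s1)+
    show "(\<lambda>j. \<eta> j x * \<phi> x) \<longlonglongrightarrow> indicator E x * \<phi> x" for x
      by (intro tendsto_mult_right \<eta>_lim)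
    show "\<bar>\<eta> j x * \<phi> x\<bar> \<le> C" if "x \<in> \<Omega>" for j x
      using mult_mono[OF \<eta>(3)[of j x] C(2)[OF that]] \<eta>(2)[of j x] by (simp add: abs_mult)
  qed
  have 2: "(\<lambda>j. signed_integral \<Omega> (pairing \<rho> \<Omega> \<phi> F) (\<eta> j))
      \<longlonglongrightarrow> signed_integral \<Omega> (pairing \<rho> \<Omega> \<phi> F) (indicator E)"
    by (rule signed_integral_dominated_convergence[where C = 1, OF pr m2 indicator_measurable[OF s2] cutoff_measurable[OF s2] \<eta>_lim])
      (use \<eta>(2,3) in auto)
  show ?thesis
    using tendsto_diff[OF tendsto_minus[OF 1] 2]
    unfolding eq normal_trace_def signed_set_integral_def by simp
qed

text \<open>A test function as weight is treated by integrating by parts against \<open>F\<close>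
  directly, instead of reading it as an element of \<open>W1_inf\<close>. Existence of the limit is
  enough to define the trace functional.\<close>

lemma smooth_trace_convergent:
  assumes \<psi>: "\<psi> \<in> Cc_inf \<Omega>"
  shows "convergent (\<lambda>j. vector_integral \<Omega> F (\<lambda>x. \<psi> x *\<^sub>R grad (\<eta> j) x))"
proof -
  note mD = dominatesD[OF m] and Fr = DM_ext_radon[OF F] and dr = divergence_radon[OF \<Omega> \<rho> F]
  obtain m1 where m1: "dominates m1 \<Omega> (divergence \<Omega> F)" using exists_dominates[OF dr] .
  note s1 = dominatesD(2)[OF m1]
  obtain C where C: "C \<ge> 0" "\<And>x. \<bar>\<psi> x\<bar> \<le> C" by (rule Cc_bounded[OF Cc_inf_Cc[OF \<psi>]]) (rule that)
  obtain G where G: "G \<ge> 0" "\<And>x. norm (grad \<psi> x) \<le> G" by (rule Cc_inf_grad_bounded[OF \<psi>]) (rule that)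
  have i1: "integrable m (\<lambda>x. \<eta> j x *\<^sub>R grad \<psi> x)" for j
    using \<eta>(2,3) by (intro integrable_scaleR_grad[OF m \<psi> cutoff_measurable[OF mD(2)], of _ 1]) auto
  have i2: "integrable m (\<lambda>x. indicator E x *\<^sub>R grad \<psi> x)"
    by (intro integrable_scaleR_grad[OF m \<psi> indicator_measurable[OF mD(2)], of 1]) auto
  have i3: "integrable m (\<lambda>x. \<psi> x *\<^sub>R grad (\<eta> j) x)" for j
    by (rule Cc_integrable_scaleR_grad[OF m Cc_inf_Cc[OF \<psi>] \<eta>(1)])
  have eq: "vector_integral \<Omega> F (\<lambda>x. \<psi> x *\<^sub>R grad (\<eta> j) x) =
      - signed_integral \<Omega> (divergence \<Omega> F) (\<lambda>x. \<psi> x * \<eta> j x) - vector_integral \<Omega> F (\<lambda>x. \<eta> j x *\<^sub>R grad \<psi> x)" for j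
  proof -
    have "(\<lambda>x. \<psi> x * \<eta> j x) \<in> Cc_inf \<Omega>" by (rule Cc_inf_mult[OF \<psi> Cc_inf_Ck[OF \<eta>(1)]])
    moreover have "grad (\<lambda>x. \<psi> x * \<eta> j x) = (\<lambda>x. \<psi> x *\<^sub>R grad (\<eta> j) x + \<eta> j x *\<^sub>R grad \<psi> x)"
      by (rule ext) (rule grad_mult[OF Cc_inf_GDERIV[OF \<psi>] Cc_inf_GDERIV[OF \<eta>(1)]])
    ultimately have "signed_integral \<Omega> (divergence \<Omega> F) (\<lambda>x. \<psi> x * \<eta> j x)
        = - vector_integral \<Omega> F (\<lambda>x. \<psi> x *\<^sub>R grad (\<eta> j) x + \<eta> j x *\<^sub>R grad \<psi> x)"
      using signed_integral_divergence[OF \<Omega> \<rho> F] by metis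
    then show ?thesis using vector_integral_add[OF Fr m i3 i1] by simp
  qed
  have 1: "(\<lambda>j. signed_integral \<Omega> (divergence \<Omega> F) (\<lambda>x. \<psi> x * \<eta> j x))
      \<longlonglongrightarrow> signed_integral \<Omega> (divergence \<Omega> F) (\<lambda>x. \<psi> x * indicator E x)"
  proof (rule signed_integral_dominated_convergence[OF dr m1])
    show "(\<lambda>x. \<psi> x * indicator E x) \<in> borel_measurable m1" "(\<lambda>x. \<psi> x * \<eta> j x) \<in> borel_measurable m1" for j
      by (intro borel_measurable_times indicator_measurable cutoff_measurable Cc_measurable[OF Cc_inf_Cc[OF \<psi>] s1] s1)+
    show "(\<lambda>j. \<psi> x * \<eta> j x) \<longlonglongrightarrow> \<psi> x * indicator E x" for x
      by (intro tendsto_mult_left \<eta>_lim)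
    show "\<bar>\<psi> x * \<eta> j x\<bar> \<le> C" if "x \<in> \<Omega>" for j x
      using mult_mono[OF C(2)[of x] \<eta>(3)[of j x]] \<eta>(2)[of j x] C(1) by (simp add: abs_mult)
  qed
  have 2: "(\<lambda>j. vector_integral \<Omega> F (\<lambda>x. \<eta> j x *\<^sub>R grad \<psi> x)) \<longlonglongrightarrow> vector_integral \<Omega> F (\<lambda>x. indicator E x *\<^sub>R grad \<psi> x)"
  proof (rule vector_integral_tendsto[OF Fr m i1 i2])
    have ng: "(\<lambda>x. norm (grad \<psi> x)) \<in> borel_measurable m"
      by (intro continuous_borel_subsets_measurable[OF mD(2)] mD(2) continuous_on_norm continuous_grad[OF \<psi>])
    have "(\<lambda>j. \<integral>x. \<bar>\<eta> j x * norm (grad \<psi> x) - indicator E x * norm (grad \<psi> x)\<bar> \<partial>m) \<longlonglongrightarrow> 0"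
    proof (rule L1_dominated_convergence(1)[where w = "\<lambda>_. G"])
      show "integrable m (\<lambda>_. G)" by (rule finite_measure.integrable_const[OF mD(1)])
      show "(\<lambda>x. indicator E x * norm (grad \<psi> x)) \<in> borel_measurable m" "(\<lambda>x. \<eta> j x * norm (grad \<psi> x)) \<in> borel_measurable m" for j
        by (intro borel_measurable_times indicator_measurable cutoff_measurable mD(2) ng)+
      show "(\<lambda>j. \<eta> j x * norm (grad \<psi> x)) \<longlonglongrightarrow> indicator E x * norm (grad \<psi> x)" for x
        by (intro tendsto_mult_right \<eta>_lim)
      show "\<bar>\<eta> j x * norm (grad \<psi> x)\<bar> \<le> G" for j x
        using mult_mono[OF \<eta>(3)[of j x] G(2)[of x]] \<eta>(2)[of j x] by (simp add: abs_mult)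
    qed
    moreover have "norm (\<eta> j x *\<^sub>R grad \<psi> x - indicator E x *\<^sub>R grad \<psi> x) = \<bar>\<eta> j x * norm (grad \<psi> x) - indicator E x * norm (grad \<psi> x)\<bar>" for j x
      by (simp flip: scaleR_diff_left left_diff_distrib add: abs_mult)
    ultimately show "(\<lambda>j. \<integral>x. norm (\<eta> j x *\<^sub>R grad \<psi> x - indicator E x *\<^sub>R grad \<psi> x) \<partial>m) \<longlonglongrightarrow> 0" by simp
  qed
  show ?thesis
    unfolding eq by (rule convergentI[OF tendsto_diff[OF tendsto_minus[OF 1] 2]])
qed

end

end

section \<open>Trace measures\<close>

text \<open>\<phi> is continuous only on \<Omega>. The product is continuous there and vanishes on
  the open complement of a compact subset, and these two open sets cover the space.\<close>

lemma Cc_mult_continuous_on: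
  fixes \<Omega> :: "'a::euclidean_space set"
  assumes \<Omega>: "open \<Omega>" and \<zeta>: "\<zeta> \<in> Cc \<Omega>" and \<phi>: "continuous_on \<Omega> \<phi>"
  shows "(\<lambda>x. \<zeta> x * (indicator \<Omega> x * \<phi> x)) \<in> Cc \<Omega>"
proof -
  obtain K where K: "compact K" "K \<subseteq> \<Omega>" "\<And>x. x \<notin> K \<Longrightarrow> \<zeta> x = 0" using CcE[OF \<zeta>] by metis
  let ?f = "\<lambda>x. \<zeta> x * (indicator \<Omega> x * \<phi> x)"
  have "continuous_on (\<Omega> \<union> - K) ?f"
  proof (rule continuous_on_open_Un[OF \<Omega>])
    have "continuous_on \<Omega> (\<lambda>x. \<zeta> x * \<phi> x)"
      using Cc_continuous[OF \<zeta>] \<phi> by (intro continuous_on_mult) (auto intro: continuous_on_subset)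
    then show "continuous_on \<Omega> ?f" by (rule continuous_on_eq) simp
    show "open (- K)" using K(1) by (simp add: compact_imp_closed open_Compl)
    show "continuous_on (- K) ?f" by (rule continuous_on_eq[OF continuous_on_const[of _ 0]]) (simp add: K(3))
  qed
  moreover have "\<Omega> \<union> - K = UNIV" using K(2) by blast
  ultimately show ?thesis using K by (intro CcI[of _ K]) auto
qed

lemma frontier_inner_set_subset: "frontier (inner_set U \<epsilon>) \<subseteq> closure U"
  using closure_mono[OF inner_set_subset[of U \<epsilon>]] by (auto simp: frontier_def)

text \<open>The integrals of such a function against the rescaled shell masses tend to 0, which confines
  their weak limits to the frontier.\<close>

lemma frontier_detector:
  fixes U :: "'a::euclidean_space set"
  assumes \<epsilon>: "\<epsilon> > 0"
  obtains g :: "'a \<Rightarrow> real" where "continuous_on UNIV g" "\<And>x. 0 \<le> g x" "\<And>x. g x \<le> 1"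
    "\<And>x. g x = 0 \<Longrightarrow> x \<in> frontier (inner_set U \<epsilon>)"
    "\<And>x h. \<epsilon> < depth U x \<Longrightarrow> depth U x \<le> \<epsilon> + h \<Longrightarrow> g x \<le> h"
proof (cases "inner_set U \<epsilon> = {}")
  case True
  \<comment> \<open>An empty inner set has empty shells, so a function without zeros will do; the
    formula of the other case would suffer from the convention
    \<open>infdist x {} = 0\<close>.\<close>
  then show ?thesis using \<epsilon> by (intro that[of "\<lambda>_. 1"]) (auto simp: inner_set_eq)
next
  case False
  have op: "open (inner_set U \<epsilon>)" using \<epsilon> by (intro open_inner_set) simp
  \<comment> \<open>The first summand vanishes on the closure of the inner set, the second where the
    distance to the frontier of \<open>U\<close> is at most \<epsilon>, which excludes the open
    inner set; common zeros thus lie on its frontier. On the shell only the second survives, and it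
    is at most \<open>h\<close>.\<close>
  define g where "g x = min 1 (infdist x (closure (inner_set U \<epsilon>)) + max 0 (infdist x (frontier U) - \<epsilon>))" for x
  have pos: "0 \<le> infdist x (closure (inner_set U \<epsilon>))" "0 \<le> max 0 (infdist x (frontier U) - \<epsilon>)" for x
    by (auto simp: infdist_nonneg)
  show ?thesis
  proof (rule that)
    show "continuous_on UNIV g" unfolding g_def[abs_def] by (intro continuous_intros)
    show "0 \<le> g x" "g x \<le> 1" for x using pos[of x] by (auto simp: g_def)
    show "x \<in> frontier (inner_set U \<epsilon>)" if "g x = 0" for x
    proof -
      have "infdist x (closure (inner_set U \<epsilon>)) = 0" "infdist x (frontier U) \<le> \<epsilon>"
        using that pos[of x] unfolding g_def by linarith+
      then have "x \<in> closure (inner_set U \<epsilon>)" "x \<notin> inner_set U \<epsilon>"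
        using False in_closed_iff_infdist_zero[OF closed_closure, of "inner_set U \<epsilon>" x] closure_eq_empty
        by (auto simp: inner_set_def)
      then show ?thesis using op by (simp add: frontier_def interior_open)
    qed
    show "g x \<le> h" if x: "\<epsilon> < depth U x" "depth U x \<le> \<epsilon> + h" for x h
    proof -
      have "x \<in> inner_set U \<epsilon>" using x \<epsilon> by (simp add: inner_set_eq)
      then have "x \<in> closure (inner_set U \<epsilon>)" using closure_subset by blast
      then have "infdist x (closure (inner_set U \<epsilon>)) = 0" by simp
      moreover have "depth U x = infdist x (frontier U)"
        using x \<epsilon> by (auto simp: depth_def split: if_splits)
      ultimately show ?thesis using x by (simp add: g_def)
    qed
  qed
qed

text \<open>The trace functional is defined on smooth functions as a limit and is dominated there by
  the weak limit of the shell measures. It is represented first; the identity for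
  \<open>W1_inf\<close> follows by approximation, since the limit there is already known to be the
  normal trace.\<close>

lemma trace_measure_exists:
  fixes \<Omega> U :: "'a::euclidean_space set" and \<rho> :: "'a \<Rightarrow> real" and F :: "'a set \<Rightarrow> 'a"
  assumes \<Omega>: "open \<Omega>" and \<rho>: "standard_mollifier \<rho>" and F: "F \<in> DM_ext \<Omega>" and m: "dominates m \<Omega> F"
    and U: "open U" "compact (closure U)" "closure U \<subseteq> \<Omega>" and \<epsilon>: "\<epsilon> > 0"
    and freq: "\<exists>\<^sub>F k in sequentially.
      (real k + 1) * measure m {x \<in> space m. \<epsilon> < depth U x \<and> depth U x \<le> \<epsilon> + 1 / (real k + 1)} \<le> C"
  obtains T where "radon_measure_on \<Omega> T" "supported_on \<Omega> T (frontier (inner_set U \<epsilon>))"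
    "\<And>\<phi>. \<phi> \<in> W1_inf \<Omega> \<Longrightarrow> normal_trace \<rho> \<Omega> F (inner_set U \<epsilon>) \<phi> =
       signed_set_integral \<Omega> (frontier (inner_set U \<epsilon>)) T \<phi>"
proof -
  note mD = dominatesD[OF m]
  interpret m: finite_measure m by (rule mD)
  let ?E = "inner_set U \<epsilon>"
  have E: "?E \<in> sets borel" using open_inner_set[of \<epsilon> U] \<epsilon> by (intro borel_open) simp
  define h where "h k = 1 / (real k + 1)" for k
  have h: "h k > 0" for k by (simp add: h_def)
  have h0: "h \<longlonglongrightarrow> 0" unfolding h_def[abs_def] using LIMSEQ_inverse_real_of_nat by (simp add: inverse_eq_divide add.commute)
  define S where "S k = {x \<in> space m. \<epsilon> < depth U x \<and> depth U x \<le> \<epsilon> + h k}" for k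
  have dm[measurable]: "depth U \<in> borel_measurable m"
    by (rule continuous_borel_subsets_measurable[OF mD(2) continuous_on_depth])
  have S[measurable]: "S k \<in> sets m" for k unfolding S_def by measurable
  have SU: "S k \<subseteq> U" for k using \<epsilon> by (auto simp: S_def depth_def split: if_splits)
  have id[measurable]: "(\<lambda>x. x) \<in> m \<rightarrow>\<^sub>M borel"
    by (rule continuous_borel_subsets_measurable[OF mD(2)]) (rule continuous_on_id)
  have "\<exists>\<^sub>F k in cofinite. (real k + 1) * measure m (S k) \<le> C"
    using freq unfolding S_def h_def cofinite_eq_sequentially .
  then have "infinite {k. (real k + 1) * measure m (S k) \<le> C}"
    unfolding frequently_cofinite .
  \<comment> \<open>Infinitely many shells have bounded rescaled mass; \<open>q\<close> lists them,
    and weak convergence will pass to a further subsequence \<open>r\<close>.\<close>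
  from infinite_enumerate[OF this] obtain q :: "nat \<Rightarrow> nat"
    where q: "strict_mono q" "\<And>j. q j \<in> {k. (real k + 1) * measure m (S k) \<le> C}"
    by blast
  have "\<exists>\<eta>. \<eta> \<in> Cc_inf \<Omega> \<and> (\<forall>x. 0 \<le> \<eta> x) \<and> (\<forall>x. \<eta> x \<le> 1) \<and> (\<forall>x. norm (grad \<eta> x) \<le> 2 / h k) \<and>
     (\<forall>x. grad \<eta> x \<noteq> 0 \<longrightarrow> \<epsilon> < depth U x \<and> depth U x \<le> \<epsilon> + h k) \<and>
     (\<forall>x. depth U x \<le> \<epsilon> \<longrightarrow> \<eta> x = 0) \<and> (\<forall>x. \<epsilon> + h k \<le> depth U x \<longrightarrow> \<eta> x = 1)" for k
    by (rule depth_cutoff[OF \<rho> \<epsilon> h[of k] U(2,3)]) blast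
  then obtain \<eta> where \<eta>: "\<And>k. \<eta> k \<in> Cc_inf \<Omega>" "\<And>k x. 0 \<le> \<eta> k x" "\<And>k x. \<eta> k x \<le> 1"
    "\<And>k x. norm (grad (\<eta> k) x) \<le> 2 / h k"
    "\<And>k x. grad (\<eta> k) x \<noteq> 0 \<Longrightarrow> \<epsilon> < depth U x \<and> depth U x \<le> \<epsilon> + h k"
    "\<And>k x. depth U x \<le> \<epsilon> \<Longrightarrow> \<eta> k x = 0" "\<And>k x. \<epsilon> + h k \<le> depth U x \<Longrightarrow> \<eta> k x = 1"
    by metis
  have \<eta>lim: "(\<lambda>k. \<eta> k x) \<longlonglongrightarrow> indicator ?E x" for x
  proof (cases "\<epsilon> < depth U x")
    case True
    have "\<forall>\<^sub>F k in sequentially. h k < depth U x - \<epsilon>" using h0 True by (intro order_tendstoD) auto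
    then have "\<forall>\<^sub>F k in sequentially. \<eta> k x = 1" by (rule eventually_mono) (intro \<eta>(7), simp)
    then have "(\<lambda>k. \<eta> k x) \<longlonglongrightarrow> 1" by (rule tendsto_eventually)
    then show ?thesis using True \<epsilon> by (simp add: inner_set_eq)
  next
    case False
    then show ?thesis using \<eta>(6) \<epsilon> by (simp add: inner_set_eq)
  qed
  \<comment> \<open>\<open>n\<close> is the constant of \<open>vector_integral_bound\<close> and
    \<open>2 / h k\<close> bounds the cutoff gradient, so integrating \<open>f\<close> times that
    gradient against \<open>F\<close> is dominated by integrating \<open>\<bar>f x\<bar>\<close>
    with the weight \<open>w k\<close>.\<close>
  define n where "n = real (2 * DIM('a))"
  have n: "n > 0" by (simp add: n_def)
  define w where "w k x = n * (2 / h k) * indicator (S k) x" for k x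
  have w: "w k x \<ge> 0" for k x using n h[of k] by (simp add: w_def)
  have [measurable]: "w k \<in> borel_measurable m" for k unfolding w_def by measurable
  \<comment> \<open>Pushed forward to the Borel sets of the whole space, where the compactness
    theorem is stated.\<close>
  define \<sigma> where "\<sigma> k = distr (density m (\<lambda>x. ennreal (w k x))) borel (\<lambda>x. x)" for k
  have \<sigma>int: "(\<integral>x. f x \<partial>\<sigma> k) = (\<integral>x. w k x * f x \<partial>m)" if [measurable]: "f \<in> borel_measurable borel" for f :: "'a \<Rightarrow> real" and k
  proof -
    have fm: "f \<in> borel_measurable m" using measurable_compose[OF id that] by simp
    have "(\<integral>x. f x \<partial>\<sigma> k) = (\<integral>x. f x \<partial>density m (\<lambda>x. ennreal (w k x)))"
      unfolding \<sigma>_def by (intro integral_distr) (use id in \<open>auto simp: measurable_density_eq1\<close>)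
    also have "\<dots> = (\<integral>x. w k x * f x \<partial>m)"
      using fm w by (subst integral_density) auto
    finally show ?thesis .
  qed
  have wint: "(\<integral>x. w k x \<partial>m) = n * (2 / h k) * measure m (S k)" for k
    using sets.sets_into_space[OF S[of k]] by (simp add: w_def Int_absorb2)
  have wi: "integrable m (w k)" for k
    unfolding w_def by (intro integrable_mult_right integrable_real_indicator S) (simp add: m.emeasure_eq_measure)
  have sets\<sigma>: "sets (\<sigma> k) = sets borel" for k by (simp add: \<sigma>_def)
  have mass_em: "emeasure (\<sigma> k) UNIV = ennreal (\<integral>x. w k x \<partial>m)" for k
  proof -
    have "emeasure (\<sigma> k) UNIV = emeasure (density m (\<lambda>x. ennreal (w k x))) (space m)"
      unfolding \<sigma>_def by (subst emeasure_distr) (use id in \<open>auto simp: measurable_density_eq1\<close>)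
    also have "\<dots> = (\<integral>\<^sup>+x. ennreal (w k x) \<partial>m)"
      by (subst emeasure_density) (auto intro!: nn_integral_cong)
    also have "\<dots> = ennreal (\<integral>x. w k x \<partial>m)"
      using wi w by (intro nn_integral_eq_integral) auto
    finally show ?thesis .
  qed
  have sp\<sigma>: "space (\<sigma> k) = UNIV" for k by (simp add: \<sigma>_def)
  have fin\<sigma>: "finite_measure (\<sigma> k)" for k
    using mass_em[of k] by (intro finite_measureI) (simp add: sp\<sigma>)
  have mass\<sigma>: "measure (\<sigma> (q j)) UNIV \<le> 2 * n * C" for j
  proof -
    have "measure (\<sigma> (q j)) UNIV = (\<integral>x. w (q j) x \<partial>m)"
      using mass_em[of "q j"] w by (simp add: measure_def)
    also have "\<dots> = 2 * n * ((real (q j) + 1) * measure m (S (q j)))" by (simp add: wint h_def)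
    also have "\<dots> \<le> 2 * n * C" using q(2)[of j] n by (intro mult_left_mono) auto
    finally show ?thesis .
  qed
  have bU: "bounded U" using U(2) bounded_subset[OF compact_imp_bounded closure_subset] by blast
  have aeU: "AE x in \<sigma> k. x \<in> U" for k
  proof -
    have "AE x in density m (\<lambda>x. ennreal (w k x)). x \<in> U"
      using SU[of k] by (subst AE_density) (auto simp: w_def indicator_def split: if_splits)
    then show ?thesis
      unfolding \<sigma>_def using U(1) by (subst AE_distr_iff) (use id in \<open>auto simp: measurable_density_eq1 borel_open\<close>)
  qed
  obtain r \<tau> where r: "strict_mono (r :: nat \<Rightarrow> nat)" and \<tau>: "finite_measure \<tau>" "sets \<tau> = sets borel"
    and lim\<sigma>: "\<And>f :: 'a \<Rightarrow> real. continuous_on UNIV f \<Longrightarrow> (\<lambda>j. \<integral>x. f x \<partial>\<sigma> (q (r j))) \<longlonglongrightarrow> (\<integral>x. f x \<partial>\<tau>)"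
    by (rule bounded_measures_weak_compactness[of "\<lambda>j. \<sigma> (q j)", OF fin\<sigma> sets\<sigma> mass\<sigma> bU borel_open[OF U(1)] aeU]) (rule that)
  interpret \<tau>: finite_measure \<tau> by (rule \<tau>)
  have sp\<tau>: "space \<tau> = UNIV" using sets_eq_imp_space_eq[OF \<tau>(2)] by simp
  define p where "p j = q (r j)" for j
  have p: "strict_mono p" unfolding p_def using q(1) r by (simp add: strict_mono_def)
  note lim\<sigma> = lim\<sigma>[folded p_def]
  have h0p: "(\<lambda>j. h (p j)) \<longlonglongrightarrow> 0" using LIMSEQ_subseq_LIMSEQ[OF h0 p] by (simp add: o_def)
  have \<eta>limp: "(\<lambda>j. \<eta> (p j) x) \<longlonglongrightarrow> indicator ?E x" for x
    using LIMSEQ_subseq_LIMSEQ[OF \<eta>lim p] by (simp add: o_def)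
  define X where "X j = \<eta> (p j)" for j
  let ?v = "\<lambda>f j. vector_integral \<Omega> F (\<lambda>x. f x *\<^sub>R grad (X j) x)"
  have Xc: "X j \<in> Cc_inf \<Omega>" for j by (simp add: X_def \<eta>)
  note Fr = DM_ext_radon[OF F]
  have vb: "\<bar>?v f j\<bar> \<le> (\<integral>x. \<bar>f x\<bar> \<partial>\<sigma> (p j))" if f: "f \<in> Cc \<Omega>" for f j
  proof -
    have i: "integrable m (\<lambda>x. f x *\<^sub>R grad (X j) x)" by (rule Cc_integrable_scaleR_grad[OF m f Xc])
    have fb: "f \<in> borel_measurable borel" using Cc_continuous[OF f] by (rule borel_measurable_continuous_onI)
    obtain B where B: "B \<ge> 0" "\<And>x. \<bar>f x\<bar> \<le> B" by (rule Cc_bounded[OF f]) (rule that)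
    have wf: "integrable m (\<lambda>x. w (p j) x * \<bar>f x\<bar>)"
    proof (rule Bochner_Integration.integrable_bound[OF integrable_mult_left[OF wi[of "p j"], of B]])
      show "AE x in m. norm (w (p j) x * \<bar>f x\<bar>) \<le> norm (w (p j) x * B)"
        using w B by (intro AE_I2) (auto simp: abs_mult intro!: mult_mono)
      show "(\<lambda>x. w (p j) x * \<bar>f x\<bar>) \<in> borel_measurable m"
        using Cc_measurable[OF f mD(2)] by measurable
    qed
    have "\<bar>?v f j\<bar> \<le> n * (\<integral>x. norm (f x *\<^sub>R grad (X j) x) \<partial>m)"
      using vector_integral_bound[OF Fr m i] by (simp add: n_def)
    also have "\<dots> = (\<integral>x. n * norm (f x *\<^sub>R grad (X j) x) \<partial>m)" by simp
    also have "\<dots> \<le> (\<integral>x. w (p j) x * \<bar>f x\<bar> \<partial>m)"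
    proof (rule integral_mono[OF _ wf])
      show "integrable m (\<lambda>x. n * norm (f x *\<^sub>R grad (X j) x))" using integrable_norm[OF i] by (intro integrable_mult_right)
      show "n * norm (f x *\<^sub>R grad (X j) x) \<le> w (p j) x * \<bar>f x\<bar>" if x: "x \<in> space m" for x
      proof (cases "grad (X j) x = 0")
        case False
        then have "x \<in> S (p j)" using \<eta>(5)[of "p j" x] x by (simp add: X_def S_def)
        then have "w (p j) x * \<bar>f x\<bar> = n * (\<bar>f x\<bar> * (2 / h (p j)))" by (simp add: w_def)
        moreover have "n * (\<bar>f x\<bar> * norm (grad (X j) x)) \<le> n * (\<bar>f x\<bar> * (2 / h (p j)))"
          using n \<eta>(4)[of "p j" x] by (intro mult_left_mono) (auto simp: X_def)
        ultimately show ?thesis by simp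
      qed (simp add: w)
    qed
    also have "\<dots> = (\<integral>x. \<bar>f x\<bar> \<partial>\<sigma> (p j))" using fb by (subst \<sigma>int) auto
    finally show ?thesis .
  qed
  obtain g where g: "continuous_on UNIV g" "\<And>x. 0 \<le> g x" "\<And>x. g x \<le> 1"
    "\<And>x. g x = 0 \<Longrightarrow> x \<in> frontier ?E"
    "\<And>x h. \<epsilon> < depth U x \<Longrightarrow> depth U x \<le> \<epsilon> + h \<Longrightarrow> g x \<le> h"
    by (rule frontier_detector[OF \<epsilon>, of U]) (rule that)
  have gb: "g \<in> borel_measurable borel" using g(1) by (rule borel_measurable_continuous_onI)
  \<comment> \<open>On the shells \<open>g\<close> is at most \<open>h\<close> while the masses stay
    bounded, so the integrals tend to 0; as \<open>g\<close> is nonnegative, \<tau> is concentrated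
    on its zeros.\<close>
  have "(\<integral>x. g x \<partial>\<tau>) \<le> 0"
  proof (rule LIMSEQ_le[OF lim\<sigma>[OF g(1)]])
    show "(\<lambda>j. h (p j) * (2 * n * C)) \<longlonglongrightarrow> 0" using tendsto_mult_left_zero[OF h0p] .
    have "(\<integral>x. g x \<partial>\<sigma> (p j)) \<le> h (p j) * (2 * n * C)" for j
    proof -
      have "(\<integral>x. g x \<partial>\<sigma> (p j)) = (\<integral>x. w (p j) x * g x \<partial>m)" by (rule \<sigma>int[OF gb])
      also have "\<dots> \<le> (\<integral>x. h (p j) * w (p j) x \<partial>m)"
      proof (rule integral_mono)
        show "integrable m (\<lambda>x. w (p j) x * g x)"
        proof (rule Bochner_Integration.integrable_bound[OF wi[of "p j"]])
          show "AE x in m. norm (w (p j) x * g x) \<le> norm (w (p j) x)"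
            using w g by (intro AE_I2) (auto simp: abs_mult intro!: mult_right_le_one_le)
          show "(\<lambda>x. w (p j) x * g x) \<in> borel_measurable m"
            using continuous_borel_subsets_measurable[OF mD(2) g(1)] by measurable
        qed
        show "integrable m (\<lambda>x. h (p j) * w (p j) x)" using wi by (intro integrable_mult_right)
        show "w (p j) x * g x \<le> h (p j) * w (p j) x" if "x \<in> space m" for x
        proof (cases "x \<in> S (p j)")
          case True
          then have "g x \<le> h (p j)" using g(5) by (auto simp: S_def)
          then show ?thesis using w[of "p j" x] by (simp add: mult.commute[of _ "g x"] mult_right_mono)
        qed (simp add: w_def)
      qed
      also have "\<dots> = h (p j) * measure (\<sigma> (p j)) UNIV"
        using mass_em[of "p j"] w by (simp add: measure_def)
      also have "\<dots> \<le> h (p j) * (2 * n * C)"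
        using mass\<sigma>[of "r j"] h[of "p j"] by (intro mult_left_mono) (auto simp: p_def)
      finally show ?thesis .
    qed
    then show "\<exists>N. \<forall>j\<ge>N. (\<integral>x. g x \<partial>\<sigma> (p j)) \<le> h (p j) * (2 * n * C)" by blast
  qed
  moreover have gi: "integrable \<tau> g"
    using g(2,3) gb \<tau>(2) by (intro \<tau>.integrable_const_bound[where B = 1]) (auto cong: measurable_cong_sets)
  ultimately have "(\<integral>x. g x \<partial>\<tau>) = 0" using g(2) by (intro antisym integral_nonneg_AE) auto
  then have "AE x in \<tau>. g x = 0" using integral_nonneg_eq_0_iff_AE[OF gi] g(2) by simp
  then have ae\<tau>: "AE x in \<tau>. x \<in> frontier ?E" by (rule eventually_mono) (rule g(4))
  \<comment> \<open>Back to \<Omega>: functions in \<open>Cc \<Omega>\<close> have the same integral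
    for both measures.\<close>
  define M where "M = restrict_space \<tau> \<Omega>"
  have \<Omega>\<tau>: "\<Omega> \<inter> space \<tau> \<in> sets \<tau>" using \<Omega> \<tau>(2) by (simp add: sp\<tau> borel_open)
  have Ms: "sets M = borel_subsets \<Omega>" unfolding M_def using \<tau>(2) by (simp add: sets_restrict_space)
  have Mf: "finite_measure M" unfolding M_def by (rule finite_measure_restrict_space[OF \<tau>(1)]) (use \<Omega>\<tau> sp\<tau> in simp)
  have spM: "space M = \<Omega>" by (simp add: M_def space_restrict_space sp\<tau>)
  have Mint: "(\<integral>x. \<bar>f x\<bar> \<partial>M) = (\<integral>x. \<bar>f x\<bar> \<partial>\<tau>)" if f: "f \<in> Cc \<Omega>" for f
  proof -
    obtain K where K: "K \<subseteq> \<Omega>" "\<And>x. x \<notin> K \<Longrightarrow> f x = 0" using CcE[OF f] by metis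
    have "indicator \<Omega> x *\<^sub>R \<bar>f x\<bar> = \<bar>f x\<bar>" for x using K by (cases "x \<in> \<Omega>") auto
    then show ?thesis unfolding M_def integral_restrict_space[OF \<Omega>\<tau>] by (simp only:)
  qed
  have lim_abs: "(\<lambda>j. \<integral>x. \<bar>f x\<bar> \<partial>\<sigma> (p j)) \<longlonglongrightarrow> (\<integral>x. \<bar>f x\<bar> \<partial>M)" if f: "f \<in> Cc \<Omega>" for f
    unfolding Mint[OF f] by (intro lim\<sigma> continuous_on_rabs Cc_continuous[OF f])
  have conv: "convergent (?v f)" if "f \<in> Cc_inf \<Omega>" for f
    using smooth_trace_convergent[OF \<Omega> \<rho> F m Xc, where E = ?E] \<eta>(2,3) \<eta>limp E that by (simp add: X_def)
  define L where "L f = lim (?v f)" for f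
  have L: "?v f \<longlonglongrightarrow> L f" if "f \<in> Cc_inf \<Omega>" for f
    using conv[OF that] by (simp add: L_def convergent_LIMSEQ_iff)
  note vint = Cc_integrable_scaleR_grad[OF m Cc_inf_Cc Xc]
  have Ladd: "L (\<lambda>x. f x + f' x) = L f + L f'" if f: "f \<in> Cc_inf \<Omega>" "f' \<in> Cc_inf \<Omega>" for f f'
  proof (rule LIMSEQ_unique[OF L[OF Cc_inf_add[OF f]]])
    have "?v (\<lambda>x. f x + f' x) j = ?v f j + ?v f' j" for j
      using vector_integral_add[OF Fr m vint[OF f(1)] vint[OF f(2)]] by (simp add: scaleR_add_left)
    then show "?v (\<lambda>x. f x + f' x) \<longlonglongrightarrow> L f + L f'"
      using tendsto_add[OF L[OF f(1)] L[OF f(2)]] by simp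
  qed
  have Lscale: "L (\<lambda>x. c * f x) = c * L f" if f: "f \<in> Cc_inf \<Omega>" for f c
  proof (rule LIMSEQ_unique[OF L[OF Cc_inf_cmult[OF f]]])
    show "?v (\<lambda>x. c * f x) \<longlonglongrightarrow> c * L f"
      using tendsto_mult_left[OF L[OF f], of c] by (simp add: vector_integral_scaleR flip: scaleR_scaleR)
  qed
  have Lbd: "\<bar>L f\<bar> \<le> (\<integral>x. \<bar>f x\<bar> \<partial>M)" if f: "f \<in> Cc_inf \<Omega>" for f
    by (rule LIMSEQ_le[OF tendsto_rabs[OF L[OF f]] lim_abs[OF Cc_inf_Cc[OF f]]])
      (use vb[OF Cc_inf_Cc[OF f]] in blast)
  obtain T where T: "radon_measure_on \<Omega> T" "dominates M \<Omega> T"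
    "\<And>f. f \<in> Cc_inf \<Omega> \<Longrightarrow> signed_integral \<Omega> T f = L f"
    by (rule L1_bounded_functional_representation[OF \<rho> \<Omega> Mf Ms Ladd Lscale Lbd]) (assumption | rule that)+
  have frB: "frontier ?E \<in> sets borel" by (intro borel_closed frontier_closed)
  have frsub: "frontier ?E \<subseteq> closure U" by (rule frontier_inner_set_subset)
  have aeM: "AE x in M. x \<in> frontier ?E"
    unfolding M_def using ae\<tau> by (subst AE_restrict_space_iff[OF \<Omega>\<tau>]) auto
  show ?thesis
  proof (rule that[OF T(1)])
    show "supported_on \<Omega> T (frontier ?E)"
      unfolding supported_on_def
    proof (intro ballI impI)
      fix A assume A: "A \<in> borel_subsets \<Omega>" "A \<inter> frontier ?E = {}"
      have "AE x in M. x \<notin> A" using aeM by (rule eventually_mono) (use A(2) in blast)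
      then have "emeasure M A = 0" using A(1) Ms by (subst (asm) AE_iff_measurable[of A]) (auto simp: spM dest: borel_subsets_subset)
      then have "measure M A = 0" by (simp add: measure_def)
      then show "T A = 0" using dominatesD(4)[OF T(2) A(1)] by simp
    qed
    fix \<phi> assume \<phi>: "\<phi> \<in> W1_inf \<Omega>"
    have NT: "?v \<phi> \<longlonglongrightarrow> normal_trace \<rho> \<Omega> F ?E \<phi>"
      using normal_trace_tendsto[OF \<Omega> \<rho> F m Xc, where E = ?E] \<eta>(2,3) \<eta>limp E \<phi> by (simp add: X_def)
    \<comment> \<open>\<phi> need not extend continuously beyond \<Omega>. Multiplied by a cutoff it
      becomes an element of \<open>Cc \<Omega>\<close> that agrees with \<phi> on
      \<open>closure U\<close>, which contains all shells and the frontier.\<close>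
    obtain \<zeta> where \<zeta>: "\<zeta> \<in> Cc_inf \<Omega>" "\<And>x. x \<in> closure U \<Longrightarrow> \<zeta> x = 1"
      using smooth_cutoff[OF \<rho> U(2) \<Omega> U(3)] by metis
    define f where "f x = \<zeta> x * (indicator \<Omega> x * \<phi> x)" for x
    have f: "f \<in> Cc \<Omega>"
      unfolding f_def[abs_def] by (rule Cc_mult_continuous_on[OF \<Omega> Cc_inf_Cc[OF \<zeta>(1)] W1_inf_continuous[OF \<phi>]])
    have f\<phi>: "f x = \<phi> x" if "x \<in> closure U" for x using that \<zeta>(2) U(3) by (auto simp: f_def)
    have v\<phi>: "?v \<phi> j = ?v f j" for j
    proof (rule vector_integral_cong)
      fix x
      show "\<phi> x *\<^sub>R grad (X j) x = f x *\<^sub>R grad (X j) x"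
      proof (cases "grad (X j) x = 0")
        case False
        then have "\<epsilon> < depth U x" using \<eta>(5)[of "p j" x] by (simp add: X_def)
        then have "x \<in> U" using \<epsilon> by (auto simp: depth_def split: if_splits)
        then have "x \<in> closure U" using closure_subset by blast
        then show ?thesis by (simp add: f\<phi>)
      qed simp
    qed
    let ?t = "signed_set_integral \<Omega> (frontier ?E) T \<phi>"
    have close: "\<bar>normal_trace \<rho> \<Omega> F ?E \<phi> - ?t\<bar> \<le> 0 + e" if e: "e > 0" for e
    proof -
      \<comment> \<open>One third pays for replacing \<open>f\<close> by \<psi> in the normal trace,
        two thirds for doing so in the integral against \<open>T\<close>, where the signed bound has
        the factor 2.\<close>
      have "e / 3 > 0" using e by simp
      then obtain \<psi> where \<psi>: "\<psi> \<in> Cc_inf \<Omega>" "(\<integral>x. \<bar>f x - \<psi> x\<bar> \<partial>M) < e / 3"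
        by (rule Cc_inf_L1_dense[OF \<rho> \<Omega> Mf Ms Cc_integrable[OF f Ms Mf]]) (rule that)
      have d: "(\<lambda>x. f x - \<psi> x) \<in> Cc \<Omega>"
        using Cc_add[OF f Cc_inf_Cc[OF Cc_inf_cmult[OF \<psi>(1), of "-1"]]] by simp
      \<comment> \<open>The bound \<open>vb\<close> holds before the limit for the merely continuous
        \<open>f - \<psi>\<close>, although \<open>L\<close> is controlled only at smooth
        functions.\<close>
      have "\<bar>normal_trace \<rho> \<Omega> F ?E \<phi> - L \<psi>\<bar> \<le> (\<integral>x. \<bar>f x - \<psi> x\<bar> \<partial>M)"
      proof (rule LIMSEQ_le[OF tendsto_rabs[OF tendsto_diff[OF NT L[OF \<psi>(1)]]] lim_abs[OF d]])
        have "\<bar>?v \<phi> j - ?v \<psi> j\<bar> \<le> (\<integral>x. \<bar>f x - \<psi> x\<bar> \<partial>\<sigma> (p j))" for j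
          using vb[OF d, of j] vector_integral_diff[OF Fr m Cc_integrable_scaleR_grad[OF m f Xc] vint[OF \<psi>(1)], of j j]
          by (simp add: v\<phi> scaleR_diff_left)
        then show "\<exists>N. \<forall>j\<ge>N. \<bar>?v \<phi> j - ?v \<psi> j\<bar> \<le> (\<integral>x. \<bar>f x - \<psi> x\<bar> \<partial>\<sigma> (p j))" by blast
      qed
      moreover have "\<bar>?t - L \<psi>\<bar> \<le> 2 * (\<integral>x. \<bar>f x - \<psi> x\<bar> \<partial>M)"
      proof -
        have t: "?t = signed_integral \<Omega> T (\<lambda>x. indicator (frontier ?E) x * f x)"
          unfolding signed_set_integral_def using f\<phi> frsub by (intro signed_integral_cong) (auto simp: indicator_def)
        have fi: "integrable M f" "integrable M \<psi>"
          using Cc_integrable[OF f Ms Mf] Cc_integrable[OF Cc_inf_Cc[OF \<psi>(1)] Ms Mf] by auto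
        have frM: "frontier ?E \<in> sets M"
          using frB frsub U(3) \<Omega> by (auto simp: Ms sets_restrict_space_iff borel_open)
        have gi: "integrable M (\<lambda>x. indicator (frontier ?E) x * f x)"
          using integrable_mult_indicator[OF frM fi(1)] by simp
        have "\<bar>signed_integral \<Omega> T (\<lambda>x. indicator (frontier ?E) x * f x - \<psi> x)\<bar>
            \<le> 2 * (\<integral>x. \<bar>indicator (frontier ?E) x * f x - \<psi> x\<bar> \<partial>M)"
          using gi fi by (intro signed_integral_bound[OF T(1,2)]) auto
        also have "(\<integral>x. \<bar>indicator (frontier ?E) x * f x - \<psi> x\<bar> \<partial>M) = (\<integral>x. \<bar>f x - \<psi> x\<bar> \<partial>M)"
        proof (rule integral_cong_AE)
          show "AE x in M. \<bar>indicator (frontier ?E) x * f x - \<psi> x\<bar> = \<bar>f x - \<psi> x\<bar>"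
            using aeM by (rule eventually_mono) simp
        qed (use gi fi in auto)
        finally show ?thesis
          unfolding t using signed_integral_diff[OF T(1,2) gi fi(2)] T(3)[OF \<psi>(1)] by simp
      qed
      ultimately show ?thesis using \<psi>(2) by linarith
    qed
    have "\<bar>normal_trace \<rho> \<Omega> F ?E \<phi> - ?t\<bar> \<le> 0" by (rule field_le_epsilon) (rule close)
    then show "normal_trace \<rho> \<Omega> F ?E \<phi> = ?t" by simp
  qed
qed

text \<open>Boundedness excludes \<open>U = UNIV\<close>, whose frontier is empty and for which
  \<open>infdist\<close> is 0 by convention.\<close>

lemma infdist_frontier_pos:
  fixes U :: "'a::euclidean_space set"
  assumes U: "open U" "bounded U" and x: "x \<in> U"
  shows "infdist x (frontier U) > 0"
proof (rule infdist_pos_not_in_closed[OF frontier_closed])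
  show "frontier U \<noteq> {}" using x U(2) not_bounded_UNIV by (auto simp: frontier_eq_empty)
  show "x \<notin> frontier U" using x U(1) by (simp add: frontier_def interior_open)
qed

lemma normal_trace_inner_set_tendsto:
  fixes \<Omega> U :: "'a::euclidean_space set" and \<rho> :: "'a \<Rightarrow> real" and F :: "'a set \<Rightarrow> 'a"
  assumes \<Omega>: "open \<Omega>" and \<rho>: "standard_mollifier \<rho>" and F: "F \<in> DM_ext \<Omega>"
    and U: "open U" "bounded U" and \<phi>: "\<phi> \<in> W1_inf \<Omega>"
    and e: "\<And>k::nat. e k > 0" "e \<longlonglongrightarrow> 0"
  shows "(\<lambda>k. normal_trace \<rho> \<Omega> F (inner_set U (e k)) \<phi>) \<longlonglongrightarrow> normal_trace \<rho> \<Omega> F U \<phi>"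
proof -
  obtain C where C: "C \<ge> 0" "\<And>x. x \<in> \<Omega> \<Longrightarrow> \<bar>\<phi> x\<bar> \<le> C" by (rule W1_inf_bounded[OF \<Omega> \<phi>]) (rule that)
  have ind: "(\<lambda>k. indicator (inner_set U (e k)) x :: real) \<longlonglongrightarrow> indicator U x" for x
  proof (cases "x \<in> U")
    case True
    have "\<forall>\<^sub>F k in sequentially. e k < infdist x (frontier U)"
      using e(2) infdist_frontier_pos[OF U True] by (intro order_tendstoD) auto
    then have "\<forall>\<^sub>F k in sequentially. (indicator (inner_set U (e k)) x :: real) = indicator U x"
      by (rule eventually_mono) (simp add: inner_set_def True)
    then show ?thesis by (rule tendsto_eventually)
  qed (simp add: inner_set_def)
  have B: "inner_set U (e k) \<in> sets borel" "U \<in> sets borel" for k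
    using open_inner_set[of "e k" U] e(1)[of k] U(1) by (auto simp: borel_open)
  \<comment> \<open>Stated for a general measure so as to apply to the divergence and to the
    pairing.\<close>
  have lim: "(\<lambda>k. signed_set_integral \<Omega> (inner_set U (e k)) \<mu> f) \<longlonglongrightarrow> signed_set_integral \<Omega> U \<mu> f"
    if \<mu>: "radon_measure_on \<Omega> \<mu>" and f: "\<And>m. sets m = borel_subsets \<Omega> \<Longrightarrow> f \<in> borel_measurable m"
      and bd: "\<And>x. x \<in> \<Omega> \<Longrightarrow> \<bar>f x\<bar> \<le> K" for \<mu> :: "'a set \<Rightarrow> real" and f K
  proof -
    obtain m where m: "dominates m \<Omega> \<mu>" using exists_dominates[OF \<mu>] .
    note s = dominatesD(2)[OF m]
    have im: "(indicator A :: 'a \<Rightarrow> real) \<in> borel_measurable m" if "A \<in> sets borel" for A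
      using measurable_restrict_space1[OF borel_measurable_indicator[OF that]]
      by (simp add: measurable_cong_sets[OF s refl])
    show ?thesis
      unfolding signed_set_integral_def
    proof (rule signed_integral_dominated_convergence[OF \<mu> m])
      show "(\<lambda>x. indicator U x * f x) \<in> borel_measurable m"
        "(\<lambda>x. indicator (inner_set U (e k)) x * f x) \<in> borel_measurable m" for k
        by (intro borel_measurable_times im B f[OF s])+
      show "(\<lambda>k. indicator (inner_set U (e k)) x * f x) \<longlonglongrightarrow> indicator U x * f x" for x
        by (intro tendsto_mult_right ind)
      show "\<bar>indicator (inner_set U (e k)) x * f x\<bar> \<le> \<bar>K\<bar>" if "x \<in> \<Omega>" for k x
        using bd[OF that] by (auto simp: indicator_def)
    qed
  qed
  have "(\<lambda>k. signed_set_integral \<Omega> (inner_set U (e k)) (divergence \<Omega> F) \<phi>)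
      \<longlonglongrightarrow> signed_set_integral \<Omega> U (divergence \<Omega> F) \<phi>"
    by (rule lim[OF divergence_radon[OF \<Omega> \<rho> F] W1_inf_measurable[OF \<phi>] C(2)])
  moreover have "(\<lambda>k. signed_set_integral \<Omega> (inner_set U (e k)) (pairing \<rho> \<Omega> \<phi> F) (\<lambda>_. 1))
      \<longlonglongrightarrow> signed_set_integral \<Omega> U (pairing \<rho> \<Omega> \<phi> F) (\<lambda>_. 1)"
    by (rule lim[OF pairing_radon[OF \<Omega> \<rho> \<phi> F], of _ 1]) auto
  ultimately show ?thesis
    unfolding normal_trace_def by (intro tendsto_diff tendsto_minus)
qed

theorem theorem3p3:
  fixes \<Omega> U :: "'a::euclidean_space set"
    and F :: "'a set \<Rightarrow> 'a"
    and \<rho> :: "'a \<Rightarrow> real"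
  assumes "DIM('a) \<ge> 2"
    and "open \<Omega>"
    and "standard_mollifier \<rho>"
    and "F \<in> DM_ext \<Omega>"
    and "open U" and "U \<Subset> \<Omega>"
  shows "\<exists>N \<subseteq> {0<..}. N \<in> null_sets lebesgue \<and>
    (\<exists>T :: real \<Rightarrow> 'a set \<Rightarrow> real.
      (\<forall>\<epsilon> \<in> {0<..} - N.
         radon_measure_on \<Omega> (T \<epsilon>) \<and>
         supported_on \<Omega> (T \<epsilon>) (frontier (inner_set U \<epsilon>)) \<and>
         (\<forall>\<phi> \<in> W1_inf \<Omega>. normal_trace \<rho> \<Omega> F (inner_set U \<epsilon>) \<phi> =
            signed_set_integral \<Omega> (frontier (inner_set U \<epsilon>)) (T \<epsilon>) \<phi>)) \<and>
      (\<forall>e :: nat \<Rightarrow> real. (\<forall>k. e k \<in> {0<..} - N) \<longrightarrow> e \<longlonglongrightarrow> 0 \<longrightarrow>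
         (\<forall>\<phi> \<in> W1_inf \<Omega>.
            (\<lambda>k. signed_set_integral \<Omega> (frontier (inner_set U (e k))) (T (e k)) \<phi>)
              \<longlonglongrightarrow> normal_trace \<rho> \<Omega> F U \<phi>)))"
proof -
  have U: "compact (closure U)" "closure U \<subseteq> \<Omega>" using assms(6) by (auto simp: compactly_inside_def)
  have bU: "bounded U" using bounded_subset[OF compact_imp_bounded[OF U(1)] closure_subset] .
  obtain m where m: "dominates m \<Omega> F" using exists_dominates[OF DM_ext_radon[OF assms(4)]] .
  let ?P = "\<lambda>\<epsilon> T. radon_measure_on \<Omega> T \<and> supported_on \<Omega> T (frontier (inner_set U \<epsilon>)) \<and>
     (\<forall>\<phi> \<in> W1_inf \<Omega>. normal_trace \<rho> \<Omega> F (inner_set U \<epsilon>) \<phi> =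
        signed_set_integral \<Omega> (frontier (inner_set U \<epsilon>)) T \<phi>)"
  have "AE \<epsilon> in lborel. \<exists>C::real. \<exists>\<^sub>F k in sequentially.
    (real k + 1) * measure m {x \<in> space m. \<epsilon> < depth U x \<and> depth U x \<le> \<epsilon> + 1 / (real k + 1)} \<le> C"
    by (rule shell_mass_AE[OF dominatesD(1)[OF m]
          continuous_borel_subsets_measurable[OF dominatesD(2)[OF m] continuous_on_depth]])
  then have "AE \<epsilon> in lborel. \<epsilon> > 0 \<longrightarrow> (\<exists>T. ?P \<epsilon> T)"
  proof (rule eventually_mono, intro impI)
    fix \<epsilon> :: real
    assume "\<exists>C::real. \<exists>\<^sub>F k in sequentially.
      (real k + 1) * measure m {x \<in> space m. \<epsilon> < depth U x \<and> depth U x \<le> \<epsilon> + 1 / (real k + 1)} \<le> C"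
      and \<epsilon>: "\<epsilon> > 0"
    then obtain C where C: "\<exists>\<^sub>F k in sequentially.
      (real k + 1) * measure m {x \<in> space m. \<epsilon> < depth U x \<and> depth U x \<le> \<epsilon> + 1 / (real k + 1)} \<le> C" by blast
    show "\<exists>T. ?P \<epsilon> T"
      by (rule trace_measure_exists[OF assms(2,3,4) m assms(5) U \<epsilon> C]) blast
  qed
  then obtain N0 where N0: "N0 \<in> null_sets lborel" "{\<epsilon>. \<not> (\<epsilon> > 0 \<longrightarrow> (\<exists>T. ?P \<epsilon> T))} \<subseteq> N0"
    by (auto simp: eventually_ae_filter)
  \<comment> \<open>The set of bad depths may fail to be Borel, but it lies in a Borel null set and
    is therefore null for the completed measure. Since \<phi> is quantified inside
    \<open>?P\<close>, the set is the same for all \<phi>.\<close>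
  define N where "N = {\<epsilon>. \<not> (\<epsilon> > 0 \<longrightarrow> (\<exists>T. ?P \<epsilon> T))}"
  have N: "N \<subseteq> {0<..}" "N \<in> null_sets lebesgue"
    using N0 null_sets_completionI[OF N0(1)] null_sets_completion_subset[of N N0 lborel] by (auto simp: N_def)
  have "\<forall>\<epsilon>\<in>{0<..} - N. \<exists>T. ?P \<epsilon> T" by (auto simp: N_def)
  then obtain T where T: "\<And>\<epsilon>. \<epsilon> \<in> {0<..} - N \<Longrightarrow> ?P \<epsilon> (T \<epsilon>)" by metis
  show ?thesis
  proof (intro exI[of _ N] conjI N exI[of _ T] ballI allI impI)
    fix \<epsilon> assume "\<epsilon> \<in> {0<..} - N"
    from T[OF this] show "radon_measure_on \<Omega> (T \<epsilon>)" "supported_on \<Omega> (T \<epsilon>) (frontier (inner_set U \<epsilon>))"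
      "\<And>\<phi>. \<phi> \<in> W1_inf \<Omega> \<Longrightarrow> normal_trace \<rho> \<Omega> F (inner_set U \<epsilon>) \<phi> =
        signed_set_integral \<Omega> (frontier (inner_set U \<epsilon>)) (T \<epsilon>) \<phi>" by auto
  next
    fix e :: "nat \<Rightarrow> real" and \<phi>
    assume e: "\<forall>k. e k \<in> {0<..} - N" "e \<longlonglongrightarrow> 0" and \<phi>: "\<phi> \<in> W1_inf \<Omega>"
    have "e k > 0" for k using e(1) by auto
    \<comment> \<open>The convergence concerns normal traces alone; the representation then turns
      each of them into an integral against \<open>T (e k)\<close>.\<close>
    from normal_trace_inner_set_tendsto[OF assms(2,3,4,5) bU \<phi> this e(2)]
    show "(\<lambda>k. signed_set_integral \<Omega> (frontier (inner_set U (e k))) (T (e k)) \<phi>)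
        \<longlonglongrightarrow> normal_trace \<rho> \<Omega> F U \<phi>"
      using T e(1) \<phi> by simp
  qed
qed

end
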